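(* Let $K$ be a subgroup of $IA_n$, and let $\tau:\mathcal{L}(K)\to\mathrm{Der}(\mathfrak{L}_n)$ be the corresponding Johnson morphism. Suppose that $K$ satisfies the Andreadakis equality (which means that $\tau$ is injective). Suppose, moreover, that every homogeneous element of $\tau(\mathcal{L}(K))\cap\mathrm{ad}(\mathfrak{L}_n)$ comes from an element of $K\cap\mathrm{Inn}(F_n)$; precisely, it equals $\tau(\overline{x})$ for some $x\in K\cap\mathrm{Inn}(F_n)$. Then $\mathrm{Inn}(F_n)K$ satisfies the Andreadakis equality.
   Context: $F_n$ is the free group on $n$ generators, $IA_n$ is the group of automorphisms of $F_n$ acting trivially on $F_n^{ab}$, and $\mathrm{Inn}(F_n)$ is the group of inner automorphisms. The lower central series of a group $K$ is $\Gamma_1(K)=K$, $\Gamma_{j+1}(K)=[K,\Gamma_j(K)]$. Its associated graded Lie ring is $\mathcal{L}(K)=\bigoplus_{j\geq1}\Gamma_j(K)/\Gamma_{j+1}(K)$, with bracket induced by commutators. $\mathfrak{L}_n=\mathcal{L}(F_n)$ is the free Lie ring on $n$ generators, $\mathrm{Der}(\mathfrak{L}_n)$ is its Lie ring of derivations, and $\mathrm{ad}(\mathfrak{L}_n)$ is the Lie subring of inner derivations $\mathrm{ad}_X=[X,-]$. For $K\subseteq IA_n$, the Johnson morphism $\tau:\mathcal{L}(K)\to\mathrm{Der}(\mathfrak{L}_n)$ sends the class $\overline{k}$ of $k\in\Gamma_j(K)$ in $\Gamma_j(K)/\Gamma_{j+1}(K)$ to the derivation (raising the degree by $j$) which sends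 the class $\overline{h}$ of $h\in\Gamma_i(F_n)$ to the class of $k(h)h^{-1}$ in $\Gamma_{i+j}(F_n)/\Gamma_{i+j+1}(F_n)$. For $x\in K$, $\overline{x}$ denotes its class in $\Gamma_d(K)/\Gamma_{d+1}(K)$ where $x\in\Gamma_d(K)\setminus\Gamma_{d+1}(K)$ (and $\overline{x}=0$ if $x\in\bigcap_d\Gamma_d(K)$). The Andreadakis filtration on $IA_n$ is $\mathcal{A}_j=\{\varphi\in\mathrm{Aut}(F_n) : \forall i\geq1,\ \forall g\in\Gamma_i(F_n),\ \varphi(g)g^{-1}\in\Gamma_{i+j}(F_n)\}$. A subgroup $K\subseteq IA_n$ satisfies the Andreadakis equality if the inclusions $\Gamma_j(K)\subseteq K\cap\Gamma_j(IA_n)\subseteq K\cap\mathcal{A}_j$ are equalities for all $j\geq1$. *)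

theory Defs
  imports "HOL-Algebra.Bij" "HOL-Algebra.FiniteProduct" "HOL-Algebra.Product_Groups"
begin

section \<open>Free groups\<close>

text \<open>The free group on \<open>S\<close>, realised on reduced words.  The letter \<open>(s, True)\<close> is the
  generator \<open>s\<close> and \<open>(s, False)\<close> its formal inverse.\<close>

definition cancels :: "'s \<times> bool \<Rightarrow> 's \<times> bool \<Rightarrow> bool" where
  "cancels x y \<longleftrightarrow> fst x = fst y \<and> snd x \<noteq> snd y"

abbreviation reduced :: "('s \<times> bool) list \<Rightarrow> bool" where
  "reduced w \<equiv> successively (\<lambda>x y. \<not> cancels x y) w"

fun push :: "'s \<times> bool \<Rightarrow> ('s \<times> bool) list \<Rightarrow> ('s \<times> bool) list" where
  "push x [] = [x]"
| "push x (y # w) = (if cancels x y then w else x # y # w)"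

definition free_group :: "'s set \<Rightarrow> ('s \<times> bool) list monoid" where
  "free_group S = \<lparr>carrier = {w. set w \<subseteq> S \<times> UNIV \<and> reduced w},
                   monoid.mult = (\<lambda>u v. foldr push u v),
                   one = []\<rparr>"

definition inverse_letter :: "'s \<times> bool \<Rightarrow> 's \<times> bool" where
  "inverse_letter x = (fst x, \<not> snd x)"

lemma reduced_push: "reduced w \<Longrightarrow> reduced (push x w)"
  by (cases w; cases "tl w") auto

lemma set_push: "set (push x w) \<subseteq> insert x (set w)"
  by (cases w) auto

lemma push_Cons_reduced: "reduced (x # w) \<Longrightarrow> push x w = x # w"
  by (cases w) auto

lemma push_cancels:
  assumes "cancels x y" "reduced w"
  shows "push x (push y w) = w"
proof (cases w)
  case Nil
  with assms show ?thesis by simp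
next
  case (Cons z w')
  show ?thesis
  proof (cases "cancels y z")
    case True
    with assms(1) have "x = z"
      by (auto simp: cancels_def prod_eq_iff)
    with True Cons assms show ?thesis
      by (simp add: push_Cons_reduced)
  qed (use Cons assms in simp)
qed

lemma reduced_foldr_push: "reduced v \<Longrightarrow> reduced (foldr push u v)"
  by (induction u) (auto simp: reduced_push)

lemma set_foldr_push: "set (foldr push u v) \<subseteq> set u \<union> set v"
  using set_push by (induction u) fastforce+

lemma foldr_push_push:
  assumes "reduced w"
  shows "foldr push (push x t) w = push x (foldr push t w)"
  using assms by (cases t) (auto simp: push_cancels reduced_foldr_push)

lemma foldr_push_assoc:
  assumes "reduced w"
  shows "foldr push (foldr push u v) w = foldr push u (foldr push v w)"
  using assms by (induction u) (auto simp: foldr_push_push)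

lemma foldr_push_Nil: "reduced u \<Longrightarrow> foldr push u [] = u"
  by (induction u) (auto simp: successively_Cons intro!: push_Cons_reduced)

lemma foldr_push_inverse:
  "foldr push (rev (map inverse_letter u)) (foldr push u []) = []"
proof (induction u)
  case (Cons x u)
  have "push (inverse_letter x) (push x (foldr push u [])) = foldr push u []"
  proof (rule push_cancels)
    show "cancels (inverse_letter x) x" by (simp add: cancels_def inverse_letter_def)
  qed (simp add: reduced_foldr_push)
  with Cons show ?case by simp
qed simp

theorem group_free_group: "group (free_group S)"
proof (rule groupI)
  fix x y assume "x \<in> carrier (free_group S)" "y \<in> carrier (free_group S)"
  then show "x \<otimes>\<^bsub>free_group S\<^esub> y \<in> carrier (free_group S)"
    using set_foldr_push[of x y] by (auto simp: free_group_def reduced_foldr_push)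
next
  fix x assume x: "x \<in> carrier (free_group S)"
  have red: "reduced (rev (map inverse_letter x))"
    using x by (auto simp: free_group_def successively_map inverse_letter_def cancels_def
        elim!: successively_mono)
  then have "rev (map inverse_letter x) \<in> carrier (free_group S)"
    using x by (auto simp: free_group_def inverse_letter_def)
  moreover have "rev (map inverse_letter x) \<otimes>\<^bsub>free_group S\<^esub> x = \<one>\<^bsub>free_group S\<^esub>"
    using x foldr_push_inverse[of x] foldr_push_Nil[of x] by (simp add: free_group_def)
  ultimately show "\<exists>y\<in>carrier (free_group S). y \<otimes>\<^bsub>free_group S\<^esub> x = \<one>\<^bsub>free_group S\<^esub>"
    by blast
qed (auto simp: free_group_def foldr_push_assoc)

lemma free_group_universal:
  assumes "group H" and f: "f \<in> S \<rightarrow> carrier H"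
  shows "\<exists>!h. h \<in> hom (free_group S) H \<inter> extensional (carrier (free_group S)) \<and>
              (\<forall>s\<in>S. h [(s, True)] = f s)"
proof -
  interpret H: group H by fact
  interpret FS: group "free_group S" by (rule group_free_group)
  define e where "e = (\<lambda>x. if snd x then f (fst x) else inv\<^bsub>H\<^esub> f (fst x))"
  define p where "p w = foldr (\<lambda>x a. e x \<otimes>\<^bsub>H\<^esub> a) w \<one>\<^bsub>H\<^esub>" for w
  have e: "e x \<in> carrier H" if "fst x \<in> S" for x
    using that f by (auto simp: e_def)
  have p: "p w \<in> carrier H" if "set w \<subseteq> S \<times> UNIV" for w
    using that by (induction w) (auto simp: p_def e)
  have e_cancels: "e x \<otimes>\<^bsub>H\<^esub> e y = \<one>\<^bsub>H\<^esub>" if "cancels x y" "fst x \<in> S" for x y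
    using that f by (auto simp: cancels_def e_def Pi_iff)
  have p_push: "p (push x w) = e x \<otimes>\<^bsub>H\<^esub> p w" if "fst x \<in> S" "set w \<subseteq> S \<times> UNIV" for x w
  proof (cases w)
    case (Cons y w')
    show ?thesis
    proof (cases "cancels x y")
      case True
      have "e x \<otimes>\<^bsub>H\<^esub> (e y \<otimes>\<^bsub>H\<^esub> p w') = e x \<otimes>\<^bsub>H\<^esub> e y \<otimes>\<^bsub>H\<^esub> p w'"
        using that Cons by (intro H.m_assoc[symmetric] e p) auto
      also have "\<dots> = p w'"
        using that Cons True p[of w'] by (simp add: e_cancels)
      finally show ?thesis using Cons True by (simp add: p_def)
    qed (use Cons in \<open>simp add: p_def\<close>)
  qed (simp add: p_def)
  have p_mult: "p (foldr push u v) = p u \<otimes>\<^bsub>H\<^esub> p v"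
    if "set u \<subseteq> S \<times> UNIV" "set v \<subseteq> S \<times> UNIV" for u v
    using that(1)
  proof (induction u)
    case (Cons x u)
    have "set (foldr push u v) \<subseteq> S \<times> UNIV"
      using set_foldr_push[of u v] Cons.prems that(2) by auto
    then have "p (foldr push (x # u) v) = e x \<otimes>\<^bsub>H\<^esub> (p u \<otimes>\<^bsub>H\<^esub> p v)"
      using Cons by (auto simp: p_push)
    also have "\<dots> = e x \<otimes>\<^bsub>H\<^esub> p u \<otimes>\<^bsub>H\<^esub> p v"
      using Cons.prems that(2) by (intro H.m_assoc[symmetric] e p) auto
    finally show ?case by (simp add: p_def)
  qed (use p[OF that(2)] in \<open>simp add: p_def\<close>)
  let ?C = "carrier (free_group S)"
  show ?thesis
  proof (rule ex1I, intro conjI ballI IntI)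
    show "restrict p ?C \<in> hom (free_group S) H"
    proof (rule homI)
      fix u v assume uv: "u \<in> ?C" "v \<in> ?C"
      then have "u \<otimes>\<^bsub>free_group S\<^esub> v \<in> ?C" by (rule FS.m_closed)
      with uv show "restrict p ?C (u \<otimes>\<^bsub>free_group S\<^esub> v) = restrict p ?C u \<otimes>\<^bsub>H\<^esub> restrict p ?C v"
        by (auto simp: free_group_def p_mult)
    qed (auto simp: free_group_def intro: p)
    show "restrict p ?C [(s, True)] = f s" if "s \<in> S" for s
      using that f by (auto simp: free_group_def p_def e_def Pi_iff)
  next
    fix h assume h: "h \<in> hom (free_group S) H \<inter> extensional ?C \<and> (\<forall>s\<in>S. h [(s, True)] = f s)"
    then interpret h: group_hom "free_group S" H h
      by unfold_locales auto
    have h_letter: "h [x] = e x" if "fst x \<in> S" for x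
    proof (cases x)
      case (Pair s b)
      have "[(s, True)] \<in> ?C" "[(s, False)] \<in> ?C"
        using that Pair by (auto simp: free_group_def)
      moreover have "[(s, False)] \<otimes>\<^bsub>free_group S\<^esub> [(s, True)] = \<one>\<^bsub>free_group S\<^esub>"
        by (simp add: free_group_def cancels_def)
      ultimately have "h [(s, False)] = inv\<^bsub>H\<^esub> h [(s, True)]"
        by (metis FS.inv_equality h.hom_inv)
      with h that Pair show ?thesis by (cases b) (auto simp: e_def)
    qed
    have "h w = p w" if "w \<in> ?C" for w
      using that
    proof (induction w)
      case Nil
      then show ?case using h.hom_one by (simp add: free_group_def p_def)
    next
      case (Cons x w)
      then have xw: "[x] \<in> ?C" "w \<in> ?C" "fst x \<in> S" "push x w = x # w"
        by (auto simp: free_group_def successively_Cons intro: push_Cons_reduced)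
      then have "h (x # w) = h ([x] \<otimes>\<^bsub>free_group S\<^esub> w)" by (simp add: free_group_def)
      also have "\<dots> = e x \<otimes>\<^bsub>H\<^esub> p w" using xw Cons.IH by (simp add: h_letter)
      finally show ?case by (simp add: p_def)
    qed
    with h show "h = restrict p ?C"
      by (intro extensionalityI[of _ ?C]) auto
  qed auto
qed

abbreviation F :: "nat \<Rightarrow> (nat \<times> bool) list monoid" where
  "F n \<equiv> free_group {..<n}"


section \<open>Lower central series and associated graded Lie ring\<close>

definition commutator :: "('a, 'm) monoid_scheme \<Rightarrow> 'a \<Rightarrow> 'a \<Rightarrow> 'a" where
  "commutator G x y = x \<otimes>\<^bsub>G\<^esub> y \<otimes>\<^bsub>G\<^esub> inv\<^bsub>G\<^esub> x \<otimes>\<^bsub>G\<^esub> inv\<^bsub>G\<^esub> y"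

text \<open>Indexing starts at 1; the value at 0 is irrelevant.\<close>

fun lower_central :: "('a, 'm) monoid_scheme \<Rightarrow> nat \<Rightarrow> 'a set" where
  "lower_central G 0 = carrier G"
| "lower_central G (Suc 0) = carrier G"
| "lower_central G (Suc (Suc j)) =
     generate G {commutator G x y | x y. x \<in> carrier G \<and> y \<in> lower_central G (Suc j)}"

definition lc_quotient :: "('a, 'm) monoid_scheme \<Rightarrow> nat \<Rightarrow> 'a set monoid" where
  "lc_quotient G j = (G\<lparr>carrier := lower_central G j\<rparr>) Mod lower_central G (j + 1)"

text \<open>The additive group of a Lie ring is the underlying monoid record,
  so it is written multiplicatively.\<close>

record 'a lie_ring = "'a monoid" +
  bracket :: "'a \<Rightarrow> 'a \<Rightarrow> 'a"

text \<open>The bracket of a class in degree \<open>i\<close> and a class in degree \<open>j\<close>.  As for products in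
  \<^const>\<open>FactGroup\<close>, the class is obtained as the union over all representatives;
  all the cosets in the union coincide.\<close>

definition class_bracket ::
    "('a, 'm) monoid_scheme \<Rightarrow> nat \<Rightarrow> nat \<Rightarrow> 'a set \<Rightarrow> 'a set \<Rightarrow> 'a set" where
  "class_bracket G i j A B =
     (\<Union>a\<in>A. \<Union>b\<in>B. lower_central G (i + j + 1) #>\<^bsub>G\<^esub> commutator G a b)"

definition assoc_graded :: "('a, 'm) monoid_scheme \<Rightarrow> (nat \<Rightarrow> 'a set) lie_ring" where
  "assoc_graded G =
     (let S = sum_group {1..} (lc_quotient G)
      in \<lparr>carrier = carrier S, monoid.mult = monoid.mult S, one = one S,
          bracket = (\<lambda>X Y. \<lambda>m\<in>{1..}.
            finprod (lc_quotient G m) (\<lambda>i. class_bracket G i (m - i) (X i) (Y (m - i))) {1..<m})\<rparr>)"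

definition graded_part :: "('a, 'm) monoid_scheme \<Rightarrow> nat \<Rightarrow> (nat \<Rightarrow> 'a set) set" where
  "graded_part G i =
     {X \<in> carrier (assoc_graded G). \<forall>m\<ge>1. m \<noteq> i \<longrightarrow> X m = \<one>\<^bsub>lc_quotient G m\<^esub>}"

text \<open>The class of \<open>x\<close>, in the unique degree \<open>d\<close> with \<open>x \<in> \<Gamma>\<^sub>d - \<Gamma>\<^sub>d\<^sub>+\<^sub>1\<close>; it is zero if there
  is no such \<open>d\<close>.\<close>

definition graded_class :: "('a, 'm) monoid_scheme \<Rightarrow> 'a \<Rightarrow> nat \<Rightarrow> 'a set" where
  "graded_class G x =
     (\<lambda>d\<in>{1..}. if x \<in> lower_central G d - lower_central G (d + 1)
                 then lower_central G (d + 1) #>\<^bsub>G\<^esub> x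
                 else \<one>\<^bsub>lc_quotient G d\<^esub>)"


section \<open>Derivations\<close>

definition derivations :: "('a, 'm) lie_ring_scheme \<Rightarrow> ('a \<Rightarrow> 'a) set" where
  "derivations L =
     {D \<in> hom L L \<inter> extensional (carrier L).
        \<forall>x\<in>carrier L. \<forall>y\<in>carrier L.
          D (bracket L x y) = bracket L (D x) y \<otimes>\<^bsub>L\<^esub> bracket L x (D y)}"

definition Der :: "('a, 'm) lie_ring_scheme \<Rightarrow> ('a \<Rightarrow> 'a) lie_ring" where
  "Der L = \<lparr>carrier = derivations L,
            monoid.mult = (\<lambda>D E. \<lambda>x\<in>carrier L. D x \<otimes>\<^bsub>L\<^esub> E x),
            one = (\<lambda>x\<in>carrier L. \<one>\<^bsub>L\<^esub>),
            bracket = (\<lambda>D E. \<lambda>x\<in>carrier L. D (E x) \<otimes>\<^bsub>L\<^esub> inv\<^bsub>L\<^esub> (E (D x)))\<rparr>"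

definition ad :: "('a, 'm) lie_ring_scheme \<Rightarrow> 'a \<Rightarrow> 'a \<Rightarrow> 'a" where
  "ad L x = (\<lambda>y\<in>carrier L. bracket L x y)"

definition homogeneous_derivation ::
    "('a, 'm) monoid_scheme \<Rightarrow> ((nat \<Rightarrow> 'a set) \<Rightarrow> (nat \<Rightarrow> 'a set)) \<Rightarrow> bool" where
  "homogeneous_derivation G D \<longleftrightarrow>
     D \<in> carrier (Der (assoc_graded G)) \<and>
     (\<exists>d. \<forall>i\<ge>1. \<forall>X\<in>graded_part G i. D X \<in> graded_part G (i + d))"


section \<open>Automorphism groups, the Johnson morphism and the Andreadakis filtration\<close>

text \<open>Groups of automorphisms are subsets of \<^term>\<open>auto G\<close>, considered as groups as follows.\<close>

abbreviation aut_subgroup ::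
    "('a, 'm) monoid_scheme \<Rightarrow> ('a \<Rightarrow> 'a) set \<Rightarrow> ('a \<Rightarrow> 'a) monoid" where
  "aut_subgroup G K \<equiv> (AutoGroup G)\<lparr>carrier := K\<rparr>"

text \<open>The automorphism of the abelianisation induced by \<open>\<phi>\<close> maps a coset to its image.\<close>

definition IA :: "('a, 'm) monoid_scheme \<Rightarrow> ('a \<Rightarrow> 'a) set" where
  "IA G = {\<phi> \<in> auto G. \<forall>A\<in>carrier (G Mod derived G (carrier G)). \<phi> ` A = A}"

definition Inn :: "('a, 'm) monoid_scheme \<Rightarrow> ('a \<Rightarrow> 'a) set" where
  "Inn G = (\<lambda>g. \<lambda>h\<in>carrier G. g \<otimes>\<^bsub>G\<^esub> h \<otimes>\<^bsub>G\<^esub> inv\<^bsub>G\<^esub> g) ` carrier G"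

text \<open>The class of \<open>k(h) h\<^sup>-\<^sup>1\<close> for the class \<open>\<kappa>\<close> of \<open>k\<close> in degree \<open>j\<close> and the class \<open>\<eta>\<close> of \<open>h\<close> in
  degree \<open>i\<close>, obtained as in \<^const>\<open>class_bracket\<close>.\<close>

definition class_action ::
    "('a, 'm) monoid_scheme \<Rightarrow> nat \<Rightarrow> nat \<Rightarrow> ('a \<Rightarrow> 'a) set \<Rightarrow> 'a set \<Rightarrow> 'a set" where
  "class_action G j i \<kappa> \<eta> =
     (\<Union>k\<in>\<kappa>. \<Union>h\<in>\<eta>. lower_central G (i + j + 1) #>\<^bsub>G\<^esub> (k h \<otimes>\<^bsub>G\<^esub> inv\<^bsub>G\<^esub> h))"

text \<open>The additive extension of \<^const>\<open>class_action\<close> to the direct sums.  Its domain is the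
  associated graded ring of a subgroup of \<^term>\<open>IA G\<close>.\<close>

definition johnson ::
    "('a, 'm) monoid_scheme \<Rightarrow> (nat \<Rightarrow> ('a \<Rightarrow> 'a) set) \<Rightarrow> (nat \<Rightarrow> 'a set) \<Rightarrow> (nat \<Rightarrow> 'a set)" where
  "johnson G X =
     (\<lambda>Y\<in>carrier (assoc_graded G). \<lambda>m\<in>{1..}.
        finprod (lc_quotient G m) (\<lambda>i. class_action G (m - i) i (X (m - i)) (Y i)) {1..<m})"

definition andreadakis_filtration :: "('a, 'm) monoid_scheme \<Rightarrow> nat \<Rightarrow> ('a \<Rightarrow> 'a) set" where
  "andreadakis_filtration G j =
     {\<phi> \<in> auto G. \<forall>i\<ge>1. \<forall>g\<in>lower_central G i.
        \<phi> g \<otimes>\<^bsub>G\<^esub> inv\<^bsub>G\<^esub> g \<in> lower_central G (i + j)}"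

definition andreadakis_equality :: "('a, 'm) monoid_scheme \<Rightarrow> ('a \<Rightarrow> 'a) set \<Rightarrow> bool" where
  "andreadakis_equality G K \<longleftrightarrow>
     subgroup K (aut_subgroup G (IA G)) \<and>
     (\<forall>j\<ge>1.
        lower_central (aut_subgroup G K) j = K \<inter> lower_central (aut_subgroup G (IA G)) j \<and>
        K \<inter> lower_central (aut_subgroup G (IA G)) j = K \<inter> andreadakis_filtration G j)"

end

theory Submission
  imports Defs "HOL-Algebra.Zassenhaus" "HOL-Library.List_Lexorder"
begin

text \<open>Let \<open>c\<^sub>g k\<close> with \<open>k \<in> K\<close> lie in \<open>\<A>\<^sub>j\<close>. If \<open>k \<in> \<A>\<^sub>d\<close> with \<open>d < j\<close>, then also \<open>c\<^sub>g \<in> \<A>\<^sub>d\<close>, and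
  since the associated graded ring of a free group of rank at least two has trivial centre,
  \<open>g \<in> \<Gamma>\<^sub>d\<close>. In degree \<open>d\<close> the classes of \<open>k\<close> and \<open>g\<^sup>-\<^sup>1\<close> induce the same derivation, so by hypothesis
  it comes from an inner automorphism \<open>x \<in> K\<close>; replacing \<open>c\<^sub>g\<close> by \<open>c\<^sub>g x\<close> and \<open>k\<close> by \<open>x\<^sup>-\<^sup>1 k\<close> moves \<open>k\<close>
  into \<open>\<A>\<^sub>d\<^sub>+\<^sub>1\<close>. At \<open>d = j\<close> both factors lie in the \<open>j\<close>-th term of the lower central series of
  \<open>Inn(F\<^sub>n) K\<close>.

  For the centre, \<open>\<Gamma>\<^sub>c\<close> is generated modulo \<open>\<Gamma>\<^sub>c\<^sub>+\<^sub>1\<close> by the commutators bracketed as the standard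
  factorisations of Lyndon words, by rewriting with the Jacobi identity. The Magnus expansion of
  such a commutator has the Lyndon word as its least word of length \<open>c\<close>, with coefficient one, so
  an element of \<open>\<Gamma>\<^sub>c\<close> whose Magnus expansion vanishes in degree \<open>c\<close> lies in \<open>\<Gamma>\<^sub>c\<^sub>+\<^sub>1\<close>. A homogeneous
  noncommutative polynomial of positive degree that commutes with two distinct variables is zero.\<close>

section \<open>Lower central series\<close>

text \<open>Below, \<open>\<Gamma>(j)\<close> is a term of the lower central series,
  \<open>\<A>(j)\<close> a term of the Andreadakis filtration and \<open>c\<^sub>g\<close>
  conjugation by \<open>g\<close>. The hypothesis on \<open>K\<close> speaks of derivations of the
  whole graded ring, whereas the argument moves one automorphism at a time. The action of
  \<open>k\<close> in degree \<open>d\<close> is therefore extended to the direct sum, as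
  \<open>graded_displacement\<close>, and shown to be a derivation before it is compared with
  \<open>johnson\<close> and \<open>ad\<close>. The inner automorphism \<open>x\<close> that the
  hypothesis returns is known only through its class, which may sit in a degree other than
  \<open>d\<close>; the common derivation is then zero and \<open>k\<close> already lies in
  \<open>\<A>(d + 1)\<close>. Freeness enters through the free generators and the Magnus
  homomorphism, and from the Lyndon basis theorem the proof takes spanning and triangularity. In
  rank one the graded ring is abelian, so the argument on the centre breaks down there; for
  \<open>n < 2\<close>, however, \<open>IA (F n)\<close> is trivial.\<close>

declare lower_central.simps(3) [simp del]

context group begin

lemma mult_inv_cancel_left:
  assumes "x \<in> carrier G" "y \<in> carrier G"
  shows "x \<otimes> (inv x \<otimes> y) = y" "inv x \<otimes> (x \<otimes> y) = y"
  using assms by (simp_all add: m_assoc[symmetric])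

text \<open>With the simp rules for the unit and for inverses these give the complete rewrite system
  of group theory, so that a commutator identity valid in all groups needs no further
  argument.\<close>

lemmas word_simps = m_assoc inv_mult_group mult_inv_cancel_left

lemma commutator_closed [simp, intro]:
  "\<lbrakk>x \<in> carrier G; y \<in> carrier G\<rbrakk> \<Longrightarrow> commutator G x y \<in> carrier G"
  by (simp add: commutator_def)

lemma inv_commutator:
  "\<lbrakk>x \<in> carrier G; y \<in> carrier G\<rbrakk> \<Longrightarrow> inv (commutator G x y) = commutator G y x"
  by (simp add: commutator_def word_simps)

lemma commutator_self: "x \<in> carrier G \<Longrightarrow> commutator G x x = \<one>"
  by (simp add: commutator_def word_simps)

lemma commutator_eq_one_iff:
  assumes "x \<in> carrier G" "y \<in> carrier G"
  shows "commutator G x y = \<one> \<longleftrightarrow> x \<otimes> y = y \<otimes> x"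
proof -
  have "commutator G x y = (x \<otimes> y) \<otimes> inv (y \<otimes> x)"
    using assms by (simp add: commutator_def word_simps)
  then show ?thesis using assms by (metis inv_closed inv_equality inv_inv m_closed r_inv)
qed

lemma lower_central_Suc:
  "j \<ge> 1 \<Longrightarrow> lower_central G (Suc j) =
    generate G {commutator G x y | x y. x \<in> carrier G \<and> y \<in> lower_central G j}"
  by (cases j) (auto simp: lower_central.simps(3))

lemma lower_central_Suc_subsetI:
  assumes "j \<ge> 1" "subgroup H G"
    and "\<And>x y. \<lbrakk>x \<in> carrier G; y \<in> lower_central G j\<rbrakk> \<Longrightarrow> commutator G x y \<in> H"
  shows "lower_central G (Suc j) \<subseteq> H"
  unfolding lower_central_Suc[OF assms(1)] using assms(2,3)
  by (intro generate_subgroup_incl) auto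

lemma subgroup_lower_central: "subgroup (lower_central G j) G"
proof (induction j)
  case (Suc j)
  show ?case
  proof (cases j)
    case (Suc i)
    have "lower_central G j \<subseteq> carrier G" using Suc.IH by (rule subgroup.subset)
    then show ?thesis using Suc by (auto simp: lower_central.simps(3) intro!: generate_is_subgroup)
  qed (simp add: subgroup_self)
qed (simp add: subgroup_self)

lemma lower_central_closed: "x \<in> lower_central G j \<Longrightarrow> x \<in> carrier G"
  using subgroup.mem_carrier[OF subgroup_lower_central] .

lemma one_lower_central [simp]: "\<one> \<in> lower_central G j"
  using subgroup.one_closed[OF subgroup_lower_central] .

lemma commutator_lower_central:
  assumes "x \<in> carrier G" "y \<in> lower_central G j"
  shows "commutator G x y \<in> lower_central G (Suc j)"
proof (cases j)
  case 0
  then show ?thesis using assms by auto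
next
  case (Suc i)
  then show ?thesis using assms by (auto simp: lower_central.simps(3) intro!: generate.incl)
qed

end

lemma hom_commutator:
  assumes "group G" "group H" "h \<in> hom G H" "x \<in> carrier G" "y \<in> carrier G"
  shows "h (commutator G x y) = commutator H (h x) (h y)"
proof -
  interpret group_hom G H h using assms by (simp add: group_hom_def group_hom_axioms_def)
  show ?thesis using assms(4,5) by (simp add: commutator_def)
qed

lemma hom_lower_central:
  assumes "group G" "group H" "h \<in> hom G H"
  shows "h ` lower_central G j \<subseteq> lower_central H j"
proof (induction j)
  case (Suc j)
  interpret group_hom G H h using assms by (simp add: group_hom_def group_hom_axioms_def)
  show ?case
  proof (cases "j = 0")
    case False
    let ?C = "\<lambda>G. {commutator G x y | x y. x \<in> carrier G \<and> y \<in> lower_central G j}"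
    have "?C G \<subseteq> carrier G" using G.lower_central_closed by auto
    then have "h ` lower_central G (Suc j) = generate H (h ` ?C G)"
      using False by (simp add: G.lower_central_Suc generate_img)
    also have "\<dots> \<subseteq> generate H (?C H)"
    proof (rule H.mono_generate)
      show "h ` ?C G \<subseteq> ?C H"
        using Suc.IH G.lower_central_closed hom_commutator[OF assms] hom_closed by blast
    qed
    finally show ?thesis using False by (simp add: H.lower_central_Suc)
  qed (use hom_closed in auto)
qed (use assms in \<open>auto simp: hom_def\<close>)

section \<open>Displacement of the lower central series by endomorphisms, and congruences modulo its
  terms\<close>

context group begin

lemma conj_hom: "g \<in> carrier G \<Longrightarrow> (\<lambda>h. g \<otimes> h \<otimes> inv g) \<in> hom G G"
  by (rule homI) (simp_all add: word_simps)

text \<open>The terms are fully invariant, and conjugations are endomorphisms.\<close>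

lemma normal_lower_central: "lower_central G j \<lhd> G"
proof (subst normal_inv_iff, intro conjI ballI)
  fix x h assume "x \<in> carrier G" "h \<in> lower_central G j"
  then show "x \<otimes> h \<otimes> inv x \<in> lower_central G j"
    using hom_lower_central[OF is_group is_group conj_hom[of x], of j] by auto
qed (rule subgroup_lower_central)

lemma lower_central_conj:
  "\<lbrakk>x \<in> carrier G; h \<in> lower_central G j\<rbrakk> \<Longrightarrow> x \<otimes> h \<otimes> inv x \<in> lower_central G j"
  using normal_lower_central by (simp add: normal_inv_iff)

lemma lower_central_mult:
  "\<lbrakk>x \<in> lower_central G j; y \<in> lower_central G j\<rbrakk> \<Longrightarrow> x \<otimes> y \<in> lower_central G j"
  by (rule subgroup.m_closed[OF subgroup_lower_central])

lemma lower_central_inv: "x \<in> lower_central G j \<Longrightarrow> inv x \<in> lower_central G j"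
  by (rule subgroup.m_inv_closed[OF subgroup_lower_central])

lemma lower_central_Suc_subset: "lower_central G (Suc j) \<subseteq> lower_central G j"
proof (cases "j = 0")
  case False
  have "commutator G x y \<in> lower_central G j" if "x \<in> carrier G" "y \<in> lower_central G j" for x y
    unfolding commutator_def
    using that by (intro lower_central_mult lower_central_conj lower_central_inv)
  then show ?thesis
    using False by (intro lower_central_Suc_subsetI subgroup_lower_central) auto
qed auto

lemma lower_central_antimono: "i \<le> j \<Longrightarrow> lower_central G j \<subseteq> lower_central G i"
  using lower_central_Suc_subset by (rule lift_Suc_antimono_le)

text \<open>The condition that defines \<open>\<A>(j)\<close>, separated from the demand that
  \<open>f\<close> be an automorphism, so that it also applies to conjugation as a function that is
  not restricted to the carrier.\<close>

definition displaces :: "('a \<Rightarrow> 'a) \<Rightarrow> nat \<Rightarrow> bool" where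
  "displaces f j \<longleftrightarrow> (\<forall>i\<ge>1. \<forall>g\<in>lower_central G i. f g \<otimes> inv g \<in> lower_central G (i + j))"

lemma displacesD:
  "\<lbrakk>displaces f j; i \<ge> 1; g \<in> lower_central G i\<rbrakk> \<Longrightarrow> f g \<otimes> inv g \<in> lower_central G (i + j)"
  by (simp add: displaces_def)

text \<open>With \<open>f g = a g\<close> and \<open>f' g = b g\<close> the quotient has, up to
  inverses, three factors: the displacement of \<open>b\<close> by \<open>f\<close>, the commutator
  of \<open>a\<close> and \<open>b\<close>, and the displacement of \<open>a\<close> by
  \<open>f'\<close>. The commutator is bounded through the depth of \<open>b\<close> alone; the
  bound by both depths, \<open>lower_central_commutator\<close>, is a consequence of this
  lemma.\<close>

lemma displaces_commute:
  assumes hom: "f \<in> hom G G" "f' \<in> hom G G" and f: "displaces f 1" and f': "displaces f' j"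
    and k: "k \<ge> 1" and g: "g \<in> lower_central G k"
  shows "f (f' g) \<otimes> inv (f' (f g)) \<in> lower_central G (k + Suc j)"
proof -
  interpret f: group_hom G G f using hom is_group by (simp add: group_hom_def group_hom_axioms_def)
  interpret f': group_hom G G f' using hom is_group by (simp add: group_hom_def group_hom_axioms_def)
  define a where "a = f g \<otimes> inv g"
  define b where "b = f' g \<otimes> inv g"
  have g': "g \<in> carrier G" using g by (rule lower_central_closed)
  have a: "a \<in> lower_central G (Suc k)" and b: "b \<in> lower_central G (k + j)"
    using displacesD[OF f k g] displacesD[OF f' k g] by (simp_all add: a_def b_def)
  have ab: "a \<in> carrier G" "b \<in> carrier G" using a b by (auto intro: lower_central_closed)
  have fg: "f g = a \<otimes> g" "f' g = b \<otimes> g" using g' by (simp_all add: a_def b_def m_assoc)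
  have al: "f b \<otimes> inv b \<in> lower_central G (k + Suc j)"
    using displacesD[OF f _ b] k by simp
  have be: "f' a \<otimes> inv a \<in> lower_central G (k + Suc j)"
    using displacesD[OF f' _ a] by simp
  have "f (f' g) \<otimes> inv (f' (f g)) =
     f b \<otimes> inv b \<otimes> inv (commutator G a b) \<otimes> inv (f' a \<otimes> inv a)"
    using ab g' by (simp add: fg commutator_def word_simps)
  moreover have "commutator G a b \<in> lower_central G (k + Suc j)"
    using commutator_lower_central[OF ab(1) b] by simp
  ultimately show ?thesis
    using al be by (simp only: lower_central_mult lower_central_inv)
qed

lemma displaces_conj_1: "g \<in> carrier G \<Longrightarrow> displaces (\<lambda>h. g \<otimes> h \<otimes> inv g) 1"
  using commutator_lower_central[of g] by (auto simp: displaces_def commutator_def)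

text \<open>The term \<open>\<Gamma>(j + 1)\<close> is given by generators; the subgroup property
  lets \<open>displaces_conj\<close> test commutators alone.\<close>

lemma subgroup_displaces_conj:
  "subgroup {g \<in> carrier G. displaces (\<lambda>h. g \<otimes> h \<otimes> inv g) j} G"
proof (rule subgroupI)
  show "{g \<in> carrier G. displaces (\<lambda>h. g \<otimes> h \<otimes> inv g) j} \<noteq> {}"
    using lower_central_closed by (auto intro!: exI[of _ \<one>] simp: displaces_def)
next
  fix g assume "g \<in> {g \<in> carrier G. displaces (\<lambda>h. g \<otimes> h \<otimes> inv g) j}"
  then have g: "g \<in> carrier G" and d: "displaces (\<lambda>h. g \<otimes> h \<otimes> inv g) j" by auto
  have "inv g \<otimes> h \<otimes> inv (inv g) \<otimes> inv h \<in> lower_central G (i + j)"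
    if i: "i \<ge> 1" and h: "h \<in> lower_central G i" for i h
  proof -
    have "inv g \<otimes> h \<otimes> inv (inv g) \<in> lower_central G i"
      using lower_central_conj[OF inv_closed[OF g] h] .
    then have "inv (g \<otimes> (inv g \<otimes> h \<otimes> inv (inv g)) \<otimes> inv g \<otimes> inv (inv g \<otimes> h \<otimes> inv (inv g)))
        \<in> lower_central G (i + j)"
      by (intro lower_central_inv displacesD[OF d i])
    then show ?thesis
      using g lower_central_closed[OF h] by (simp add: word_simps)
  qed
  with g show "inv g \<in> {g \<in> carrier G. displaces (\<lambda>h. g \<otimes> h \<otimes> inv g) j}"
    by (simp add: displaces_def)
next
  fix g g' assume "g \<in> {g \<in> carrier G. displaces (\<lambda>h. g \<otimes> h \<otimes> inv g) j}"
    "g' \<in> {g \<in> carrier G. displaces (\<lambda>h. g \<otimes> h \<otimes> inv g) j}"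
  then have g: "g \<in> carrier G" "g' \<in> carrier G" and d: "displaces (\<lambda>h. g \<otimes> h \<otimes> inv g) j"
    "displaces (\<lambda>h. g' \<otimes> h \<otimes> inv g') j" by auto
  have "(g \<otimes> g') \<otimes> h \<otimes> inv (g \<otimes> g') \<otimes> inv h \<in> lower_central G (i + j)"
    if i: "i \<ge> 1" and h: "h \<in> lower_central G i" for i h
  proof -
    have "g' \<otimes> h \<otimes> inv g' \<in> lower_central G i"
      using g h by (simp add: lower_central_conj)
    then have "(g \<otimes> (g' \<otimes> h \<otimes> inv g') \<otimes> inv g \<otimes> inv (g' \<otimes> h \<otimes> inv g')) \<otimes> (g' \<otimes> h \<otimes> inv g' \<otimes> inv h)
        \<in> lower_central G (i + j)"
      by (rule lower_central_mult[OF displacesD[OF d(1) i] displacesD[OF d(2) i h]])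
    then show ?thesis
      using g lower_central_closed[OF h] by (simp add: word_simps)
  qed
  with g show "g \<otimes> g' \<in> {g \<in> carrier G. displaces (\<lambda>h. g \<otimes> h \<otimes> inv g) j}"
    by (simp add: displaces_def)
qed auto

lemma displaces_conj:
  assumes "g \<in> lower_central G j" "j \<ge> 1"
  shows "displaces (\<lambda>h. g \<otimes> h \<otimes> inv g) j"
  using assms(2,1)
proof (induction j arbitrary: g rule: dec_induct)
  case base
  then show ?case using displaces_conj_1 by simp
next
  case (step j)
  let ?c = "\<lambda>g h. g \<otimes> h \<otimes> inv g"
  have "commutator G x y \<in> {g \<in> carrier G. displaces (?c g) (Suc j)}"
    if x: "x \<in> carrier G" and y: "y \<in> lower_central G j" for x y
  proof -
    have y': "y \<in> carrier G" using y by (rule lower_central_closed)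
    have dy: "displaces (?c y) j" using step.IH y by simp
    have "displaces (?c (commutator G x y)) (Suc j)" unfolding displaces_def
    proof (intro allI impI ballI)
      fix i g assume i: "1 \<le> i" and g: "g \<in> lower_central G i"
      \<comment> \<open>Conjugating \<open>h\<close> by \<open>y x\<close> gives \<open>g\<close>,
        and conjugating it by \<open>x y\<close> gives the conjugate of \<open>g\<close> by
        \<open>[x, y]\<close>. The displacement of \<open>g\<close> thus compares the two orders of
        conjugating \<open>h\<close>.\<close>
      define h where "h = inv (y \<otimes> x) \<otimes> g \<otimes> inv (inv (y \<otimes> x))"
      have g': "g \<in> carrier G" using g by (rule lower_central_closed)
      have h: "h \<in> lower_central G i"
        using x y' g unfolding h_def by (intro lower_central_conj) auto
      have "?c (commutator G x y) g \<otimes> inv g = ?c x (?c y h) \<otimes> inv (?c y (?c x h))"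
        using x y' g' by (simp add: h_def commutator_def word_simps)
      also have "\<dots> \<in> lower_central G (i + Suc j)"
        using displaces_commute[OF conj_hom[OF x] conj_hom[OF y'] displaces_conj_1[OF x] dy i h] .
      finally show "?c (commutator G x y) g \<otimes> inv g \<in> lower_central G (i + Suc j)" .
    qed
    with x y' show ?thesis by simp
  qed
  then have "lower_central G (Suc j) \<subseteq> {g \<in> carrier G. displaces (?c g) (Suc j)}"
    using step.hyps(1) by (intro lower_central_Suc_subsetI subgroup_displaces_conj) auto
  with step.prems show ?case by auto
qed

text \<open>\<open>[x, y]\<close> is the displacement of \<open>y\<close> under conjugation by
  \<open>x\<close>. The estimate on inner displacements does the work usually given to the three
  subgroup lemma.\<close>

lemma lower_central_commutator:
  "\<lbrakk>x \<in> lower_central G i; y \<in> lower_central G j; i \<ge> 1; j \<ge> 1\<rbrakk>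
    \<Longrightarrow> commutator G x y \<in> lower_central G (i + j)"
  using displaces_conj[of x i] displacesD[of _ i j y] by (simp add: commutator_def add.commute)

text \<open>A congruence modulo \<open>\<Gamma>(m)\<close> is written as an equation of cosets, so
  that a chain of congruences becomes a computation in the quotient group.\<close>

definition lc_proj :: "nat \<Rightarrow> 'a \<Rightarrow> 'a set" where
  "lc_proj m a = lower_central G m #> a"

lemma lc_proj_hom: "group_hom G (G Mod lower_central G m) (lc_proj m)"
proof -
  interpret N: normal "lower_central G m" G by (rule normal_lower_central)
  show ?thesis
    using N.factorgroup_is_group N.r_coset_hom_Mod is_group
    by (simp add: group_hom_def group_hom_axioms_def lc_proj_def[abs_def])
qed

lemma lc_proj_eq_iff:
  assumes "a \<in> carrier G" "b \<in> carrier G"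
  shows "lc_proj m a = lc_proj m b \<longleftrightarrow> a \<otimes> inv b \<in> lower_central G m"
  using assms subgroup.rcos_module[OF subgroup_lower_central is_group, of b a m]
  unfolding lc_proj_def
  by (metis rcos_self repr_independence subgroup_lower_central)

lemma lc_proj_commute:
  assumes "a \<in> lower_central G i" "b \<in> lower_central G j" "i \<ge> 1" "j \<ge> 1" "m \<le> i + j"
  shows "lc_proj m a \<otimes>\<^bsub>G Mod lower_central G m\<^esub> lc_proj m b =
    lc_proj m b \<otimes>\<^bsub>G Mod lower_central G m\<^esub> lc_proj m a"
proof -
  interpret p: group_hom G "G Mod lower_central G m" "lc_proj m" by (rule lc_proj_hom)
  have ab: "a \<in> carrier G" "b \<in> carrier G" using assms lower_central_closed by auto
  have "commutator G a b \<in> lower_central G m"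
    using lower_central_commutator[OF assms(1-4)] lower_central_antimono[OF assms(5)] by auto
  then have "lc_proj m (a \<otimes> b) = lc_proj m (b \<otimes> a)"
    using ab by (subst lc_proj_eq_iff) (simp_all add: commutator_def word_simps)
  then show ?thesis using ab by (simp del: mult_FactGroup)
qed

text \<open>The word identity behind the Leibniz rule, isolated from the weights. In the quotient
  where it is applied, \<open>[x, k]\<close> and \<open>[h, y]\<close> have the top weight and are
  central, while \<open>[x, y]\<close> and the commutators of \<open>x\<close> and \<open>y\<close>
  with \<open>[h, k]\<close> exceed it and vanish; hence all factors can be collected.\<close>

lemma commutator_mult_mult:
  assumes c: "x \<in> carrier G" "h \<in> carrier G" "y \<in> carrier G" "k \<in> carrier G"
    and xy: "x \<otimes> y = y \<otimes> x"
    and x: "x \<otimes> commutator G h k = commutator G h k \<otimes> x"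
    and y: "y \<otimes> commutator G h k = commutator G h k \<otimes> y"
    and xk: "\<And>z. z \<in> carrier G \<Longrightarrow> commutator G x k \<otimes> z = z \<otimes> commutator G x k"
    and hy: "\<And>z. z \<in> carrier G \<Longrightarrow> commutator G h y \<otimes> z = z \<otimes> commutator G h y"
  shows "commutator G (x \<otimes> h) (y \<otimes> k) =
    commutator G x k \<otimes> commutator G h y \<otimes> commutator G h k"
proof -
  let ?p = "commutator G x k" and ?q = "commutator G h y" and ?r = "commutator G h k"
  have "commutator G (x \<otimes> h) (y \<otimes> k) = x \<otimes> ?q \<otimes> (y \<otimes> ?r) \<otimes> (k \<otimes> inv x \<otimes> inv k) \<otimes> inv y"
    using c by (simp add: commutator_def word_simps)
  also have "\<dots> = ?q \<otimes> (x \<otimes> y) \<otimes> ?r \<otimes> (k \<otimes> inv x \<otimes> inv k) \<otimes> inv y"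
    using c by (simp only: hy[OF c(1), symmetric]) (simp add: m_assoc)
  also have "\<dots> = ?q \<otimes> (y \<otimes> (x \<otimes> ?r)) \<otimes> (k \<otimes> inv x \<otimes> inv k) \<otimes> inv y"
    using c xy by (simp add: m_assoc)
  also have "\<dots> = ?q \<otimes> (y \<otimes> ?r) \<otimes> ?p \<otimes> inv y"
    using c x by (simp add: m_assoc) (simp add: commutator_def word_simps)
  also have "\<dots> = ?q \<otimes> ?r \<otimes> (y \<otimes> ?p) \<otimes> inv y"
    using c y by (simp add: m_assoc)
  also have "\<dots> = ?q \<otimes> ?r \<otimes> ?p"
    using c by (simp only: xk[OF c(3), symmetric]) (simp add: word_simps)
  also have "\<dots> = ?p \<otimes> ?q \<otimes> ?r"
    using c xk[of "?q \<otimes> ?r"] by (simp add: m_assoc)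
  finally show ?thesis .
qed

text \<open>Applied with the displacements \<open>x = f h h\<^sup>-\<^sup>1\<close> and \<open>y = f k k\<^sup>-\<^sup>1\<close> of an endomorphism \<open>f\<close>, this is the
  Leibniz rule for \<open>f\<close>; with \<open>f\<close> inner, it is the Jacobi identity.\<close>

lemma commutator_leibniz:
  assumes "x \<in> lower_central G (i + d)" "h \<in> lower_central G i"
    and "y \<in> lower_central G (j + d)" "k \<in> lower_central G j"
    and ij: "i \<ge> 1" "j \<ge> 1" "d \<ge> 1"
  shows "lc_proj (Suc (i + j + d)) (commutator G (x \<otimes> h) (y \<otimes> k) \<otimes> inv (commutator G h k)) =
    lc_proj (Suc (i + j + d)) (commutator G x k \<otimes> commutator G h y)"
proof -
  let ?m = "Suc (i + j + d)"
  let ?Q = "G Mod lower_central G ?m" and ?p = "lc_proj ?m"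
  interpret p: group_hom G ?Q ?p by (rule lc_proj_hom)
  have c: "x \<in> carrier G" "h \<in> carrier G" "y \<in> carrier G" "k \<in> carrier G"
    using assms lower_central_closed by auto
  have pc: "?p (commutator G a b) = commutator ?Q (?p a) (?p b)"
    if "a \<in> carrier G" "b \<in> carrier G" for a b
    using that p.homh by (intro hom_commutator) (auto simp: is_group)
  have hk: "commutator G h k \<in> lower_central G (i + j)"
    and xk: "commutator G x k \<in> lower_central G (i + j + d)"
    and hy: "commutator G h y \<in> lower_central G (i + j + d)"
    using assms lower_central_commutator[of h i k j] lower_central_commutator[of x "i+d" k j]
      lower_central_commutator[of h i y "j + d"] by (simp_all add: ac_simps)
  have surj: "\<exists>a\<in>carrier G. z = ?p a" if "z \<in> carrier ?Q" for z
    using that by (auto simp: carrier_FactGroup lc_proj_def)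
  have "commutator ?Q (?p x \<otimes>\<^bsub>?Q\<^esub> ?p h) (?p y \<otimes>\<^bsub>?Q\<^esub> ?p k) =
    commutator ?Q (?p x) (?p k) \<otimes>\<^bsub>?Q\<^esub> commutator ?Q (?p h) (?p y) \<otimes>\<^bsub>?Q\<^esub> commutator ?Q (?p h) (?p k)"
  proof (rule p.H.commutator_mult_mult)
    \<comment> \<open>The weight \<open>(i + d) + (j + d)\<close> reaches the modulus
      \<open>i + j + d + 1\<close> because \<open>d\<close> is positive; in the next two claims the
      positivity of \<open>i\<close> and of \<open>j\<close> has this role.\<close>
    show "?p x \<otimes>\<^bsub>?Q\<^esub> ?p y = ?p y \<otimes>\<^bsub>?Q\<^esub> ?p x"
      using assms by (intro lc_proj_commute[of _ "i+d" _ "j+d"]) auto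
    show "?p x \<otimes>\<^bsub>?Q\<^esub> commutator ?Q (?p h) (?p k) = commutator ?Q (?p h) (?p k) \<otimes>\<^bsub>?Q\<^esub> ?p x"
      using ij c lc_proj_commute[OF assms(1) hk, of ?m] by (simp del: mult_FactGroup add: pc)
    show "?p y \<otimes>\<^bsub>?Q\<^esub> commutator ?Q (?p h) (?p k) = commutator ?Q (?p h) (?p k) \<otimes>\<^bsub>?Q\<^esub> ?p y"
      using ij c lc_proj_commute[OF assms(3) hk, of ?m] by (simp del: mult_FactGroup add: pc)
    show "commutator ?Q (?p x) (?p k) \<otimes>\<^bsub>?Q\<^esub> z = z \<otimes>\<^bsub>?Q\<^esub> commutator ?Q (?p x) (?p k)" if "z \<in> carrier ?Q" for z
      using surj[OF that] ij c lc_proj_commute[OF xk, of _ 1 ?m] by (auto simp del: mult_FactGroup simp add: pc)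
    show "commutator ?Q (?p h) (?p y) \<otimes>\<^bsub>?Q\<^esub> z = z \<otimes>\<^bsub>?Q\<^esub> commutator ?Q (?p h) (?p y)" if "z \<in> carrier ?Q" for z
      using surj[OF that] ij c lc_proj_commute[OF hy, of _ 1 ?m] by (auto simp del: mult_FactGroup simp add: pc)
  qed (use c in auto)
  then have "?p (commutator G (x \<otimes> h) (y \<otimes> k)) =
      ?p (commutator G x k \<otimes> commutator G h y) \<otimes>\<^bsub>?Q\<^esub> ?p (commutator G h k)"
    using c by (simp add: pc)
  then show ?thesis
    using c by (simp add: p.H.m_assoc del: mult_FactGroup one_FactGroup)
qed

text \<open>\<open>[a a', b]\<close> is a conjugate of \<open>[a', b]\<close> times
  \<open>[a, b]\<close>, and conjugation is trivial on \<open>\<Gamma>(i + j)\<close> modulo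
  \<open>\<Gamma>(i + j + 1)\<close>. Hence the bracket of classes is biadditive.\<close>

lemma commutator_congruences:
  assumes "a \<in> lower_central G i" "b \<in> lower_central G j" "i \<ge> 1" "j \<ge> 1"
  shows "a' \<in> lower_central G i \<Longrightarrow> lc_proj (Suc (i + j)) (commutator G (a \<otimes> a') b) =
      lc_proj (Suc (i + j)) (commutator G a b \<otimes> commutator G a' b)"
    and "b' \<in> lower_central G j \<Longrightarrow> lc_proj (Suc (i + j)) (commutator G a (b \<otimes> b')) =
      lc_proj (Suc (i + j)) (commutator G a b \<otimes> commutator G a b')"
proof -
  let ?Q = "G Mod lower_central G (Suc (i + j))" and ?p = "lc_proj (Suc (i + j))"
  interpret p: group_hom G ?Q ?p by (rule lc_proj_hom)
  have central: "?p (a \<otimes> b \<otimes> inv a) = ?p b" if "a \<in> carrier G" "b \<in> lower_central G (i + j)" for a b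
    using commutator_lower_central[OF that] that lower_central_closed[OF that(2)]
    by (subst lc_proj_eq_iff) (auto simp: commutator_def)
  have ab: "a \<in> carrier G" "b \<in> carrier G" using assms lower_central_closed by auto
  {
    assume a': "a' \<in> lower_central G i"
    then have a'': "a' \<in> carrier G" by (rule lower_central_closed)
    have 1: "commutator G a b \<in> lower_central G (i + j)" "commutator G a' b \<in> lower_central G (i + j)"
      using assms a' lower_central_commutator by auto
    have "commutator G (a \<otimes> a') b = a \<otimes> commutator G a' b \<otimes> inv a \<otimes> commutator G a b"
      using ab a'' by (simp add: commutator_def word_simps)
    then have "?p (commutator G (a \<otimes> a') b) = ?p (a \<otimes> commutator G a' b \<otimes> inv a) \<otimes>\<^bsub>?Q\<^esub> ?p (commutator G a b)"
      using ab a'' by (simp del: mult_FactGroup)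
    also have "\<dots> = ?p (commutator G a' b) \<otimes>\<^bsub>?Q\<^esub> ?p (commutator G a b)"
      using ab a'' 1 by (simp only: central)
    also have "\<dots> = ?p (commutator G a b) \<otimes>\<^bsub>?Q\<^esub> ?p (commutator G a' b)"
      using 1 assms by (intro lc_proj_commute[of _ "i + j" _ "i + j"]) auto
    finally show "?p (commutator G (a \<otimes> a') b) = ?p (commutator G a b \<otimes> commutator G a' b)"
      using ab a'' by simp
  }
  assume b': "b' \<in> lower_central G j"
  then have b'': "b' \<in> carrier G" by (rule lower_central_closed)
  have 1: "commutator G a b \<in> lower_central G (i + j)" "commutator G a b' \<in> lower_central G (i + j)"
    using assms b' lower_central_commutator by auto
  have "commutator G a (b \<otimes> b') = commutator G a b \<otimes> (b \<otimes> commutator G a b' \<otimes> inv b)"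
    using ab b'' by (simp add: commutator_def word_simps)
  then have "?p (commutator G a (b \<otimes> b')) = ?p (commutator G a b) \<otimes>\<^bsub>?Q\<^esub> ?p (b \<otimes> commutator G a b' \<otimes> inv b)"
    using ab b'' by (simp del: mult_FactGroup)
  also have "\<dots> = ?p (commutator G a b) \<otimes>\<^bsub>?Q\<^esub> ?p (commutator G a b')"
    using ab b'' 1 by (simp only: central)
  finally show "?p (commutator G a (b \<otimes> b')) = ?p (commutator G a b \<otimes> commutator G a b')"
    using ab b'' by simp
qed

end

section \<open>The Magnus ring\<close>

text \<open>Formal series in noncommuting variables with integer coefficients. Polynomials would not
  do, since \<open>1 + s\<close> has to be a unit.\<close>

typedef 's ncps = "UNIV :: ('s list \<Rightarrow> int) set" morphisms ncps_nth Abs_ncps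
  by simp

lemmas ncps_nth_Abs [simp] = Abs_ncps_inverse[OF UNIV_I]

lemma ncps_eqI: "(\<And>w. ncps_nth f w = ncps_nth g w) \<Longrightarrow> f = g"
  by (simp add: ncps_nth_inject[symmetric] fun_eq_iff)

lemma sum_triangle_swap:
  fixes a :: "nat \<Rightarrow> nat \<Rightarrow> 'a::comm_monoid_add"
  shows "(\<Sum>k\<le>n. \<Sum>i\<le>k. a i k) = (\<Sum>i\<le>n. \<Sum>k\<in>{i..n}. a i k)"
proof -
  have "(\<Sum>k\<le>n. \<Sum>i\<le>k. a i k) = (\<Sum>k\<le>n. \<Sum>i\<in>{i \<in> {..n}. i \<le> k}. a i k)"
    by (intro sum.cong) auto
  also have "\<dots> = (\<Sum>i\<le>n. \<Sum>k\<in>{k \<in> {..n}. i \<le> k}. a i k)"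
    by (rule sum.swap_restrict) auto
  also have "\<dots> = (\<Sum>i\<le>n. \<Sum>k\<in>{i..n}. a i k)"
    by (intro sum.cong) auto
  finally show ?thesis .
qed

instantiation ncps :: (type) ring_1
begin

definition "0 = Abs_ncps (\<lambda>w. 0)"
definition "1 = Abs_ncps (\<lambda>w. if w = [] then 1 else 0)"
definition "f + g = Abs_ncps (\<lambda>w. ncps_nth f w + ncps_nth g w)"
definition "f - g = Abs_ncps (\<lambda>w. ncps_nth f w - ncps_nth g w)"
definition "- f = Abs_ncps (\<lambda>w. - ncps_nth f w)"
definition "f * g = Abs_ncps (\<lambda>w. \<Sum>i\<le>length w. ncps_nth f (take i w) * ncps_nth g (drop i w))"

lemma ncps_nth_simps [simp]:
  "ncps_nth 0 w = 0"
  "ncps_nth 1 w = (if w = [] then 1 else 0)"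
  "ncps_nth (f + g) w = ncps_nth f w + ncps_nth g w"
  "ncps_nth (f - g) w = ncps_nth f w - ncps_nth g w"
  "ncps_nth (- f) w = - ncps_nth f w"
  by (simp_all add: zero_ncps_def one_ncps_def plus_ncps_def minus_ncps_def uminus_ncps_def)

lemma ncps_nth_mult:
  "ncps_nth (f * g) w = (\<Sum>i\<le>length w. ncps_nth f (take i w) * ncps_nth g (drop i w))"
  by (simp add: times_ncps_def)

instance
proof
  fix f g h :: "'a ncps"
  show "f * g * h = f * (g * h)"
  proof (rule ncps_eqI)
    fix w :: "'a list"
    let ?F = "ncps_nth f" and ?G = "ncps_nth g" and ?H = "ncps_nth h" and ?n = "length w"
    have "ncps_nth (f * g * h) w =
        (\<Sum>k\<le>?n. \<Sum>i\<le>k. ?F (take i w) * ?G (drop i (take k w)) * ?H (drop k w))"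
      by (auto simp: ncps_nth_mult sum_distrib_right min_def intro!: sum.cong)
    also have "\<dots> = (\<Sum>k\<le>?n. \<Sum>i\<le>k. ?F (take i w) * ?G (take (k - i) (drop i w)) * ?H (drop k w))"
      by (simp add: drop_take)
    also have "\<dots> = (\<Sum>i\<le>?n. \<Sum>k\<in>{i..?n}. ?F (take i w) * ?G (take (k - i) (drop i w)) * ?H (drop k w))"
      by (rule sum_triangle_swap)
    also have "\<dots> = (\<Sum>i\<le>?n. \<Sum>j\<le>?n - i. ?F (take i w) * ?G (take j (drop i w)) * ?H (drop (i + j) w))"
    proof (rule sum.cong)
      fix i
      show "(\<Sum>k\<in>{i..?n}. ?F (take i w) * ?G (take (k - i) (drop i w)) * ?H (drop k w)) =
          (\<Sum>j\<le>?n - i. ?F (take i w) * ?G (take j (drop i w)) * ?H (drop (i + j) w))"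
        if "i \<in> {..?n}"
        by (rule sum.reindex_bij_witness[of _ "\<lambda>j. i + j" "\<lambda>k. k - i"]) (use that in auto)
    qed simp
    also have "\<dots> = ncps_nth (f * (g * h)) w"
      by (auto simp: ncps_nth_mult sum_distrib_left add.commute mult.assoc intro!: sum.cong)
    finally show "ncps_nth (f * g * h) w = ncps_nth (f * (g * h)) w" .
  qed
  show "1 * f = f"
  proof (rule ncps_eqI)
    fix w :: "'a list"
    have "ncps_nth (1 * f) w = (\<Sum>i\<le>length w. if i = 0 then ncps_nth f w else 0)"
      unfolding ncps_nth_mult by (intro sum.cong) auto
    then show "ncps_nth (1 * f) w = ncps_nth f w" by simp
  qed
  show "f * 1 = f"
  proof (rule ncps_eqI)
    fix w :: "'a list"
    have "ncps_nth (f * 1) w = (\<Sum>i\<le>length w. if i = length w then ncps_nth f w else 0)"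
      unfolding ncps_nth_mult by (intro sum.cong) auto
    then show "ncps_nth (f * 1) w = ncps_nth f w" by simp
  qed
  show "(f + g) * h = f * h + g * h" "f * (g + h) = f * g + f * h"
    by (auto intro!: ncps_eqI simp: ncps_nth_mult algebra_simps sum.distrib)
  show "(0::'a ncps) \<noteq> 1"
  proof
    assume "(0::'a ncps) = 1"
    then have "ncps_nth (0::'a ncps) [] = ncps_nth 1 []" by (rule arg_cong)
    then show False by simp
  qed
qed (auto intro!: ncps_eqI)

end

section \<open>Order of a series and lowest terms of products\<close>

definition ord_ge :: "nat \<Rightarrow> 's ncps set" where
  "ord_ge c = {f. \<forall>w. length w < c \<longrightarrow> ncps_nth f w = 0}"

lemma ord_ge_0 [simp]: "f \<in> ord_ge 0"
  by (simp add: ord_ge_def)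

lemma zero_ord_ge [simp]: "0 \<in> ord_ge c"
  by (simp add: ord_ge_def)

lemma ord_ge_antimono: "c \<le> d \<Longrightarrow> f \<in> ord_ge d \<Longrightarrow> f \<in> ord_ge c"
  by (simp add: ord_ge_def)

lemma ord_ge_add: "f \<in> ord_ge c \<Longrightarrow> g \<in> ord_ge c \<Longrightarrow> f + g \<in> ord_ge c"
  and ord_ge_diff: "f \<in> ord_ge c \<Longrightarrow> g \<in> ord_ge c \<Longrightarrow> f - g \<in> ord_ge c"
  and ord_ge_uminus: "f \<in> ord_ge c \<Longrightarrow> - f \<in> ord_ge c"
  by (simp_all add: ord_ge_def)

lemma ord_ge_mult:
  assumes "f \<in> ord_ge c" "g \<in> ord_ge d"
  shows "f * g \<in> ord_ge (c + d)"
proof -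
  have "ncps_nth f (take i w) * ncps_nth g (drop i w) = 0"
    if "length w < c + d" "i \<le> length w" for w i
    using that assms by (cases "i < c") (auto simp: ord_ge_def)
  then show ?thesis by (auto simp: ord_ge_def ncps_nth_mult intro!: sum.neutral)
qed

lemma ncps_nth_mult_lowest:
  assumes "f \<in> ord_ge c" "g \<in> ord_ge d" "length w = c + d"
  shows "ncps_nth (f * g) w = ncps_nth f (take c w) * ncps_nth g (drop c w)"
proof -
  have "ncps_nth (f * g) w = (\<Sum>i\<le>length w. if i = c then ncps_nth f (take c w) * ncps_nth g (drop c w) else 0)"
    unfolding ncps_nth_mult
  proof (rule sum.cong)
    fix i assume "i \<in> {..length w}"
    then show "ncps_nth f (take i w) * ncps_nth g (drop i w) =
        (if i = c then ncps_nth f (take c w) * ncps_nth g (drop c w) else 0)"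
      using assms by (cases i c rule: linorder_cases) (auto simp: ord_ge_def)
  qed simp
  then show ?thesis using assms by simp
qed

section \<open>Units of the Magnus ring and multiplication by variables\<close>

definition ncps_units :: "'s ncps monoid" where
  "ncps_units = units_of \<lparr>carrier = UNIV, monoid.mult = (*), one = 1\<rparr>"

lemma monoid_ncps: "monoid \<lparr>carrier = UNIV :: 's ncps set, monoid.mult = (*), one = 1\<rparr>"
  by (rule monoidI) (simp_all add: mult.assoc)

lemma group_ncps_units: "group ncps_units"
  unfolding ncps_units_def by (rule monoid.units_group[OF monoid_ncps])

lemma ncps_units_simps [simp]:
  "\<one>\<^bsub>ncps_units\<^esub> = 1" "f \<otimes>\<^bsub>ncps_units\<^esub> g = f * g"
  "f \<in> carrier ncps_units \<longleftrightarrow> (\<exists>g. g * f = 1 \<and> f * g = 1)"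
  by (auto simp: ncps_units_def units_of_def Units_def)

definition ncps_var :: "'s \<Rightarrow> 's ncps" where
  "ncps_var s = Abs_ncps (\<lambda>w. if w = [s] then 1 else 0)"

lemma ncps_nth_var [simp]: "ncps_nth (ncps_var s) w = (if w = [s] then 1 else 0)"
  by (simp add: ncps_var_def)

lemma ncps_var_ord_ge: "ncps_var s \<in> ord_ge 1"
  by (auto simp: ord_ge_def)

lemma ncps_nth_mult_var_left:
  "ncps_nth (ncps_var s * f) w = (case w of [] \<Rightarrow> 0 | a # v \<Rightarrow> if a = s then ncps_nth f v else 0)"
proof (cases w)
  case (Cons a v)
  have "ncps_nth (ncps_var s * f) w = (\<Sum>i\<le>length w. if i = 1 then (if a = s then ncps_nth f v else 0) else 0)"
    unfolding ncps_nth_mult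
    by (rule sum.cong) (use Cons in \<open>auto simp: take_Cons' drop_Cons' not_le\<close>)
  also have "\<dots> = (if a = s then ncps_nth f v else 0)" by (subst sum.delta) (auto simp: Cons)
  finally show ?thesis by (simp add: Cons)
qed (simp add: ncps_nth_mult)

lemma ncps_nth_mult_var_right: "ncps_nth (f * ncps_var s) (v @ [a]) = (if a = s then ncps_nth f v else 0)"
proof -
  have "ncps_nth (f * ncps_var s) (v @ [a]) =
      (\<Sum>i\<le>Suc (length v). if i = length v then (if a = s then ncps_nth f v else 0) else 0)"
    unfolding ncps_nth_mult
  proof (rule sum.cong)
    fix i assume "i \<in> {..Suc (length v)}"
    then consider "i < length v" | "i = length v" | "i = Suc (length v)" by fastforce
    then show "ncps_nth f (take i (v @ [a])) * ncps_nth (ncps_var s) (drop i (v @ [a])) =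
        (if i = length v then (if a = s then ncps_nth f v else 0) else 0)"
    proof cases
      case 1
      then have "length (drop i (v @ [a])) \<noteq> length [s]" by simp
      then have "drop i (v @ [a]) \<noteq> [s]" by metis
      with 1 show ?thesis by simp
    qed auto
  qed simp
  then show ?thesis by simp
qed

text \<open>The inverse of \<open>1 + s\<close> is the geometric series of \<open>- s\<close>.\<close>

lemma one_plus_var_unit: "1 + ncps_var s \<in> carrier ncps_units"
proof -
  define g where "g = Abs_ncps (\<lambda>w. if set w \<subseteq> {s} then (- 1) ^ length w else 0)"
  have g: "ncps_nth g w = (if set w \<subseteq> {s} then (- 1) ^ length w else 0)" for w
    by (simp add: g_def)
  have "(1 + ncps_var s) * g = 1"
  proof (rule ncps_eqI)
    fix w show "ncps_nth ((1 + ncps_var s) * g) w = ncps_nth 1 w"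
      by (cases w) (auto simp: distrib_right g ncps_nth_mult_var_left)
  qed
  moreover have "g * (1 + ncps_var s) = 1"
  proof (rule ncps_eqI)
    fix w show "ncps_nth (g * (1 + ncps_var s)) w = ncps_nth 1 w"
      by (cases w rule: rev_cases)
        (auto simp: distrib_left g ncps_nth_mult_var_right, simp_all add: ncps_nth_mult g)
  qed
  ultimately show ?thesis by auto
qed

text \<open>Compare coefficients at \<open>w a\<close>, where \<open>w\<close> has length
  \<open>e\<close> and begins with \<open>b\<close>. In \<open>f a\<close> this is the coefficient
  of \<open>w\<close> in \<open>f\<close>; in \<open>a f\<close> it is zero once \<open>a\<close>
  differs from \<open>b\<close>. Two variables leave such an \<open>a\<close> for every
  \<open>b\<close>, and \<open>e \<ge> 1\<close> provides the first letter.\<close>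

lemma ncps_central_eq_0:
  assumes f: "f \<in> ord_ge e" "e \<ge> 1" and s: "s \<noteq> t"
    and comm: "\<And>w a. \<lbrakk>length w = Suc e; a \<in> {s, t}\<rbrakk> \<Longrightarrow> ncps_nth (ncps_var a * f) w = ncps_nth (f * ncps_var a) w"
  shows "f \<in> ord_ge (Suc e)"
proof -
  have "ncps_nth f w = 0" if w: "length w = e" for w
  proof -
    obtain b v where bv: "w = b # v" using w f by (cases w) auto
    obtain a where a: "a \<in> {s, t}" "a \<noteq> b" using s by auto
    have "ncps_nth f w = ncps_nth (f * ncps_var a) (w @ [a])"
      by (simp add: ncps_nth_mult_var_right)
    also have "\<dots> = ncps_nth (ncps_var a * f) (w @ [a])"
      using comm[of "w @ [a]" a] a w by simp
    also have "\<dots> = 0" using a bv by (simp add: ncps_nth_mult_var_left)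
    finally show ?thesis .
  qed
  then show ?thesis using f by (auto simp: ord_ge_def less_Suc_eq)
qed

text \<open>With \<open>h\<close> the inverse of \<open>g f\<close> one has
  \<open>[f, g] - 1 = (f g - g f) h\<close>, and \<open>f g - g f\<close> is the ring commutator
  \<open>r\<close> of \<open>f - 1\<close> and \<open>g - 1\<close>. The error is
  \<open>r (h - 1)\<close>, which gains a degree because \<open>h\<close> has constant term
  one.\<close>

lemma unit_commutator_ord_ge:
  assumes f: "f \<in> carrier ncps_units" "f - 1 \<in> ord_ge i" and g: "g \<in> carrier ncps_units" "g - 1 \<in> ord_ge j"
    and "i \<ge> 1" "j \<ge> 1"
  shows "commutator ncps_units f g - 1 - ((f - 1) * (g - 1) - (g - 1) * (f - 1)) \<in> ord_ge (Suc (i + j))"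
proof -
  interpret U: group "ncps_units :: 's ncps monoid" by (rule group_ncps_units)
  define q where "q = commutator ncps_units f g"
  define h where "h = inv\<^bsub>ncps_units\<^esub> (g * f)"
  define r where "r = (f - 1) * (g - 1) - (g - 1) * (f - 1)"
  have gf: "g * f \<in> carrier ncps_units" using U.m_closed[OF g(1) f(1)] by simp
  have h: "g * f * h = 1" using U.r_inv[OF gf] by (simp add: h_def)
  have "q = f * g * h"
    using f(1) g(1) U.inv_mult_group[OF g(1) f(1)] U.m_assoc[of f g] U.m_assoc[of "f * g"] U.m_closed[OF f(1) g(1)]
    unfolding q_def h_def commutator_def by (simp add: mult.assoc del: ncps_units_simps(3))
  then have "q - 1 = (f * g - g * f) * h" using h by (simp add: left_diff_distrib)
  also have "f * g - g * f = r" by (simp add: r_def algebra_simps)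
  finally have q: "q - 1 - r = r * (h - 1)" by (simp add: algebra_simps)
  have "ncps_nth f [] = 1" "ncps_nth g [] = 1"
    using f g assms(5,6) by (auto simp: ord_ge_def)
  then have "ncps_nth h [] = 1"
    using arg_cong[OF h, of "\<lambda>f. ncps_nth f []"] by (simp add: ncps_nth_mult)
  then have "h - 1 \<in> ord_ge 1" by (simp add: ord_ge_def)
  moreover have "r \<in> ord_ge (i + j)"
    unfolding r_def using ord_ge_mult[OF f(2) g(2)] ord_ge_mult[OF g(2) f(2)]
    by (intro ord_ge_diff) (simp_all add: add.commute)
  ultimately have "r * (h - 1) \<in> ord_ge (i + j + 1)" by (intro ord_ge_mult)
  then show ?thesis using q by (simp add: q_def r_def)
qed

section \<open>Standard trees and the rewriting of brackets\<close>

lemma less_append_not_prefix: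
  fixes x y :: "'a::linorder list"
  assumes "x < y" "\<And>z. y \<noteq> x @ z"
  shows "x @ a < y @ b"
  using assms
proof (induction x arbitrary: y)
  case (Cons c x)
  then show ?case by (cases y) auto
qed auto

lemma append_less_append_same_length:
  fixes x y :: "'a::linorder list"
  assumes "x < y" "length y \<le> length x"
  shows "x @ a < y @ b"
  using assms by (intro less_append_not_prefix) auto

lemma append_le_append_same_length:
  fixes x y :: "'a::linorder list"
  assumes "x \<le> y" "a \<le> b" "length y \<le> length x"
  shows "x @ a \<le> y @ b"
proof (cases "x = y")
  case True
  then show ?thesis using assms(2) by (induction x arbitrary: y) auto
next
  case False
  then have "x < y" using assms(1) by simp
  then show ?thesis using append_less_append_same_length[of x y a b] assms(3) by simp
qed

lemma append_less_cancel_left [simp]: "x @ a < x @ b \<longleftrightarrow> a < (b :: 'a::linorder list)"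
  by (induction x) auto

lemma less_append_right [simp]: "x < x @ a \<longleftrightarrow> a \<noteq> ([] :: 'a::linorder list)"
  using append_less_cancel_left[of x "[]" a] by (cases a) simp_all

datatype 's htree = Leaf 's | Node "'s htree" "'s htree"

primrec word :: "'s htree \<Rightarrow> 's list" where
  "word (Leaf s) = [s]"
| "word (Node a b) = word a @ word b"

text \<open>The bracketings of Lyndon words by their standard factorisations, characterised without
  reference to Lyndon words.\<close>

fun std :: "'s::linorder set \<Rightarrow> 's htree \<Rightarrow> bool" where
  "std S (Leaf s) \<longleftrightarrow> s \<in> S"
| "std S (Node a b) \<longleftrightarrow> std S a \<and> std S b \<and> word a < word b \<and>
     (case a of Leaf s \<Rightarrow> True | Node a1 a2 \<Rightarrow> word b \<le> word a2)"

lemma word_neq_Nil [simp]: "word t \<noteq> []"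
  by (induction t) auto

lemma std_word_subset: "std S t \<Longrightarrow> set (word t) \<subseteq> S"
  by (induction t) auto

text \<open>The right subtree carries the least proper suffix of the word, so that the word of a standard
  tree is a Lyndon word and determines the tree.\<close>

lemma std_least_suffix:
  "\<lbrakk>std S (Node a b); word a @ word b = p @ q; p \<noteq> []; q \<noteq> []\<rbrakk> \<Longrightarrow> word b \<le> q"
  and std_less_suffix: "\<lbrakk>std S t; word t = p @ q; p \<noteq> []; q \<noteq> []\<rbrakk> \<Longrightarrow> word t < q"
proof -
  have *: "(\<forall>p q. word t = p @ q \<longrightarrow> p \<noteq> [] \<longrightarrow> q \<noteq> [] \<longrightarrow> word t < q) \<and>
      (\<forall>a b. t = Node a b \<longrightarrow> (\<forall>p q. word t = p @ q \<longrightarrow> p \<noteq> [] \<longrightarrow> q \<noteq> [] \<longrightarrow> word b \<le> q))" if "std S t" for t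
    using that
  proof (induction t)
    case (Leaf s)
    then show ?case by (auto simp: Cons_eq_append_conv)
  next
    case (Node a b)
    have suffix: "word b \<le> q" if pq: "word a @ word b = p @ q" "p \<noteq> []" "q \<noteq> []" for p q
    proof -
      consider (right) us where "word a @ us = p" "word b = us @ q"
        | (left) us where "word a = p @ us" "us @ word b = q" "us \<noteq> []"
        using pq(1) by (metis append_eq_append_conv2 append_Nil append_Nil2)
      then show ?thesis
      proof cases
        case right
        then show ?thesis using Node pq by (cases "us = []") (auto simp: less_imp_le)
      next
        \<comment> \<open>Here \<open>q\<close> starts inside \<open>word a\<close>. Its part
          \<open>us\<close> is a proper suffix of \<open>word a\<close>, hence at least
          \<open>word a2\<close>, which is at least \<open>word b\<close> by standardness.\<close>
        case left
        then obtain a1 a2 where a: "a = Node a1 a2"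
          using pq(2) by (cases a) (auto simp: Cons_eq_append_conv)
        then have "word a2 \<le> us" "word b \<le> word a2" using Node left pq(2) by auto
        then have "word b \<le> us" by order
        also have "us < q" using left by auto
        finally show ?thesis by order
      qed
    qed
    \<comment> \<open>If \<open>word b = word a @ z\<close>, then \<open>z\<close> is a proper
      suffix of \<open>word b\<close>, so \<open>word b < z\<close>, and the common prefix can be
      restored. Otherwise the first difference between \<open>word a\<close> and
      \<open>word b\<close> decides.\<close>
    have "word a @ word b < word b"
    proof (cases "\<exists>z. word b = word a @ z")
      case True
      then obtain z where z: "word b = word a @ z" by auto
      have "z \<noteq> []" using z Node.prems by auto
      then have "word b < z" using Node z by auto
      then show ?thesis using z by (metis append_less_cancel_left)
    next
      case False
      then show ?thesis using less_append_not_prefix[of "word a" "word b" "word b" "[]"] Node.prems by auto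
    qed
    then show ?case using suffix by (auto intro: less_le_trans)
  qed
  show "\<lbrakk>std S (Node a b); word a @ word b = p @ q; p \<noteq> []; q \<noteq> []\<rbrakk> \<Longrightarrow> word b \<le> q"
    using *[of "Node a b"] by simp
  show "\<lbrakk>std S t; word t = p @ q; p \<noteq> []; q \<noteq> []\<rbrakk> \<Longrightarrow> word t < q"
    using *[of t] by simp
qed

lemma std_Node_less:
  assumes "std S (Node a b)"
  shows "word (Node a b) < word b" "word a < word (Node a b)"
  using std_less_suffix[OF assms, of "word a" "word b"] by simp_all

text \<open>Both right words are proper suffixes of the common word, so by minimality each bounds
  the other.\<close>

lemma std_word_inj: "\<lbrakk>std S t; std S t'; word t = word t'\<rbrakk> \<Longrightarrow> t = t'"
proof (induction t arbitrary: t')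
  case (Leaf s)
  then show ?case by (cases t') (auto simp: Cons_eq_append_conv)
next
  case (Node a b)
  then obtain a' b' where t': "t' = Node a' b'" by (cases t') (auto simp: append_eq_Cons_conv)
  have "word b \<le> word b'" "word b' \<le> word b"
    using std_least_suffix[of S a b "word a'" "word b'"] std_least_suffix[of S a' b' "word a" "word b"]
      Node.prems t' by auto
  then have "word b = word b'" by order
  then show ?case using Node t' by auto
qed

lemma finite_std: "finite S \<Longrightarrow> finite {t. std S t \<and> length (word t) = c}"
proof (rule finite_imageD)
  assume "finite S"
  then show "finite (word ` {t. std S t \<and> length (word t) = c})"
    by (rule finite_subset[OF _ finite_lists_length_eq[of S c], rotated]) (use std_word_subset in auto)
qed (auto intro!: inj_onI std_word_inj)

section \<open>Commutators of trees, and reduction of membership in a subgroup to generators\<close>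

context group begin

primrec tree_comm :: "('s \<Rightarrow> 'a) \<Rightarrow> 's htree \<Rightarrow> 'a" where
  "tree_comm x (Leaf s) = x s"
| "tree_comm x (Node a b) = commutator G (tree_comm x a) (tree_comm x b)"

text \<open>Lets a congruence modulo \<open>\<Gamma>(m)\<close> serve as an equation when the goal
  is membership in a subgroup above \<open>\<Gamma>(m)\<close>.\<close>

lemma lc_proj_mem_iff:
  assumes "subgroup H G" "lower_central G m \<subseteq> H" "a \<in> carrier G" "b \<in> carrier G"
    and "lc_proj m a = lc_proj m b"
  shows "a \<in> H \<longleftrightarrow> b \<in> H"
proof -
  have *: "a \<in> H" if "b \<in> H" "a \<in> carrier G" "a \<otimes> inv b \<in> H" for a b
    using subgroup.m_closed[OF assms(1) that(3,1)] that subgroup.mem_carrier[OF assms(1) that(1)]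
    by (simp add: m_assoc)
  have "a \<otimes> inv b \<in> H" "b \<otimes> inv a \<in> H"
    using assms(2-5) lc_proj_eq_iff[of a b m] lc_proj_eq_iff[of b a m] by auto
  then show ?thesis using * assms(3,4) by blast
qed

text \<open>By biadditivity modulo \<open>\<Gamma>(i + j + 1)\<close>, the elements whose commutator
  with a fixed one lies in \<open>H\<close> form a subgroup. The two arguments are reduced to
  generators one after the other.\<close>

lemma commutator_generate:
  assumes H: "subgroup H G" "lower_central G (Suc (i + j)) \<subseteq> H" and ij: "i \<ge> 1" "j \<ge> 1"
    and U: "U \<subseteq> lower_central G i" and V: "V \<subseteq> lower_central G j"
    and UV: "\<And>u v. \<lbrakk>u \<in> U; v \<in> V\<rbrakk> \<Longrightarrow> commutator G u v \<in> H"
    and a: "a \<in> generate G U" and b: "b \<in> generate G V"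
  shows "commutator G a b \<in> H"
proof -
  interpret H: subgroup H G by (rule H)
  note cl = lower_central_closed
  have left: "subgroup {a \<in> lower_central G i. commutator G a b \<in> H} G" if b: "b \<in> lower_central G j" for b
  proof (rule subgroupI)
    show "{a \<in> lower_central G i. commutator G a b \<in> H} \<noteq> {}"
      using cl[OF b] by (auto intro!: exI[of _ \<one>] simp: commutator_def)
  next
    fix a a' assume *: "a \<in> {a \<in> lower_central G i. commutator G a b \<in> H}"
      "a' \<in> {a \<in> lower_central G i. commutator G a b \<in> H}"
    then show "a \<otimes> a' \<in> {a \<in> lower_central G i. commutator G a b \<in> H}"
      using lc_proj_mem_iff[OF H _ _ commutator_congruences(1)[OF _ b ij, of a a']] b cl
      by (auto intro: lower_central_mult)
  next
    fix a assume *: "a \<in> {a \<in> lower_central G i. commutator G a b \<in> H}"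
    \<comment> \<open>The commutator of \<open>inv a \<otimes> a\<close> with \<open>b\<close> is
      trivial; splitting it puts \<open>[inv a, b] [a, b]\<close> into \<open>H\<close>.\<close>
    have "\<one> \<in> H" by simp
    then have "commutator G (inv a \<otimes> a) b \<in> H"
      using * cl[OF b] cl[of a i] by (auto simp: commutator_def)
    then have "commutator G (inv a) b \<otimes> commutator G a b \<in> H"
      using lc_proj_mem_iff[OF H _ _ commutator_congruences(1)[OF _ b ij, of "inv a" a]] b cl *
        lower_central_inv[of a i] by auto
    then have "commutator G (inv a) b \<otimes> commutator G a b \<otimes> inv (commutator G a b) \<in> H"
      using * by blast
    then show "inv a \<in> {a \<in> lower_central G i. commutator G a b \<in> H}"
      using * cl[OF b] cl[of a i] by (auto simp: m_assoc lower_central_inv)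
  qed (use cl in auto)
  have right: "subgroup {b \<in> lower_central G j. commutator G a b \<in> H} G" if a: "a \<in> lower_central G i" for a
  proof (rule subgroupI)
    show "{b \<in> lower_central G j. commutator G a b \<in> H} \<noteq> {}"
      using cl[OF a] by (auto intro!: exI[of _ \<one>] simp: commutator_def)
  next
    fix b b' assume *: "b \<in> {b \<in> lower_central G j. commutator G a b \<in> H}"
      "b' \<in> {b \<in> lower_central G j. commutator G a b \<in> H}"
    then show "b \<otimes> b' \<in> {b \<in> lower_central G j. commutator G a b \<in> H}"
      using lc_proj_mem_iff[OF H _ _ commutator_congruences(2)[OF a _ ij, of b b']] a cl
      by (auto intro: lower_central_mult)
  next
    fix b assume *: "b \<in> {b \<in> lower_central G j. commutator G a b \<in> H}"
    have "\<one> \<in> H" by simp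
    then have "commutator G a (inv b \<otimes> b) \<in> H"
      using * cl[OF a] cl[of b j] by (auto simp: commutator_def)
    then have "commutator G a (inv b) \<otimes> commutator G a b \<in> H"
      using lc_proj_mem_iff[OF H _ _ commutator_congruences(2)[OF a _ ij, of "inv b" b]] a cl *
        lower_central_inv[of b j] by auto
    then have "commutator G a (inv b) \<otimes> commutator G a b \<otimes> inv (commutator G a b) \<in> H"
      using * by blast
    then show "inv b \<in> {b \<in> lower_central G j. commutator G a b \<in> H}"
      using * cl[OF a] cl[of b j] by (auto simp: m_assoc lower_central_inv)
  qed (use cl in auto)
  have "generate G U \<subseteq> {a \<in> lower_central G i. commutator G a v \<in> H}" if "v \<in> V" for v
    using that U V UV by (intro generate_subgroup_incl left) auto
  then have "generate G V \<subseteq> {b \<in> lower_central G j. commutator G a b \<in> H}"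
    using a U V generate_subgroup_incl[OF U subgroup_lower_central]
    by (intro generate_subgroup_incl right) auto
  then show ?thesis using b by auto
qed

lemma commutator_jacobi:
  assumes "a \<in> lower_central G i" "b \<in> lower_central G j" "c \<in> lower_central G k"
    "i \<ge> 1" "j \<ge> 1" "k \<ge> 1"
  shows "lc_proj (Suc (i + j + k)) (commutator G a (commutator G b c)) =
    lc_proj (Suc (i + j + k)) (commutator G (commutator G a b) c \<otimes> commutator G b (commutator G a c))"
proof -
  have cl: "a \<in> carrier G" "b \<in> carrier G" "c \<in> carrier G" using assms lower_central_closed by auto
  \<comment> \<open>Conjugation by \<open>a\<close> turns \<open>b\<close> into
    \<open>[a, b] b\<close> and \<open>c\<close> into \<open>[a, c] c\<close>, which is the shape
    that the Leibniz rule expects.\<close>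
  have "commutator G a (commutator G b c) =
      commutator G (commutator G a b \<otimes> b) (commutator G a c \<otimes> c) \<otimes> inv (commutator G b c)"
    using cl by (simp add: commutator_def word_simps)
  then show ?thesis
    using commutator_leibniz[of "commutator G a b" j i b "commutator G a c" k c] assms
      lower_central_commutator[of a i b j] lower_central_commutator[of a i c k]
    by (simp add: ac_simps)
qed

end

locale group_gen = group G for G (structure) +
  fixes x :: "'s::linorder \<Rightarrow> 'a" and S :: "'s set"
  assumes finite_S: "finite S" and x_closed: "x ` S \<subseteq> carrier G"
    and generate_x: "generate G (x ` S) = carrier G"
begin

abbreviation e where "e \<equiv> tree_comm x"

text \<open>The preimage in \<open>\<Gamma>(c)\<close> of a subgroup of \<open>\<Gamma>(c)\<close>
  modulo \<open>\<Gamma>(c + 1)\<close>, since the latter is among the generators. The predicate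
  \<open>P\<close> carries the bound on words that keeps the rewriting going.\<close>

definition spanned :: "nat \<Rightarrow> ('s htree \<Rightarrow> bool) \<Rightarrow> 'a set" where
  "spanned c P = generate G (lower_central G (Suc c) \<union> e ` {t. std S t \<and> length (word t) = c \<and> P t})"

lemma tree_comm_lower_central: "std S t \<Longrightarrow> e t \<in> lower_central G (length (word t))"
proof (induction t)
  case (Leaf s)
  then have "s \<in> S" by simp
  then show ?case using x_closed by (simp add: image_subset_iff)
next
  case (Node a b)
  then have "e a \<in> lower_central G (length (word a))" "e b \<in> lower_central G (length (word b))"
    by simp_all
  then show ?case by (simp add: lower_central_commutator Suc_le_eq)
qed

lemma span_subset: "lower_central G (Suc c) \<union> e ` {t. std S t \<and> length (word t) = c \<and> P t} \<subseteq> lower_central G c"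
  using lower_central_Suc_subset tree_comm_lower_central by auto

lemma subgroup_spanned: "subgroup (spanned c P) G"
  unfolding spanned_def using span_subset lower_central_closed
  by (intro generate_is_subgroup) blast

lemma spanned_mono: "(\<And>t. P t \<Longrightarrow> Q t) \<Longrightarrow> spanned c P \<subseteq> spanned c Q"
  unfolding spanned_def by (intro mono_generate) auto

lemma lower_central_spanned: "lower_central G (Suc c) \<subseteq> spanned c P"
  unfolding spanned_def by (auto intro: generate.incl)

lemma tree_comm_spanned: "\<lbrakk>std S t; P t; length (word t) = c\<rbrakk> \<Longrightarrow> e t \<in> spanned c P"
  unfolding spanned_def by (auto intro: generate.incl)

lemma commutator_spanned:
  assumes "a \<in> spanned i P" "b \<in> spanned j Q" "i \<ge> 1" "j \<ge> 1"
    and "\<And>s t. \<lbrakk>std S s; P s; length (word s) = i; std S t; Q t; length (word t) = j\<rbrakk>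
      \<Longrightarrow> commutator G (e s) (e t) \<in> spanned (i + j) R"
  shows "commutator G a b \<in> spanned (i + j) R"
proof (rule commutator_generate[OF subgroup_spanned lower_central_spanned assms(3,4) span_subset span_subset])
  fix u v
  assume u: "u \<in> lower_central G (Suc i) \<union> e ` {t. std S t \<and> length (word t) = i \<and> P t}"
    and v: "v \<in> lower_central G (Suc j) \<union> e ` {t. std S t \<and> length (word t) = j \<and> Q t}"
  have u': "u \<in> lower_central G i" by (rule subsetD[OF span_subset u])
  have v': "v \<in> lower_central G j" by (rule subsetD[OF span_subset v])
  show "commutator G u v \<in> spanned (i + j) R"
  proof (cases "u \<in> lower_central G (Suc i) \<or> v \<in> lower_central G (Suc j)")
    case True
    then have "commutator G u v \<in> lower_central G (Suc (i + j))"
      using lower_central_commutator[of u "Suc i" v j] lower_central_commutator[of u i v "Suc j"]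
        u' v' assms(3,4) by auto
    then show ?thesis by (rule subsetD[OF lower_central_spanned])
  next
    case False
    with u v have "u \<in> e ` {t. std S t \<and> length (word t) = i \<and> P t}"
      "v \<in> e ` {t. std S t \<and> length (word t) = j \<and> Q t}" by blast+
    then obtain s t where "std S s" "P s" "length (word s) = i" "u = e s"
      and "std S t" "Q t" "length (word t) = j" "v = e t" by blast
    then show ?thesis using assms(5) by simp
  qed
qed (use assms(1,2) in \<open>simp_all add: spanned_def\<close>)

text \<open>Frees the rewriting from the order of its arguments: reversed arguments invert the
  commutator, and trees with equal words are equal, so that their commutator is trivial.\<close>

lemma commutator_spanned_less:
  assumes "\<And>s t. \<lbrakk>std S s; std S t; word s < word t; word t < v; length (word s) + length (word t) = c\<rbrakk>
      \<Longrightarrow> commutator G (e s) (e t) \<in> spanned c (\<lambda>r. word r < word t)"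
    and st: "std S s" "std S t" "word s < v" "word t < v" "length (word s) + length (word t) = c"
  shows "commutator G (e s) (e t) \<in> spanned c (\<lambda>r. word r < v)"
proof -
  have cl: "e s \<in> carrier G" "e t \<in> carrier G"
    using st tree_comm_lower_central lower_central_closed by blast+
  have mono: "spanned c (\<lambda>r. word r < word t) \<subseteq> spanned c (\<lambda>r. word r < v)" if "word t < v" for t
    using that by (intro spanned_mono) auto
  show ?thesis
  proof (cases "word s" "word t" rule: linorder_cases)
    case less
    then show ?thesis using subsetD[OF mono[OF st(4)] assms(1)[OF st(1,2) _ st(4,5)]] by simp
  next
    case greater
    have "length (word t) + length (word s) = c" using st(5) by (simp only: add.commute)
    then have "commutator G (e t) (e s) \<in> spanned c (\<lambda>r. word r < v)"
      using subsetD[OF mono[OF st(3)] assms(1)[OF st(2,1) greater st(3)]] by simp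
    then have "inv (commutator G (e t) (e s)) \<in> spanned c (\<lambda>r. word r < v)"
      by (rule subgroup.m_inv_closed[OF subgroup_spanned])
    then show ?thesis using cl by (simp add: inv_commutator)
  next
    case equal
    then have "s = t" using st(1,2) by (rule std_word_inj[rotated 2])
    then show ?thesis using cl by (simp add: commutator_self subgroup.one_closed[OF subgroup_spanned])
  qed
qed

text \<open>The rewriting of brackets of standard trees.  If \<open>Node a b\<close> is not standard then
  \<open>a = Node a1 a2\<close> with \<open>word a2 < word b\<close>, and the Jacobi identity leads to brackets of the same
  degree in which both words are less than \<open>word b\<close>.\<close>

lemma commutator_std_spanned:
  assumes "std S a" "std S b" "word a < word b" "length (word a) + length (word b) = c"
  shows "commutator G (e a) (e b) \<in> spanned c (\<lambda>t. word t < word b)"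
  using assms
proof (induction c arbitrary: a b rule: less_induct)
  case (less c)
  note outer = less.IH
  show ?case using less.prems
  \<comment> \<open>The dictionary order is not well founded; counting the words below
    \<open>word b\<close> of length at most \<open>c\<close> over the finite alphabet gives a
    measure that decreases.\<close>
  proof (induction "card {w. set w \<subseteq> S \<and> length w \<le> c \<and> w < word b}" arbitrary: a b rule: less_induct)
    case (less b a)
    let ?V = "\<lambda>b. {w. set w \<subseteq> S \<and> length w \<le> c \<and> w < word b}"
    let ?X = "spanned c (\<lambda>t. word t < word b)"
    have fin: "finite (?V b)"
      by (rule finite_subset[OF _ finite_lists_length_le[OF finite_S, of c]]) auto
    have inner: "commutator G (e s) (e t) \<in> spanned c (\<lambda>r. word r < word t)"
      if "std S s" "std S t" "word s < word t" "word t < word b" "length (word s) + length (word t) = c" for s t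
    proof (rule less.hyps)
      have "word t \<in> ?V b" using that std_word_subset[OF that(2)] by auto
      then have "?V t \<subset> ?V b" using that(4) by auto
      then show "card (?V t) < card (?V b)" by (rule psubset_card_mono[OF fin])
    qed (use that in auto)
    show ?case
    proof (cases "std S (Node a b)")
      case True
      then show ?thesis using tree_comm_spanned[of "Node a b"] std_Node_less[OF True] less.prems by simp
    next
      case False
      then obtain a1 a2 where a: "a = Node a1 a2" and a2b: "word a2 < word b"
        using less.prems by (auto split: htree.splits)
      have std: "std S a1" "std S a2" "word a1 < word a2" using less.prems a by auto
      let ?i = "length (word a1)" and ?j = "length (word a2)" and ?k = "length (word b)"
      have c: "c = ?i + ?j + ?k" using less.prems a by simp
      have pos: "?i \<ge> 1" "?j \<ge> 1" "?k \<ge> 1" by (simp_all add: Suc_le_eq)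
      have lc: "e a1 \<in> lower_central G ?i" "e a2 \<in> lower_central G ?j" "e b \<in> lower_central G ?k"
        using std less.prems tree_comm_lower_central by blast+
      then have cl: "e a1 \<in> carrier G" "e a2 \<in> carrier G" "e b \<in> carrier G"
        using lower_central_closed by blast+
      have red: "commutator G (e s) (e t) \<in> ?X"
        if "std S s" "std S t" "word s < word b" "word t < word b" "length (word s) + length (word t) = c" for s t
        using inner that by (rule commutator_spanned_less)
      \<comment> \<open>The inner brackets \<open>[a1, b]\<close> and \<open>[a2, b]\<close> have
        smaller degree, so the outer induction writes them by trees with words below
        \<open>word b\<close>. As \<open>word a1\<close> and \<open>word a2\<close> are also below
        \<open>word b\<close>, the remaining brackets fall under the inner induction.\<close>
      have 1: "commutator G (e a1) (e b) \<in> spanned (?i + ?k) (\<lambda>t. word t < word b)"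
        using outer[of "?i + ?k" a1 b] pos c std a2b less.prems by auto
      have 2: "commutator G (e a2) (e b) \<in> spanned (?j + ?k) (\<lambda>t. word t < word b)"
        using outer[of "?j + ?k" a2 b] pos c std a2b less.prems by auto
      \<comment> \<open>The predicate \<open>\<lambda>t. t = a2\<close> presents the single element
        \<open>e a2\<close> as a member of a span.\<close>
      have "commutator G (commutator G (e a1) (e b)) (e a2) \<in> spanned (?i + ?k + ?j) (\<lambda>t. word t < word b)"
        using red a2b c pos std
        by (intro commutator_spanned[OF 1 tree_comm_spanned[of a2 "\<lambda>t. t = a2"]]) (auto simp: ac_simps)
      then have 3: "commutator G (commutator G (e a1) (e b)) (e a2) \<in> ?X" by (simp add: c ac_simps)
      have "commutator G (e a1) (commutator G (e a2) (e b)) \<in> spanned (?i + (?j + ?k)) (\<lambda>t. word t < word b)"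
        using red a2b c pos std
        by (intro commutator_spanned[OF tree_comm_spanned[of a1 "\<lambda>t. t = a1"] 2]) (auto simp: ac_simps)
      then have "commutator G (e a1) (commutator G (e a2) (e b)) \<in> ?X" by (simp add: c ac_simps)
      moreover have "lower_central G (Suc (?i + ?j + ?k)) \<subseteq> ?X"
        using lower_central_spanned c by simp
      ultimately have "commutator G (commutator G (e a1) (e a2)) (e b) \<otimes>
          commutator G (e a2) (commutator G (e a1) (e b)) \<in> ?X"
        using lc_proj_mem_iff[OF subgroup_spanned _ _ _ commutator_jacobi[OF lc pos]] cl by (simp only: commutator_closed m_closed)
      from subgroup.m_closed[OF subgroup_spanned this 3]
      have "commutator G (commutator G (e a1) (e a2)) (e b) \<otimes>
          commutator G (e a2) (commutator G (e a1) (e b)) \<otimes>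
          inv (commutator G (e a2) (commutator G (e a1) (e b))) \<in> ?X"
        using cl by (simp only: inv_commutator commutator_closed)
      then have "commutator G (commutator G (e a1) (e a2)) (e b) \<in> ?X"
        using cl by (simp only: m_assoc r_inv r_one commutator_closed inv_closed)
      then show ?thesis by (simp only: a tree_comm.simps)
    qed
  qed
qed

lemma carrier_eq_spanned: "carrier G = spanned 1 (\<lambda>t. True)"
proof -
  have "x s \<in> spanned 1 (\<lambda>t. True)" if "s \<in> S" for s
    using that tree_comm_spanned[of "Leaf s" "\<lambda>t. True" 1] by simp
  then have "generate G (x ` S) \<subseteq> spanned 1 (\<lambda>t. True)"
    by (intro generate_subgroup_incl subgroup_spanned) auto
  then show ?thesis
    unfolding generate_x by (rule equalityI) (rule subgroup.subset[OF subgroup_spanned])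
qed

lemma lower_central_eq_spanned: "c \<ge> 1 \<Longrightarrow> lower_central G c = spanned c (\<lambda>t. True)"
proof (induction c rule: dec_induct)
  case base
  show ?case using carrier_eq_spanned by (simp only: One_nat_def lower_central.simps)
next
  case (step c)
  have sub: "spanned (Suc c) (\<lambda>t. True) \<subseteq> lower_central G (Suc c)"
    unfolding spanned_def by (intro generate_subgroup_incl span_subset subgroup_lower_central)
  have "commutator G a b \<in> spanned (1 + c) (\<lambda>t. True)" if "a \<in> carrier G" "b \<in> lower_central G c" for a b
  proof (rule commutator_spanned[where P = "\<lambda>t. True" and Q = "\<lambda>t. True"])
    show "a \<in> spanned 1 (\<lambda>t. True)" using that(1) by (simp only: carrier_eq_spanned)
    show "commutator G (e s) (e t) \<in> spanned (1 + c) (\<lambda>t. True)"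
      if "std S s" "length (word s) = 1" "std S t" "length (word t) = c" for s t
    proof -
      \<comment> \<open>Any word above both serves; a proper extension of the greater one is such a
        word.\<close>
      obtain v where v: "word s < v" "word t < v"
      proof
        have "max (word s) (word t) < max (word s) (word t) @ word s"
          by (simp only: less_append_right word_neq_Nil not_False_eq_True)
        then show "word s < max (word s) (word t) @ word s"
          by (rule le_less_trans[OF max.cobounded1])
        show "word t < max (word s) (word t) @ word s"
          by (rule le_less_trans[OF max.cobounded2]) fact
      qed
      have "commutator G (e s) (e t) \<in> spanned (1 + c) (\<lambda>t. word t < v)"
        by (rule commutator_spanned_less[OF commutator_std_spanned]) (use v that in simp_all)
      then show ?thesis by (rule subsetD[OF spanned_mono, rotated]) simp
    qed
  next
    show "b \<in> spanned c (\<lambda>t. True)" using that(2) step.IH by simp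
  qed (use step.hyps in auto)
  then have "lower_central G (Suc c) \<subseteq> spanned (Suc c) (\<lambda>t. True)"
    using step.hyps by (intro lower_central_Suc_subsetI subgroup_spanned) auto
  then show ?case using sub by blast
qed

end

section \<open>Centralizers modulo the lower central series\<close>

text \<open>Freeness of \<open>G\<close> on \<open>S\<close> is recorded only as a homomorphism to
  the Magnus units with prescribed values on the generators.\<close>

locale magnus_group = group_gen G x S for G (structure) and x :: "'s::linorder \<Rightarrow> 'a" and S +
  fixes \<mu> :: "'a \<Rightarrow> 's ncps"
  assumes hom_\<mu>: "\<mu> \<in> hom G ncps_units" and \<mu>_x: "s \<in> S \<Longrightarrow> \<mu> (x s) = 1 + ncps_var s"
begin

lemma \<mu>_unit: "a \<in> carrier G \<Longrightarrow> \<mu> a \<in> carrier ncps_units"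
  using hom_\<mu> by (auto simp: hom_def)

lemma \<mu>_mult: "\<lbrakk>a \<in> carrier G; b \<in> carrier G\<rbrakk> \<Longrightarrow> \<mu> (a \<otimes> b) = \<mu> a * \<mu> b"
  using hom_\<mu> by (auto simp: hom_def)

lemma \<mu>_one: "\<mu> \<one> = 1"
  using hom_one[OF hom_\<mu> is_group group_ncps_units] by simp

lemma \<mu>_commutator:
  assumes a: "a \<in> carrier G" "\<mu> a - 1 \<in> ord_ge i" and b: "b \<in> carrier G" "\<mu> b - 1 \<in> ord_ge j"
    and ij: "i \<ge> 1" "j \<ge> 1"
  shows "\<mu> (commutator G a b) - 1 - ((\<mu> a - 1) * (\<mu> b - 1) - (\<mu> b - 1) * (\<mu> a - 1)) \<in> ord_ge (Suc (i + j))"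
  using unit_commutator_ord_ge[OF \<mu>_unit[OF a(1)] a(2) \<mu>_unit[OF b(1)] b(2) ij]
    hom_commutator[OF is_group group_ncps_units hom_\<mu> a(1) b(1)] by simp

text \<open>With \<open>\<mu> a = 1 + u\<close> and \<open>\<mu> b = 1 + v\<close> the product is
  \<open>1 + u \<mu> b + v\<close> and the inverse is \<open>1 - u \<mu> (inv a)\<close>; a factor
  of order zero does not lower the order.\<close>

lemma subgroup_\<mu>_ord_ge: "subgroup {a \<in> carrier G. \<mu> a - 1 \<in> ord_ge c} G"
proof (rule subgroupI)
  fix a b assume ab: "a \<in> {a \<in> carrier G. \<mu> a - 1 \<in> ord_ge c}" "b \<in> {a \<in> carrier G. \<mu> a - 1 \<in> ord_ge c}"
  have "(\<mu> a - 1) * \<mu> b \<in> ord_ge (c + 0)"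
    using ab by (intro ord_ge_mult) auto
  then have "(\<mu> a - 1) * \<mu> b + (\<mu> b - 1) \<in> ord_ge c"
    using ab by (intro ord_ge_add) auto
  then show "a \<otimes> b \<in> {a \<in> carrier G. \<mu> a - 1 \<in> ord_ge c}"
    using ab by (simp add: \<mu>_mult algebra_simps)
next
  fix a assume a: "a \<in> {a \<in> carrier G. \<mu> a - 1 \<in> ord_ge c}"
  have "(\<mu> a - 1) * \<mu> (inv a) \<in> ord_ge (c + 0)"
    using a by (intro ord_ge_mult) auto
  then have "- ((\<mu> a - 1) * \<mu> (inv a)) \<in> ord_ge c" by (intro ord_ge_uminus) simp
  moreover have "\<mu> a * \<mu> (inv a) = 1"
    using a \<mu>_mult[of a "inv a"] \<mu>_one by simp
  ultimately show "inv a \<in> {a \<in> carrier G. \<mu> a - 1 \<in> ord_ge c}"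
    using a by (simp add: algebra_simps)
qed (auto intro!: exI[of _ \<one>] simp: \<mu>_one)

lemma \<mu>_lower_central: "a \<in> lower_central G c \<Longrightarrow> \<mu> a - 1 \<in> ord_ge c"
proof -
  have "x ` S \<subseteq> {a \<in> carrier G. \<mu> a - 1 \<in> ord_ge 1}"
    using x_closed \<mu>_x ncps_var_ord_ge by (auto simp: image_subset_iff)
  then have "generate G (x ` S) \<subseteq> {a \<in> carrier G. \<mu> a - 1 \<in> ord_ge 1}"
    by (rule generate_subgroup_incl[OF _ subgroup_\<mu>_ord_ge])
  then have 1: "\<mu> a - 1 \<in> ord_ge 1" if "a \<in> carrier G" for a
    using that unfolding generate_x by blast
  have "lower_central G c \<subseteq> {a \<in> carrier G. \<mu> a - 1 \<in> ord_ge c}" if "c \<ge> 1"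
    using that
  proof (induction c rule: dec_induct)
    case base
    show ?case using 1 by auto
  next
    case (step c)
    show ?case
    proof (rule lower_central_Suc_subsetI[OF step.hyps(1) subgroup_\<mu>_ord_ge])
      fix a b assume a: "a \<in> carrier G" and b: "b \<in> lower_central G c"
      have b': "b \<in> carrier G" "\<mu> b - 1 \<in> ord_ge c" using b step.IH by auto
      note a' = 1[OF a]
      let ?r = "(\<mu> a - 1) * (\<mu> b - 1) - (\<mu> b - 1) * (\<mu> a - 1)"
      have "?r \<in> ord_ge (Suc c)"
        using ord_ge_mult[OF a' b'(2)] ord_ge_mult[OF b'(2) a'] by (intro ord_ge_diff) simp_all
      moreover have "\<mu> (commutator G a b) - 1 - ?r \<in> ord_ge (Suc c)"
        using \<mu>_commutator[OF a a' b' _ step.hyps(1)] by (rule ord_ge_antimono[rotated]) simp_all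
      ultimately have "\<mu> (commutator G a b) - 1 - ?r + ?r \<in> ord_ge (Suc c)" by (intro ord_ge_add)
      then show "commutator G a b \<in> {a \<in> carrier G. \<mu> a - 1 \<in> ord_ge (Suc c)}"
        using a b' by (simp only: diff_add_cancel commutator_closed mem_Collect_eq)
    qed
  qed
  then show "a \<in> lower_central G c \<Longrightarrow> \<mu> a - 1 \<in> ord_ge c" by (cases "c = 0") auto
qed

lemma \<mu>_commutator_lowest:
  assumes a: "a \<in> lower_central G i" and b: "b \<in> lower_central G j" and ij: "i \<ge> 1" "j \<ge> 1"
    and w: "length w = i + j"
  shows "ncps_nth (\<mu> (commutator G a b)) w =
    ncps_nth (\<mu> a) (take i w) * ncps_nth (\<mu> b) (drop i w) - ncps_nth (\<mu> b) (take j w) * ncps_nth (\<mu> a) (drop j w)"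
proof -
  note o = \<mu>_lower_central[OF a] \<mu>_lower_central[OF b]
  have "ncps_nth (\<mu> (commutator G a b) - 1 - ((\<mu> a - 1) * (\<mu> b - 1) - (\<mu> b - 1) * (\<mu> a - 1))) w = 0"
    using \<mu>_commutator[OF lower_central_closed[OF a] o(1) lower_central_closed[OF b] o(2) ij] w
    by (simp add: ord_ge_def)
  moreover have "ncps_nth ((\<mu> a - 1) * (\<mu> b - 1)) w = ncps_nth (\<mu> a) (take i w) * ncps_nth (\<mu> b) (drop i w)"
    using ncps_nth_mult_lowest[OF o w] ij w by auto
  moreover have "ncps_nth ((\<mu> b - 1) * (\<mu> a - 1)) w = ncps_nth (\<mu> b) (take j w) * ncps_nth (\<mu> a) (drop j w)"
    using ncps_nth_mult_lowest[OF o(2,1), of w] ij w by auto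
  moreover have "w \<noteq> []" using w ij by auto
  ultimately show ?thesis by simp
qed

text \<open>In the lowest degree the expansion of a node is a difference of two products, with least
  words \<open>word a @ word b\<close> and \<open>word b @ word a\<close>. A Lyndon word is less
  than its nontrivial rotations, so the first is the smaller and keeps its coefficient one. Equal
  lengths make the order compatible with concatenation.\<close>

lemma \<mu>_tree_comm:
  "std S t \<Longrightarrow> ncps_nth (\<mu> (e t)) (word t) = 1"
  "\<lbrakk>std S t; length w = length (word t); w < word t\<rbrakk> \<Longrightarrow> ncps_nth (\<mu> (e t)) w = 0"
proof -
  have *: "ncps_nth (\<mu> (e t)) (word t) = 1 \<and>
      (\<forall>w. length w = length (word t) \<longrightarrow> w < word t \<longrightarrow> ncps_nth (\<mu> (e t)) w = 0)" if "std S t"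
    using that
  proof (induction t)
    case (Leaf s)
    then show ?case by (auto simp: \<mu>_x length_Suc_conv)
  next
    case (Node a b)
    let ?i = "length (word a)" and ?j = "length (word b)"
    have ab: "std S a" "std S b" and pos: "?i \<ge> 1" "?j \<ge> 1" using Node.prems by (auto simp: Suc_le_eq)
    note nth = \<mu>_commutator_lowest[OF tree_comm_lower_central[OF ab(1)] tree_comm_lower_central[OF ab(2)] pos]
    have swap: "word a @ word b < word b @ word a"
    proof -
      have "word a @ word b < word b" using std_Node_less(1)[OF Node.prems] by simp
      moreover have "word b \<noteq> (word a @ word b) @ z" for z by (auto dest: arg_cong[of _ _ length])
      ultimately have "(word a @ word b) @ [] < word b @ word a" by (rule less_append_not_prefix)
      then show ?thesis by simp
    qed
    have second: "ncps_nth (\<mu> (e b)) (take ?j w) * ncps_nth (\<mu> (e a)) (drop ?j w) = 0"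
      if w: "length w = ?i + ?j" "w \<le> word a @ word b" for w
    proof (rule ccontr)
      assume "\<not> ?thesis"
      then have "word b \<le> take ?j w" "word a \<le> drop ?j w"
        using Node.IH ab w(1) by (auto simp: not_less[symmetric])
      moreover have "length (take ?j w) \<le> length (word b)" by simp
      ultimately have "word b @ word a \<le> take ?j w @ drop ?j w"
        by (rule append_le_append_same_length)
      then show False using w(2) swap by simp
    qed
    have first: "ncps_nth (\<mu> (e a)) (take ?i w) * ncps_nth (\<mu> (e b)) (drop ?i w) = 0"
      if w: "length w = ?i + ?j" "w < word a @ word b" for w
    proof (rule ccontr)
      assume "\<not> ?thesis"
      then have "word a \<le> take ?i w" "word b \<le> drop ?i w"
        using Node.IH ab w(1) by (auto simp: not_less[symmetric])
      moreover have "length (take ?i w) \<le> length (word a)" by simp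
      ultimately have "word a @ word b \<le> take ?i w @ drop ?i w"
        by (rule append_le_append_same_length)
      then show False using w(2) by simp
    qed
    have "ncps_nth (\<mu> (e (Node a b))) (word (Node a b)) = 1"
      using nth[of "word a @ word b"] second[of "word a @ word b"] Node.IH ab by simp
    moreover have "ncps_nth (\<mu> (e (Node a b))) w = 0"
      if "length w = length (word (Node a b))" "w < word (Node a b)" for w
    proof -
      have w: "length w = ?i + ?j" "w < word a @ word b" using that by simp_all
      show ?thesis using nth[OF w(1)] first[OF w] second[OF w(1) less_imp_le[OF w(2)]] by simp
    qed
    ultimately show ?case by blast
  qed
  show "std S t \<Longrightarrow> ncps_nth (\<mu> (e t)) (word t) = 1"
    "\<lbrakk>std S t; length w = length (word t); w < word t\<rbrakk> \<Longrightarrow> ncps_nth (\<mu> (e t)) w = 0"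
    using * by auto
qed

lemma \<mu>_mult_lowest:
  assumes "a \<in> lower_central G c" "b \<in> lower_central G c" "c \<ge> 1" "length w = c"
  shows "ncps_nth (\<mu> (a \<otimes> b)) w = ncps_nth (\<mu> a) w + ncps_nth (\<mu> b) w"
proof -
  have "\<mu> (a \<otimes> b) = (\<mu> a - 1) * (\<mu> b - 1) + \<mu> a + \<mu> b - 1"
    using assms lower_central_closed by (simp add: \<mu>_mult algebra_simps)
  moreover have "ncps_nth ((\<mu> a - 1) * (\<mu> b - 1)) w = 0"
    using ord_ge_mult[OF \<mu>_lower_central[OF assms(1)] \<mu>_lower_central[OF assms(2)]] assms(3,4)
    by (simp add: ord_ge_def)
  moreover have "w \<noteq> []" using assms by auto
  ultimately show ?thesis by simp
qed

lemma \<mu>_hom_integer_group: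
  assumes "c \<ge> 1" "length w = c"
  shows "group_hom (G\<lparr>carrier := lower_central G c\<rparr>) integer_group (\<lambda>a. ncps_nth (\<mu> a) w)"
  using assms subgroup_imp_group[OF subgroup_lower_central] \<mu>_mult_lowest
  by (auto simp: group_hom_def group_hom_axioms_def intro!: homI)

text \<open>Trees are removed in the order of their words. For the tree \<open>t\<close> with the
  least word, the coefficient \<open>\<chi>\<close> at \<open>word t\<close> is a homomorphism from
  \<open>\<Gamma>(c)\<close> to the integers that is one on \<open>e t\<close> and zero on
  \<open>\<Gamma>(c + 1)\<close> and on the other trees. The subgroup \<open>H\<close> generated by
  these others lies between \<open>\<Gamma>(c + 1)\<close> and \<open>\<Gamma>(c)\<close>, hence is
  normal; so \<open>g\<close> is an element of \<open>H\<close> times a power of \<open>e t\<close>,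
  and \<open>\<chi> g = 0\<close> makes the exponent vanish.\<close>

lemma spanned_ord_ge:
  assumes c: "c \<ge> 1" and T: "finite T" "T \<subseteq> {t. std S t \<and> length (word t) = c}"
    and g: "g \<in> generate G (lower_central G (Suc c) \<union> e ` T)" "\<mu> g - 1 \<in> ord_ge (Suc c)"
  shows "g \<in> lower_central G (Suc c)"
  using T g(1)
proof (induction "card T" arbitrary: T)
  case 0
  then show ?case
    using generate_subgroup_incl[OF _ subgroup_lower_central, of "lower_central G (Suc c)" "Suc c"] by auto
next
  case (Suc n)
  then have "T \<noteq> {}" by auto
  then obtain t where t: "t \<in> T" "\<And>u. u \<in> T \<Longrightarrow> word t \<le> word u"
    using arg_min_if_finite[OF Suc.prems(1), of word] by (metis not_le)
  have std: "std S t" "length (word t) = c" using t(1) Suc.prems by auto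
  have et: "e t \<in> lower_central G c" using tree_comm_lower_central std by auto
  define H where "H = generate G (lower_central G (Suc c) \<union> e ` (T - {t}))"
  define \<chi> where "\<chi> a = ncps_nth (\<mu> a) (word t)" for a
  interpret \<chi>: group_hom "G\<lparr>carrier := lower_central G c\<rparr>" integer_group \<chi>
    unfolding \<chi>_def using c std by (intro \<mu>_hom_integer_group) auto
  have gens: "lower_central G (Suc c) \<union> e ` (T - {t}) \<subseteq> lower_central G c"
    using lower_central_Suc_subset tree_comm_lower_central Suc.prems by fastforce
  then have sub: "H \<subseteq> lower_central G c"
    unfolding H_def by (rule generate_subgroup_incl[OF _ subgroup_lower_central])
  have H: "subgroup H G"
    unfolding H_def using gens lower_central_closed by (intro generate_is_subgroup) blast
  have \<Gamma>H: "lower_central G (Suc c) \<subseteq> H" unfolding H_def by (auto intro: generate.incl)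
  have normal: "H \<lhd> G"
  proof (subst normal_inv_iff, intro conjI ballI)
    fix a h assume a: "a \<in> carrier G" and h: "h \<in> H"
    have hc: "h \<in> carrier G" using h H by (rule subgroup.mem_carrier[rotated])
    have "commutator G a h \<otimes> h \<in> H"
      using commutator_lower_central[OF a, of h c] h sub \<Gamma>H by (intro subgroup.m_closed[OF H]) auto
    then show "a \<otimes> h \<otimes> inv a \<in> H" using a hc by (simp add: commutator_def m_assoc)
  qed (rule H)
  have \<chi>H: "\<chi> h = 0" if "h \<in> H" for h
  proof -
    have "subgroup (kernel (G\<lparr>carrier := lower_central G c\<rparr>) integer_group \<chi>) (G\<lparr>carrier := lower_central G c\<rparr>)"
      by (rule \<chi>.subgroup_kernel)
    then have ker: "subgroup {a \<in> lower_central G c. \<chi> a = 0} G"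
      using incl_subgroup[OF subgroup_lower_central] by (simp add: kernel_def)
    have "\<chi> a = 0" if "a \<in> lower_central G (Suc c)" for a
    proof -
      have "word t \<noteq> []" by simp
      then show ?thesis
        using \<mu>_lower_central[OF that] std by (auto simp: ord_ge_def \<chi>_def simp del: word_neq_Nil)
    qed
    moreover have "\<chi> (e u) = 0" if "u \<in> T - {t}" for u
    proof -
      have "word t < word u" using t(2)[of u] that std_word_inj[of S t u] std Suc.prems(2)
        by (auto simp: order.order_iff_strict)
      then show ?thesis using \<mu>_tree_comm(2)[of u "word t"] that Suc.prems(2) std by (auto simp: \<chi>_def)
    qed
    ultimately have "lower_central G (Suc c) \<union> e ` (T - {t}) \<subseteq> {a \<in> lower_central G c. \<chi> a = 0}"
      using gens by auto
    then have "H \<subseteq> {a \<in> lower_central G c. \<chi> a = 0}"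
      unfolding H_def by (rule generate_subgroup_incl[OF _ ker])
    then show ?thesis using that by auto
  qed
  have cl: "e t \<in> carrier G" using et by (rule lower_central_closed)
  have "subgroup (H <#> generate G {e t}) G"
    using cl by (intro mult_norm_subgroup[OF normal] generate_is_subgroup) auto
  moreover have "a \<in> H <#> generate G {e t}" if "a \<in> H \<or> a = e t" for a
    using that
  proof
    assume "a \<in> H"
    then have "a \<otimes> \<one> \<in> H <#> generate G {e t}"
      unfolding set_mult_def by (blast intro: generate.one)
    then show ?thesis using subgroup.mem_carrier[OF H \<open>a \<in> H\<close>] by simp
  next
    assume "a = e t"
    have "\<one> \<otimes> e t \<in> H <#> generate G {e t}"
      unfolding set_mult_def using subgroup.one_closed[OF H] by (blast intro: generate.incl)
    then show ?thesis using cl \<open>a = e t\<close> by simp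
  qed
  then have "lower_central G (Suc c) \<union> e ` T \<subseteq> H <#> generate G {e t}"
    unfolding H_def by (auto intro: generate.incl)
  ultimately have "g \<in> H <#> generate G {e t}"
    using generate_subgroup_incl Suc.prems(3) by blast
  then obtain h k where h: "h \<in> H" and g_eq: "g = h \<otimes> e t [^] (k::int)"
    unfolding set_mult_def generate_pow[OF cl] by auto
  have pow: "e t [^] k \<in> lower_central G c" "\<chi> (e t [^] k) = k"
  proof -
    have eq: "e t [^] k = e t [^]\<^bsub>G\<lparr>carrier := lower_central G c\<rparr>\<^esub> k"
      using int_pow_consistent[OF subgroup_lower_central et] by simp
    show "e t [^] k \<in> lower_central G c"
      using subgroup_int_pow_closed[OF subgroup_lower_central et] .
    show "\<chi> (e t [^] k) = k"
      unfolding eq using \<chi>.hom_int_pow[of "e t" k] et \<mu>_tree_comm(1)[OF std(1)] by (simp add: \<chi>_def)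
  qed
  have "\<chi> g = k"
    using \<chi>.hom_mult[of h "e t [^] k"] h sub pow \<chi>H[OF h] unfolding g_eq by auto
  moreover have "\<chi> g = 0"
  proof -
    have "word t \<noteq> []" by simp
    then show ?thesis using g(2) std by (auto simp: ord_ge_def \<chi>_def simp del: word_neq_Nil)
  qed
  ultimately have "g \<in> H" using h g_eq subgroup.mem_carrier[OF H h] by simp
  show ?case
  proof (rule Suc.hyps(1)[of "T - {t}"])
    show "n = card (T - {t})" using Suc.hyps(2) Suc.prems(1) t(1) by simp
    show "T - {t} \<subseteq> {t. std S t \<and> length (word t) = c}" using Suc.prems(2) by blast
  qed (use \<open>g \<in> H\<close> Suc.prems(1) in \<open>simp_all add: H_def\<close>)
qed

lemma lower_central_ord_ge:
  assumes "c \<ge> 1" "g \<in> lower_central G c" "\<mu> g - 1 \<in> ord_ge (Suc c)"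
  shows "g \<in> lower_central G (Suc c)"
  using spanned_ord_ge[OF assms(1) finite_std[OF finite_S, of c] _ _ assms(3)] assms(2)
    lower_central_eq_spanned[OF assms(1)] by (simp add: spanned_def)

text \<open>A commutator two terms deeper than \<open>g\<close> has no Magnus part in degree
  \<open>c + 1\<close>. The degree \<open>c\<close> part of \<open>g\<close> therefore commutes with
  the variables, and so is zero.\<close>

lemma lower_central_centralizer_step:
  assumes "s \<in> S" "t \<in> S" "s \<noteq> t" and c: "c \<ge> 1" and g: "g \<in> lower_central G c"
    and comm: "\<And>u. u \<in> S \<Longrightarrow> commutator G (x u) g \<in> lower_central G (Suc (Suc c))"
  shows "g \<in> lower_central G (Suc c)"
proof (rule lower_central_ord_ge[OF c g])
  show "\<mu> g - 1 \<in> ord_ge (Suc c)"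
  proof (rule ncps_central_eq_0[OF \<mu>_lower_central[OF g] c assms(3)])
    fix w :: "'s list" and a assume w: "length w = Suc c" and "a \<in> {s, t}"
    then have a: "a \<in> S" using assms by auto
    then have xa: "x a \<in> carrier G" "\<mu> (x a) - 1 = ncps_var a" using x_closed \<mu>_x by auto
    have "\<mu> (commutator G (x a) g) - 1 - (ncps_var a * (\<mu> g - 1) - (\<mu> g - 1) * ncps_var a) \<in> ord_ge (Suc (1 + c))"
      using \<mu>_commutator[OF xa(1) _ lower_central_closed[OF g] \<mu>_lower_central[OF g] _ c, of 1] ncps_var_ord_ge[of a] xa(2)
      by simp
    moreover have "\<mu> (commutator G (x a) g) - 1 \<in> ord_ge (Suc (1 + c))"
      using \<mu>_lower_central[OF comm[OF a]] by simp
    ultimately show "ncps_nth (ncps_var a * (\<mu> g - 1)) w = ncps_nth ((\<mu> g - 1) * ncps_var a) w"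
      using w by (simp add: ord_ge_def)
  qed
qed

text \<open>Climb from \<open>\<Gamma>(1)\<close>; the step from \<open>c\<close> to
  \<open>c + 1\<close> asks for commutators in \<open>\<Gamma>(c + 2)\<close>, which is available
  while \<open>c < d\<close>.\<close>

lemma lower_central_centralizer:
  assumes st: "s \<in> S" "t \<in> S" "s \<noteq> t" and "d \<ge> 1" and g: "g \<in> carrier G"
    and comm: "\<And>u. u \<in> S \<Longrightarrow> commutator G (x u) g \<in> lower_central G (Suc d)"
  shows "g \<in> lower_central G d"
proof -
  have "g \<in> lower_central G c" if "1 \<le> c" "c \<le> d" for c
    using that
  proof (induction c rule: dec_induct)
    case (step c)
    have "lower_central G (Suc d) \<subseteq> lower_central G (Suc (Suc c))"
      using step.prems by (intro lower_central_antimono) simp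
    moreover have "g \<in> lower_central G c" using step by simp
    ultimately show ?case
      using comm by (intro lower_central_centralizer_step[OF st step.hyps(1)]) blast+
  qed (use g in simp)
  then show ?thesis using assms by simp
qed

end

section \<open>Automorphism groups\<close>

context group begin

lemma subgroup_lower_central_mono:
  assumes "subgroup H G" "subgroup K G" "H \<subseteq> K"
  shows "lower_central (G\<lparr>carrier := H\<rparr>) j \<subseteq> lower_central (G\<lparr>carrier := K\<rparr>) j"
proof -
  have "subgroup H (G\<lparr>carrier := K\<rparr>)" using assms by (rule subgroup_incl)
  then have "id \<in> hom (G\<lparr>carrier := H\<rparr>) (G\<lparr>carrier := K\<rparr>)"
    using assms(3) by (auto simp: hom_def dest: subgroup.m_closed)
  from hom_lower_central[OF subgroup_imp_group[OF assms(1)] subgroup_imp_group[OF assms(2)] this]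
  show ?thesis by simp
qed

lemma commutator_subgroup_consistent:
  assumes "subgroup H G" "x \<in> H" "y \<in> H"
  shows "commutator (G\<lparr>carrier := H\<rparr>) x y = commutator G x y"
  using assms by (simp add: commutator_def m_inv_consistent)

lemma carrier_AutoGroup [simp]: "carrier (AutoGroup G) = auto G"
  by (simp add: AutoGroup_def)

lemma auto_hom: "f \<in> auto G \<Longrightarrow> f \<in> hom G G"
  by (simp add: auto_def)

lemma auto_group_hom: "f \<in> auto G \<Longrightarrow> group_hom G G f"
  using auto_hom is_group by (simp add: group_hom_def group_hom_axioms_def)

lemma auto_closed: "\<lbrakk>f \<in> auto G; x \<in> carrier G\<rbrakk> \<Longrightarrow> f x \<in> carrier G"
  using auto_hom by (auto simp: hom_def)

lemma auto_extensional: "f \<in> auto G \<Longrightarrow> f \<in> extensional (carrier G)"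
  by (simp add: auto_def Bij_def)

lemma auto_eqI: "\<lbrakk>f \<in> auto G; g \<in> auto G; \<And>x. x \<in> carrier G \<Longrightarrow> f x = g x\<rbrakk> \<Longrightarrow> f = g"
  using auto_extensional by (intro extensionalityI)

lemma auto_mult_apply:
  "\<lbrakk>f \<in> auto G; g \<in> auto G; x \<in> carrier G\<rbrakk> \<Longrightarrow> (f \<otimes>\<^bsub>AutoGroup G\<^esub> g) x = f (g x)"
  by (simp add: AutoGroup_def BijGroup_def auto_def compose_def)

lemma auto_one_apply: "x \<in> carrier G \<Longrightarrow> \<one>\<^bsub>AutoGroup G\<^esub> x = x"
  by (simp add: AutoGroup_def BijGroup_def)

lemma auto_inv_closed: "f \<in> auto G \<Longrightarrow> inv\<^bsub>AutoGroup G\<^esub> f \<in> auto G"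
  using group.inv_closed[OF AutoGroup] by simp

lemma auto_mult_closed: "\<lbrakk>f \<in> auto G; g \<in> auto G\<rbrakk> \<Longrightarrow> f \<otimes>\<^bsub>AutoGroup G\<^esub> g \<in> auto G"
  using monoid.m_closed[OF group.is_monoid[OF AutoGroup]] by simp

lemma auto_inv_apply:
  assumes "f \<in> auto G" "x \<in> carrier G"
  shows "f ((inv\<^bsub>AutoGroup G\<^esub> f) x) = x" "(inv\<^bsub>AutoGroup G\<^esub> f) (f x) = x"
proof -
  interpret A: group "AutoGroup G" by (rule AutoGroup)
  have "f \<otimes>\<^bsub>AutoGroup G\<^esub> inv\<^bsub>AutoGroup G\<^esub> f = \<one>\<^bsub>AutoGroup G\<^esub>"
    "inv\<^bsub>AutoGroup G\<^esub> f \<otimes>\<^bsub>AutoGroup G\<^esub> f = \<one>\<^bsub>AutoGroup G\<^esub>"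
    using assms by simp_all
  then show "f ((inv\<^bsub>AutoGroup G\<^esub> f) x) = x" "(inv\<^bsub>AutoGroup G\<^esub> f) (f x) = x"
    using assms auto_mult_apply[of f "inv\<^bsub>AutoGroup G\<^esub> f" x]
      auto_mult_apply[of "inv\<^bsub>AutoGroup G\<^esub> f" f x] auto_one_apply auto_inv_closed by simp_all
qed

lemma auto_lower_central: "\<lbrakk>f \<in> auto G; x \<in> lower_central G j\<rbrakk> \<Longrightarrow> f x \<in> lower_central G j"
  using hom_lower_central[OF is_group is_group auto_hom] by blast

lemma andreadakis_filtration_iff: "f \<in> andreadakis_filtration G j \<longleftrightarrow> f \<in> auto G \<and> displaces f j"
  by (simp add: andreadakis_filtration_def displaces_def)

lemma displaces_antimono: "\<lbrakk>i \<le> j; displaces f j\<rbrakk> \<Longrightarrow> displaces f i"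
  unfolding displaces_def using subsetD[OF lower_central_antimono[OF add_left_mono[of i j]]] by blast

lemma andreadakis_filtration_antimono:
  "i \<le> j \<Longrightarrow> andreadakis_filtration G j \<subseteq> andreadakis_filtration G i"
  using displaces_antimono by (auto simp: andreadakis_filtration_iff)

lemma subgroup_andreadakis_filtration: "subgroup (andreadakis_filtration G j) (AutoGroup G)"
proof (rule group.subgroupI[OF AutoGroup])
  have "\<one>\<^bsub>AutoGroup G\<^esub> \<in> andreadakis_filtration G j"
    using group.is_monoid[OF AutoGroup, THEN monoid.one_closed] lower_central_closed
    by (auto simp: andreadakis_filtration_def auto_one_apply)
  then show "andreadakis_filtration G j \<noteq> {}" by auto
next
  fix f assume "f \<in> andreadakis_filtration G j"
  then have f: "f \<in> auto G" "displaces f j" by (auto simp: andreadakis_filtration_iff)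
  let ?f = "inv\<^bsub>AutoGroup G\<^esub> f"
  have "?f g \<otimes> inv g \<in> lower_central G (i + j)" if "i \<ge> 1" "g \<in> lower_central G i" for i g
  proof -
    have g: "g \<in> carrier G" using that lower_central_closed by auto
    have h: "?f g \<in> lower_central G i" using that f auto_inv_closed auto_lower_central by blast
    have "inv (f (?f g) \<otimes> inv (?f g)) \<in> lower_central G (i + j)"
      using displacesD[OF f(2) that(1) h] by (rule lower_central_inv)
    then show ?thesis
      using g lower_central_closed[OF h] f by (simp add: auto_inv_apply inv_mult_group)
  qed
  then show "?f \<in> andreadakis_filtration G j"
    using f auto_inv_closed by (simp add: andreadakis_filtration_def)
next
  fix f f' assume "f \<in> andreadakis_filtration G j" "f' \<in> andreadakis_filtration G j"
  then have f: "f \<in> auto G" "displaces f j" "f' \<in> auto G" "displaces f' j"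
    by (auto simp: andreadakis_filtration_iff)
  have "f (f' g) \<otimes> inv g \<in> lower_central G (i + j)" if "i \<ge> 1" "g \<in> lower_central G i" for i g
  proof -
    have g: "g \<in> carrier G" using that lower_central_closed by auto
    have h: "f' g \<in> lower_central G i" using that f auto_lower_central by blast
    have "(f (f' g) \<otimes> inv (f' g)) \<otimes> (f' g \<otimes> inv g) \<in> lower_central G (i + j)"
      by (rule lower_central_mult[OF displacesD[OF f(2) that(1) h] displacesD[OF f(4) that]])
    then show ?thesis
      using g f auto_closed by (simp add: word_simps)
  qed
  then show "f \<otimes>\<^bsub>AutoGroup G\<^esub> f' \<in> andreadakis_filtration G j"
    using f auto_mult_closed lower_central_closed
    by (auto simp: andreadakis_filtration_def auto_mult_apply)
qed (auto simp: andreadakis_filtration_def)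

text \<open>The auxiliary \<open>h\<close> is the inverse of \<open>f' f\<close>, so the
  displacement of \<open>g\<close> by the commutator compares \<open>f f'\<close> with
  \<open>f' f\<close> at \<open>h g\<close>, as for conjugations in
  \<open>displaces_conj\<close>.\<close>

lemma commutator_andreadakis_filtration:
  assumes "f \<in> andreadakis_filtration G 1" "f' \<in> andreadakis_filtration G j"
  shows "commutator (AutoGroup G) f f' \<in> andreadakis_filtration G (Suc j)"
proof -
  interpret A: group "AutoGroup G" by (rule AutoGroup)
  have f: "f \<in> auto G" "displaces f 1" "f' \<in> auto G" "displaces f' j"
    using assms by (auto simp: andreadakis_filtration_iff)
  define h where "h = inv\<^bsub>AutoGroup G\<^esub> f \<otimes>\<^bsub>AutoGroup G\<^esub> inv\<^bsub>AutoGroup G\<^esub> f'"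
  have h: "h \<in> auto G" using f auto_inv_closed auto_mult_closed unfolding h_def by blast
  have "commutator (AutoGroup G) f f' = f \<otimes>\<^bsub>AutoGroup G\<^esub> (f' \<otimes>\<^bsub>AutoGroup G\<^esub> h)"
    using f by (simp add: commutator_def h_def A.m_assoc auto_inv_closed auto_mult_closed)
  moreover have "f' (f (h g)) = g" if "g \<in> carrier G" for g
    using that f auto_inv_closed auto_closed by (simp add: h_def auto_mult_apply auto_inv_apply)
  moreover have "f (f' (h g)) \<otimes> inv (f' (f (h g))) \<in> lower_central G (i + Suc j)"
    if "i \<ge> 1" "g \<in> lower_central G i" for i g
    using auto_lower_central[OF h that(2)]
    by (intro displaces_commute[OF auto_hom[OF f(1)] auto_hom[OF f(3)] f(2,4) that(1)])
  moreover have "commutator (AutoGroup G) f f' \<in> auto G" using A.commutator_closed[of f f'] f by simp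
  ultimately show ?thesis
    using f h auto_mult_closed auto_closed lower_central_closed
    by (simp add: andreadakis_filtration_def auto_mult_apply)
qed

lemma derived_eq_lower_central: "derived G (carrier G) = lower_central G 2"
proof -
  have "(\<Union>h1\<in>carrier G. \<Union>h2\<in>carrier G. {h1 \<otimes> h2 \<otimes> inv h1 \<otimes> inv h2}) =
      {commutator G x y | x y. x \<in> carrier G \<and> y \<in> carrier G}"
    by (auto simp: commutator_def)
  then show ?thesis by (simp add: derived_def numeral_2_eq_2 lower_central.simps(3))
qed

text \<open>An endomorphism that is trivial on the abelianisation is trivial on every graded piece.
  By the Leibniz rule the displacement of \<open>[g, h]\<close> is \<open>[a, h] [g, b]\<close> to
  leading order, with \<open>a\<close> and \<open>b\<close> the displacements of \<open>g\<close>
  and \<open>h\<close>, each one degree deeper.\<close>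

lemma displaces_1I:
  assumes f: "f \<in> hom G G" and 1: "\<And>g. g \<in> carrier G \<Longrightarrow> f g \<otimes> inv g \<in> lower_central G 2"
  shows "displaces f 1"
proof -
  interpret f: group_hom G G f using f is_group by (simp add: group_hom_def group_hom_axioms_def)
  have sub: "subgroup {g \<in> lower_central G i. f g \<otimes> inv g \<in> lower_central G (Suc i)} G" for i
  proof (rule subgroupI)
    fix g assume g: "g \<in> {g \<in> lower_central G i. f g \<otimes> inv g \<in> lower_central G (Suc i)}"
    then have c: "g \<in> carrier G" using lower_central_closed by auto
    have "inv g \<otimes> inv (f g \<otimes> inv g) \<otimes> inv (inv g) \<in> lower_central G (Suc i)"
      using g c by (intro lower_central_conj lower_central_inv) auto
    then show "inv g \<in> {g \<in> lower_central G i. f g \<otimes> inv g \<in> lower_central G (Suc i)}"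
      using g c by (simp add: word_simps lower_central_inv)
  next
    fix g h assume gh: "g \<in> {g \<in> lower_central G i. f g \<otimes> inv g \<in> lower_central G (Suc i)}"
      "h \<in> {g \<in> lower_central G i. f g \<otimes> inv g \<in> lower_central G (Suc i)}"
    then have c: "g \<in> carrier G" "h \<in> carrier G" using lower_central_closed by auto
    have "(f g \<otimes> inv g) \<otimes> (g \<otimes> (f h \<otimes> inv h) \<otimes> inv g) \<in> lower_central G (Suc i)"
      using gh by (intro lower_central_mult[of "f g \<otimes> inv g"] lower_central_conj[OF c(1)]) auto
    then show "g \<otimes> h \<in> {g \<in> lower_central G i. f g \<otimes> inv g \<in> lower_central G (Suc i)}"
      using gh c by (simp add: word_simps lower_central_mult)
  qed (use lower_central_closed in \<open>auto intro!: exI[of _ \<one>]\<close>)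
  have "lower_central G i \<subseteq> {g \<in> lower_central G i. f g \<otimes> inv g \<in> lower_central G (Suc i)}" if "i \<ge> 1" for i
    using that
  proof (induction i rule: dec_induct)
    case base
    then show ?case using 1 by (auto simp: numeral_2_eq_2)
  next
    case (step i)
    show ?case
    proof (rule lower_central_Suc_subsetI[OF step.hyps(1) sub])
      fix g h assume g: "g \<in> carrier G" and h: "h \<in> lower_central G i"
      have hc: "h \<in> carrier G" using h by (rule lower_central_closed)
      define a where "a = f g \<otimes> inv g"
      define b where "b = f h \<otimes> inv h"
      have a: "a \<in> lower_central G (1 + 1)" using 1[OF g] by (simp add: a_def numeral_2_eq_2)
      have b: "b \<in> lower_central G (i + 1)" using h step.IH by (auto simp: b_def)
      have ab: "f g = a \<otimes> g" "f h = b \<otimes> h" using g hc by (simp_all add: a_def b_def m_assoc)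
      have abc: "a \<in> carrier G" "b \<in> carrier G" using a b lower_central_closed by blast+
      have mem: "commutator G a h \<otimes> commutator G g b \<in> lower_central G (Suc (Suc i))"
        using lower_central_commutator[OF a h] lower_central_commutator[of g 1, OF _ b] g step.hyps(1)
        by (simp add: lower_central_mult)
      have gh: "commutator G g h \<in> lower_central G (Suc i)"
        using g h by (rule commutator_lower_central)
      have "commutator G (a \<otimes> g) (b \<otimes> h) \<otimes> inv (commutator G g h) \<in> lower_central G (Suc (Suc i))"
      proof (rule iffD2[OF lc_proj_mem_iff mem])
        show "lc_proj (Suc (1 + i + 1)) (commutator G (a \<otimes> g) (b \<otimes> h) \<otimes> inv (commutator G g h)) =
            lc_proj (Suc (1 + i + 1)) (commutator G a h \<otimes> commutator G g b)"
          using a b g h step.hyps(1) by (intro commutator_leibniz) auto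
        show "lower_central G (Suc (1 + i + 1)) \<subseteq> lower_central G (Suc (Suc i))"
          by (rule lower_central_antimono) simp
      qed (use g hc abc in \<open>simp_all add: subgroup_lower_central\<close>)
      then show "commutator G g h \<in> {g \<in> lower_central G (Suc i). f g \<otimes> inv g \<in> lower_central G (Suc (Suc i))}"
        using gh g hc by (simp add: hom_commutator[OF is_group is_group f] ab)
    qed
  qed
  then show ?thesis by (auto simp: displaces_def)
qed

section \<open>Inner automorphisms, and \<open>IA\<close> as the first term of the
  filtration\<close>

definition conj_auto :: "'a \<Rightarrow> 'a \<Rightarrow> 'a" where
  "conj_auto g = (\<lambda>h\<in>carrier G. g \<otimes> h \<otimes> inv g)"

lemma Inn_eq: "Inn G = conj_auto ` carrier G"
  by (simp add: Inn_def conj_auto_def)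

lemma conj_auto_apply: "h \<in> carrier G \<Longrightarrow> conj_auto g h = g \<otimes> h \<otimes> inv g"
  by (simp add: conj_auto_def)

lemma conj_auto_auto: "g \<in> carrier G \<Longrightarrow> conj_auto g \<in> auto G"
proof -
  assume g: "g \<in> carrier G"
  have "bij_betw (conj_auto g) (carrier G) (carrier G)"
    by (rule bij_betw_byWitness[of _ "conj_auto (inv g)"])
      (use g in \<open>auto simp: conj_auto_apply word_simps\<close>)
  moreover have "conj_auto g \<in> hom G G"
    using g by (intro homI) (simp_all add: conj_auto_apply word_simps)
  ultimately show ?thesis by (auto simp: auto_def Bij_def conj_auto_def)
qed

lemma conj_auto_mult:
  "\<lbrakk>g \<in> carrier G; h \<in> carrier G\<rbrakk> \<Longrightarrow> conj_auto (g \<otimes> h) = conj_auto g \<otimes>\<^bsub>AutoGroup G\<^esub> conj_auto h"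
  by (rule auto_eqI)
    (simp_all add: conj_auto_auto auto_mult_closed auto_mult_apply conj_auto_apply word_simps)

lemma group_hom_conj_auto: "group_hom G (AutoGroup G) conj_auto"
  using is_group AutoGroup conj_auto_auto conj_auto_mult
  by (auto simp: group_hom_def group_hom_axioms_def intro!: homI)

lemma normal_Inn: "Inn G \<lhd> AutoGroup G"
proof -
  interpret A: group "AutoGroup G" by (rule AutoGroup)
  interpret c: group_hom G "AutoGroup G" conj_auto by (rule group_hom_conj_auto)
  show ?thesis unfolding Inn_eq
  proof (subst A.normal_inv_iff, intro conjI ballI)
    show "subgroup (conj_auto ` carrier G) (AutoGroup G)" by (rule c.img_is_subgroup)
    fix f h assume f: "f \<in> carrier (AutoGroup G)" and "h \<in> conj_auto ` carrier G"
    then obtain g where g: "g \<in> carrier G" "h = conj_auto g" by auto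
    have f: "f \<in> auto G" using f by simp
    interpret f: group_hom G G f using f by (rule auto_group_hom)
    have "f \<otimes>\<^bsub>AutoGroup G\<^esub> h \<otimes>\<^bsub>AutoGroup G\<^esub> inv\<^bsub>AutoGroup G\<^esub> f = conj_auto (f g)"
      using f g auto_inv_closed auto_closed
      by (intro auto_eqI) (simp_all add: auto_mult_closed auto_mult_apply conj_auto_auto conj_auto_apply auto_inv_apply)
    then show "f \<otimes>\<^bsub>AutoGroup G\<^esub> h \<otimes>\<^bsub>AutoGroup G\<^esub> inv\<^bsub>AutoGroup G\<^esub> f \<in> conj_auto ` carrier G"
      using f g auto_closed by auto
  qed
qed

lemma displaces_conj_auto:
  assumes "g \<in> lower_central G j" "j \<ge> 1"
  shows "displaces (conj_auto g) j"
  using displaces_conj[OF assms] lower_central_closed by (simp add: displaces_def conj_auto_apply)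

text \<open>Mapping a coset into itself, applied to \<open>f\<close> and to its inverse, gives
  equality. Conversely, fixed cosets bound the displacement in degree one, and
  \<open>displaces_1I\<close> carries this to all degrees.\<close>

lemma IA_eq_andreadakis_filtration: "IA G = andreadakis_filtration G 1"
proof -
  interpret N: normal "lower_central G 2" G by (rule normal_lower_central)
  have image: "f ` (lower_central G 2 #> g) \<subseteq> lower_central G 2 #> g"
    if f: "f \<in> andreadakis_filtration G 1" and g: "g \<in> carrier G" for f g
  proof (rule image_subsetI)
    fix h assume h: "h \<in> lower_central G 2 #> g"
    then have hc: "h \<in> carrier G" using g by (rule N.elemrcos_carrier[OF is_group, rotated])
    have "f \<in> auto G" "displaces f 1" using f by (simp_all add: andreadakis_filtration_iff)
    then have fh: "f h \<in> carrier G" "f h \<otimes> inv h \<in> lower_central G 2"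
      using hc auto_closed displacesD[of f 1 1 h] by (simp_all add: numeral_2_eq_2)
    then have "f h \<in> lower_central G 2 #> h"
      using N.rcos_module[OF is_group hc fh(1)] by simp
    then show "f h \<in> lower_central G 2 #> g"
      unfolding repr_independence[OF h g N.is_subgroup] .
  qed
  show ?thesis
  proof (intro equalityI subsetI)
    fix f assume f: "f \<in> andreadakis_filtration G 1"
    have "f ` (lower_central G 2 #> g) = lower_central G 2 #> g" if g: "g \<in> carrier G" for g
    proof
      show "lower_central G 2 #> g \<subseteq> f ` (lower_central G 2 #> g)"
      proof
        fix h assume h: "h \<in> lower_central G 2 #> g"
        then have hc: "h \<in> carrier G" using g by (rule N.elemrcos_carrier[OF is_group, rotated])
        have "inv\<^bsub>AutoGroup G\<^esub> f \<in> andreadakis_filtration G 1"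
          using f subgroup.m_inv_closed[OF subgroup_andreadakis_filtration] by blast
        then have "(inv\<^bsub>AutoGroup G\<^esub> f) h \<in> lower_central G 2 #> g" using image[OF _ g] h by blast
        moreover have "f ((inv\<^bsub>AutoGroup G\<^esub> f) h) = h"
          using f hc by (intro auto_inv_apply) (auto simp: andreadakis_filtration_def)
        ultimately show "h \<in> f ` (lower_central G 2 #> g)" by force
      qed
    qed (rule image[OF f g])
    then show "f \<in> IA G"
      using f by (auto simp: IA_def derived_eq_lower_central carrier_FactGroup andreadakis_filtration_def)
  next
    fix f assume f: "f \<in> IA G"
    then have fa: "f \<in> auto G" by (simp add: IA_def)
    have "f g \<otimes> inv g \<in> lower_central G 2" if g: "g \<in> carrier G" for g
    proof -
      have "f ` (lower_central G 2 #> g) = lower_central G 2 #> g"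
        using f g by (auto simp: IA_def derived_eq_lower_central carrier_FactGroup)
      then have "f g \<in> lower_central G 2 #> g"
        using rcos_self[OF g N.is_subgroup] by blast
      then show ?thesis using N.rcos_module[OF is_group g] fa g auto_closed by blast
    qed
    then show "f \<in> andreadakis_filtration G 1"
      using fa displaces_1I[OF auto_hom[OF fa]] by (simp add: andreadakis_filtration_iff)
  qed
qed

lemma subgroup_IA: "subgroup (IA G) (AutoGroup G)"
  unfolding IA_eq_andreadakis_filtration by (rule subgroup_andreadakis_filtration)

lemma Inn_subset_IA: "Inn G \<subseteq> IA G"
  using displaces_conj_auto[of _ 1] conj_auto_auto
  by (auto simp: Inn_eq IA_eq_andreadakis_filtration andreadakis_filtration_iff)

lemma lower_central_IA_subset:
  assumes "j \<ge> 1"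
  shows "lower_central (aut_subgroup G (IA G)) j \<subseteq> andreadakis_filtration G j"
  using assms
proof (induction j rule: dec_induct)
  case base
  then show ?case by (simp add: IA_eq_andreadakis_filtration)
next
  case (step j)
  interpret A: group "AutoGroup G" by (rule AutoGroup)
  interpret I: group "aut_subgroup G (IA G)" using subgroup_IA by (rule A.subgroup_imp_group)
  show ?case
  proof (rule I.lower_central_Suc_subsetI[OF step.hyps(1)])
    show "subgroup (andreadakis_filtration G (Suc j)) (aut_subgroup G (IA G))"
      using andreadakis_filtration_antimono[of 1 "Suc j"]
      by (intro A.subgroup_incl subgroup_andreadakis_filtration subgroup_IA) (simp add: IA_eq_andreadakis_filtration)
    fix f f' assume f: "f \<in> carrier (aut_subgroup G (IA G))" and f': "f' \<in> lower_central (aut_subgroup G (IA G)) j"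
    have "f \<in> IA G" "f' \<in> IA G" using f I.lower_central_closed[OF f'] by simp_all
    moreover have "f' \<in> andreadakis_filtration G j" using f' step.IH by blast
    ultimately show "commutator (aut_subgroup G (IA G)) f f' \<in> andreadakis_filtration G (Suc j)"
      using commutator_andreadakis_filtration[of f f' j] A.commutator_subgroup_consistent[OF subgroup_IA]
      by (simp add: IA_eq_andreadakis_filtration)
  qed
qed

end

section \<open>Free groups\<close>

lemma free_group_generate: "generate (free_group S) ((\<lambda>s. [(s, True)]) ` S) = carrier (free_group S)"
proof -
  interpret group "free_group S" by (rule group_free_group)
  let ?x = "\<lambda>s. [(s, True)]"
  have x: "?x ` S \<subseteq> carrier (free_group S)" by (auto simp: free_group_def)
  have letter: "[(s, b)] \<in> generate (free_group S) (?x ` S)" if "s \<in> S" for s b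
  proof (cases b)
    case False
    have "[(s, False)] \<otimes>\<^bsub>free_group S\<^esub> ?x s = \<one>\<^bsub>free_group S\<^esub>"
      by (simp add: free_group_def cancels_def)
    moreover have "[(s, False)] \<in> carrier (free_group S)" using that by (auto simp: free_group_def)
    ultimately have "inv\<^bsub>free_group S\<^esub> (?x s) = [(s, False)]"
      using x that by (intro inv_equality) auto
    then show ?thesis using generate.inv[of "?x s" "?x ` S" "free_group S"] that False by auto
  qed (use that in \<open>auto intro: generate.incl\<close>)
  have "w \<in> generate (free_group S) (?x ` S)" if "w \<in> carrier (free_group S)" for w
    using that
  proof (induction w)
    case Nil
    then show ?case using generate.one[of "free_group S"] by (simp add: free_group_def)
  next
    case (Cons a w)
    then have "w \<in> carrier (free_group S)" "fst a \<in> S" "push a w = a # w"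
      by (auto simp: free_group_def successively_Cons intro: push_Cons_reduced)
    moreover have "a # w = [a] \<otimes>\<^bsub>free_group S\<^esub> w"
      using calculation by (simp add: free_group_def)
    ultimately show ?case using letter[of "fst a" "snd a"] Cons.IH
      by (metis generate.eng prod.collapse)
  qed
  then show ?thesis using generate_incl[OF x] by blast
qed

lemma free_group_commute:
  assumes "\<And>s t. \<lbrakk>s \<in> S; t \<in> S\<rbrakk> \<Longrightarrow> s = t" "g \<in> carrier (free_group S)" "h \<in> carrier (free_group S)"
  shows "g \<otimes>\<^bsub>free_group S\<^esub> h = h \<otimes>\<^bsub>free_group S\<^esub> g"
proof -
  interpret group "free_group S" by (rule group_free_group)
  obtain a where a: "a \<in> carrier (free_group S)" "(\<lambda>s. [(s, True)]) ` S \<subseteq> {a}"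
  proof (cases "S = {}")
    case True
    then show ?thesis using that[OF one_closed] by simp
  next
    case False
    then obtain s where s: "s \<in> S" by auto
    then have "S = {s}" using assms(1) by blast
    then show ?thesis using that[of "[(s, True)]"] by (auto simp: free_group_def)
  qed
  have "carrier (free_group S) \<subseteq> generate (free_group S) {a}"
    using mono_generate[OF a(2)] by (simp add: free_group_generate)
  then have "g \<in> generate (free_group S) {a}" "h \<in> generate (free_group S) {a}" using assms(2,3) by auto
  then obtain k l :: int where "g = a [^]\<^bsub>free_group S\<^esub> k" "h = a [^]\<^bsub>free_group S\<^esub> l"
    unfolding generate_pow[OF a(1)] by blast
  then show ?thesis using a(1) by (simp add: int_pow_mult[symmetric] add.commute)
qed

lemma free_group_magnus:
  fixes S :: "'s::linorder set"
  assumes "finite S"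
  obtains \<mu> where "magnus_group (free_group S) (\<lambda>s. [(s, True)]) S \<mu>"
proof -
  have f: "(\<lambda>s. 1 + ncps_var s) \<in> S \<rightarrow> carrier ncps_units"
    by (rule Pi_I) (rule one_plus_var_unit)
  obtain \<mu> where "\<mu> \<in> hom (free_group S) ncps_units" "\<forall>s\<in>S. \<mu> [(s, True)] = 1 + ncps_var s"
    using ex1_implies_ex[OF free_group_universal[OF group_ncps_units f]] by auto
  then have "magnus_group (free_group S) (\<lambda>s. [(s, True)]) S \<mu>"
    using assms free_group_generate
    by (intro magnus_group.intro group_gen.intro group_gen_axioms.intro magnus_group_axioms.intro group_free_group)
      (auto simp: free_group_def)
  then show ?thesis by (rule that)
qed

text \<open>The converse of \<open>displaces_conj_auto\<close>. Displacements of the generators give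
  \<open>[g, u]\<close> in \<open>\<Gamma>(d + 1)\<close>, and two distinct generators make the
  centre of the graded ring trivial.\<close>

lemma free_group_displaces_conj:
  fixes S :: "'s::linorder set"
  assumes S: "finite S" "s \<in> S" "t \<in> S" "s \<noteq> t" and g: "g \<in> carrier (free_group S)" and d: "d \<ge> 1"
    and disp: "group.displaces (free_group S) (group.conj_auto (free_group S) g) d"
  shows "g \<in> lower_central (free_group S) d"
proof -
  obtain \<mu> where "magnus_group (free_group S) (\<lambda>s. [(s, True)]) S \<mu>"
    using free_group_magnus[OF S(1)] .
  then interpret magnus_group "free_group S" "\<lambda>s. [(s, True)]" S \<mu> .
  show ?thesis
  proof (rule lower_central_centralizer[OF S(2-4) d g])
    fix u assume "u \<in> S"
    then have u: "[(u, True)] \<in> carrier (free_group S)" using x_closed by auto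
    have "commutator (free_group S) g [(u, True)] \<in> lower_central (free_group S) (Suc d)"
      using displacesD[OF disp, of 1 "[(u, True)]"] u g by (simp add: commutator_def conj_auto_apply)
    then show "commutator (free_group S) [(u, True)] g \<in> lower_central (free_group S) (Suc d)"
      using lower_central_inv inv_commutator[OF g u] by metis
  qed
qed

lemma (in group) IA_commutative:
  assumes "\<And>g h. \<lbrakk>g \<in> carrier G; h \<in> carrier G\<rbrakk> \<Longrightarrow> g \<otimes> h = h \<otimes> g"
  shows "IA G = {\<one>\<^bsub>AutoGroup G\<^esub>}"
proof -
  have "lower_central G (Suc 1) \<subseteq> {\<one>}"
    using assms by (intro lower_central_Suc_subsetI triv_subgroup)
      (simp_all add: commutator_eq_one_iff lower_central_closed)
  then have trivial: "a = \<one>" if "a \<in> lower_central G (Suc 1)" for a using that by blast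
  have "f = \<one>\<^bsub>AutoGroup G\<^esub>" if "f \<in> IA G" for f
  proof (rule auto_eqI)
    show f: "f \<in> auto G" using that by (simp add: IA_def)
    show "\<one>\<^bsub>AutoGroup G\<^esub> \<in> auto G" using group.is_monoid[OF AutoGroup, THEN monoid.one_closed] by simp
    fix g assume g: "g \<in> carrier G"
    have "displaces f 1" using that by (simp add: IA_eq_andreadakis_filtration andreadakis_filtration_iff)
    then have "f g \<otimes> inv g \<in> lower_central G (Suc 1)" using displacesD[of f 1 1 g] g by simp
    then have "f g \<otimes> inv g = \<one>" by (rule trivial)
    then have "f g \<otimes> inv g \<otimes> g = g" using g by simp
    then show "f g = \<one>\<^bsub>AutoGroup G\<^esub> g"
      using g f auto_closed by (simp add: m_assoc auto_one_apply)
  qed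
  moreover have "\<one>\<^bsub>AutoGroup G\<^esub> \<in> IA G" by (rule subgroup.one_closed[OF subgroup_IA])
  ultimately show ?thesis by blast
qed

section \<open>The associated graded Lie ring and its homogeneous derivations\<close>

context group begin

lemma carrier_lc_quotient: "carrier (lc_quotient G m) = lc_proj (Suc m) ` lower_central G m"
  by (auto simp: lc_quotient_def carrier_FactGroup lc_proj_def)

lemma lc_proj_carrier_lc_quotient [simp, intro]:
  "a \<in> lower_central G m \<Longrightarrow> lc_proj (Suc m) a \<in> carrier (lc_quotient G m)"
  by (simp add: carrier_lc_quotient)

lemma lc_quotient_mult:
  assumes "a \<in> carrier G" "b \<in> carrier G"
  shows "lc_proj (Suc m) a \<otimes>\<^bsub>lc_quotient G m\<^esub> lc_proj (Suc m) b = lc_proj (Suc m) (a \<otimes> b)"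
  using assms normal.rcos_sum[OF normal_lower_central] by (simp add: lc_quotient_def lc_proj_def)

lemma one_lc_quotient: "\<one>\<^bsub>lc_quotient G m\<^esub> = lc_proj (Suc m) \<one>"
  using lower_central_closed by (simp add: lc_quotient_def lc_proj_def subsetI)

lemma lc_proj_eq_one_lc_quotient:
  "a \<in> carrier G \<Longrightarrow> lc_proj (Suc m) a = \<one>\<^bsub>lc_quotient G m\<^esub> \<longleftrightarrow> a \<in> lower_central G (Suc m)"
  by (simp add: one_lc_quotient lc_proj_eq_iff)

lemma comm_group_lc_quotient:
  assumes "m \<ge> 1"
  shows "comm_group (lc_quotient G m)"
proof -
  have "lower_central G (Suc m) \<lhd> G\<lparr>carrier := lower_central G m\<rparr>"
    by (intro normal_restrict_supergroup subgroup_lower_central normal_lower_central lower_central_Suc_subset)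
  then have group: "group (lc_quotient G m)"
    unfolding lc_quotient_def Suc_eq_plus1[symmetric] by (rule normal.factorgroup_is_group)
  show ?thesis
  proof (rule group.group_comm_groupI[OF group])
    fix x y assume "x \<in> carrier (lc_quotient G m)" "y \<in> carrier (lc_quotient G m)"
    then obtain a b where ab: "a \<in> lower_central G m" "b \<in> lower_central G m"
      and xy: "x = lc_proj (Suc m) a" "y = lc_proj (Suc m) b" by (auto simp: carrier_lc_quotient)
    have cl: "a \<in> carrier G" "b \<in> carrier G" using ab lower_central_closed by auto
    have "commutator G a b \<in> lower_central G (Suc m)" using cl(1) ab(2) by (rule commutator_lower_central)
    then show "x \<otimes>\<^bsub>lc_quotient G m\<^esub> y = y \<otimes>\<^bsub>lc_quotient G m\<^esub> x"
      using cl by (simp add: xy lc_quotient_mult lc_proj_eq_iff commutator_def word_simps)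
  qed
qed

lemma group_lc_quotient: "m \<ge> 1 \<Longrightarrow> group (lc_quotient G m)"
  using comm_group_lc_quotient by (simp add: comm_group_def)

lemma carrier_assoc_graded:
  "carrier (assoc_graded G) =
    {X \<in> \<Pi>\<^sub>E i\<in>{1..}. carrier (lc_quotient G i). finite {i \<in> {1..}. X i \<noteq> \<one>\<^bsub>lc_quotient G i\<^esub>}}"
proof -
  have "carrier (assoc_graded G) = carrier (sum_group {1..} (lc_quotient G))"
    by (simp add: assoc_graded_def Let_def)
  also have "\<dots> = {X \<in> \<Pi>\<^sub>E i\<in>{1..}. carrier (lc_quotient G i). finite {i \<in> {1..}. X i \<noteq> \<one>\<^bsub>lc_quotient G i\<^esub>}}"
    by (rule carrier_sum_group) (simp add: group_lc_quotient)
  finally show ?thesis .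
qed

lemma carrier_assoc_gradedI:
  assumes "\<And>m. m \<ge> 1 \<Longrightarrow> X m \<in> carrier (lc_quotient G m)" "X \<in> extensional {1..}"
    and "finite {m \<in> {1..}. X m \<noteq> \<one>\<^bsub>lc_quotient G m\<^esub>}"
  shows "X \<in> carrier (assoc_graded G)"
  unfolding carrier_assoc_graded using assms by (intro CollectI conjI PiE_I) (auto simp: extensional_def)

lemma assoc_graded_mult:
  "X \<otimes>\<^bsub>assoc_graded G\<^esub> Y = (\<lambda>i\<in>{1..}. X i \<otimes>\<^bsub>lc_quotient G i\<^esub> Y i)"
  by (simp add: assoc_graded_def Let_def)

lemma assoc_graded_closed: "\<lbrakk>X \<in> carrier (assoc_graded G); i \<ge> 1\<rbrakk> \<Longrightarrow> X i \<in> carrier (lc_quotient G i)"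
  by (auto simp: carrier_assoc_graded)

text \<open>A choice of representatives in all positive degrees, which turns computations with
  classes into computations in \<open>G\<close>.\<close>

definition graded_reps :: "(nat \<Rightarrow> 'a set) \<Rightarrow> (nat \<Rightarrow> 'a) \<Rightarrow> bool" where
  "graded_reps X x \<longleftrightarrow> (\<forall>i\<ge>1. x i \<in> lower_central G i \<and> X i = lc_proj (Suc i) (x i))"

lemma graded_repsD:
  assumes "graded_reps X x" "i \<ge> 1"
  shows "x i \<in> lower_central G i" "X i = lc_proj (Suc i) (x i)" "x i \<in> carrier G"
  using assms lower_central_closed by (auto simp: graded_reps_def)

lemma graded_repsE:
  assumes "X \<in> carrier (assoc_graded G)"
  obtains x where "graded_reps X x"
proof -
  have "\<forall>i\<in>{1..}. \<exists>a. a \<in> lower_central G i \<and> X i = lc_proj (Suc i) a"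
    using assoc_graded_closed[OF assms] by (auto simp: carrier_lc_quotient)
  then show ?thesis using that unfolding graded_reps_def by (metis atLeast_iff)
qed

lemma lc_proj_mem:
  assumes "a \<in> carrier G" "b \<in> lc_proj m a"
  obtains c where "c \<in> lower_central G m" "b = c \<otimes> a"
  using assms by (auto simp: lc_proj_def r_coset_def)

lemma lc_proj_self: "a \<in> carrier G \<Longrightarrow> a \<in> lc_proj m a"
  unfolding lc_proj_def by (rule rcos_self[OF _ subgroup_lower_central])

text \<open>Changing a representative by an element one term deeper multiplies the commutator,
  modulo \<open>\<Gamma>(i + j + 1)\<close>, by one that lies there; so all cosets in the union
  coincide.\<close>

lemma class_bracket_lc_proj:
  assumes a: "a \<in> lower_central G i" and b: "b \<in> lower_central G j" and ij: "i \<ge> 1" "j \<ge> 1"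
  shows "class_bracket G i j (lc_proj (Suc i) a) (lc_proj (Suc j) b) =
    lc_proj (Suc (i + j)) (commutator G a b)"
proof -
  note cl = lower_central_closed
  have "lc_proj (Suc (i + j)) (commutator G a' b') = lc_proj (Suc (i + j)) (commutator G a b)"
    if a': "a' \<in> lc_proj (Suc i) a" and b': "b' \<in> lc_proj (Suc j) b" for a' b'
  proof -
    let ?p = "lc_proj (Suc (i + j))"
    let ?Q = "G Mod lower_central G (Suc (i + j))"
    interpret p: group_hom G ?Q ?p by (rule lc_proj_hom)
    obtain c where c: "c \<in> lower_central G (Suc i)" "a' = c \<otimes> a" using lc_proj_mem[OF cl[OF a] a'] .
    obtain d where d: "d \<in> lower_central G (Suc j)" "b' = d \<otimes> b" using lc_proj_mem[OF cl[OF b] b'] .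
    have c': "c \<in> lower_central G i" and d': "d \<in> lower_central G j"
      using c d lower_central_Suc_subset by blast+
    have b'': "b' \<in> lower_central G j" using d' b d(2) lower_central_mult by simp
    have cb: "commutator G c b' \<in> lower_central G (Suc (i + j))"
      using lower_central_commutator[OF c(1) b''] ij by simp
    have ad: "commutator G a d \<in> lower_central G (Suc (i + j))"
      using lower_central_commutator[OF a d(1)] ij by simp
    have clc: "commutator G c b' \<in> carrier G" "commutator G a d \<in> carrier G"
      using cl[OF cb] cl[OF ad] by auto
    have "?p (commutator G a' b') = ?p (commutator G c b' \<otimes> commutator G a b')"
      unfolding c(2) by (rule commutator_congruences(1)[OF c' b'' ij a])
    also have "\<dots> = ?p (commutator G a b')"
      using cb clc cl[OF a] cl[OF b''] by (subst lc_proj_eq_iff) (simp_all add: m_assoc)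
    also have "\<dots> = ?p (commutator G a d \<otimes> commutator G a b)"
      unfolding d(2) by (rule commutator_congruences(2)[OF a d' ij b])
    also have "\<dots> = ?p (commutator G a b)"
      using ad clc cl[OF a] cl[OF b] by (subst lc_proj_eq_iff) (simp_all add: m_assoc)
    finally show ?thesis .
  qed
  moreover have "lc_proj (Suc i) a \<noteq> {}" "lc_proj (Suc j) b \<noteq> {}"
    using lc_proj_self cl a b by blast+
  ultimately show ?thesis
    unfolding class_bracket_def lc_proj_def[of "Suc (i + j)", symmetric] Suc_eq_plus1[symmetric] by auto
qed

text \<open>The displacement of \<open>a b\<close> is that of \<open>a\<close> times the conjugate
  by \<open>a\<close> of that of \<open>b\<close>, and this conjugation is trivial modulo
  \<open>\<Gamma>(i + d + 1)\<close>.\<close>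

lemma displacement_mult:
  assumes k: "k \<in> hom G G" "displaces k d" and ab: "a \<in> lower_central G i" "b \<in> lower_central G i" and "i \<ge> 1"
  shows "lc_proj (Suc (i + d)) (k (a \<otimes> b) \<otimes> inv (a \<otimes> b)) =
    lc_proj (Suc (i + d)) ((k a \<otimes> inv a) \<otimes> (k b \<otimes> inv b))"
proof -
  interpret k: group_hom G G k using k(1) is_group by (simp add: group_hom_def group_hom_axioms_def)
  have cl: "a \<in> carrier G" "b \<in> carrier G" using ab lower_central_closed by auto
  have db: "k b \<otimes> inv b \<in> lower_central G (i + d)" using displacesD[OF k(2) assms(5) ab(2)] .
  have "(k (a \<otimes> b) \<otimes> inv (a \<otimes> b)) \<otimes> inv ((k a \<otimes> inv a) \<otimes> (k b \<otimes> inv b)) =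
      (k a \<otimes> inv a) \<otimes> commutator G a (k b \<otimes> inv b) \<otimes> inv (k a \<otimes> inv a)"
    using cl by (simp add: commutator_def word_simps)
  also have "\<dots> \<in> lower_central G (Suc (i + d))"
    using cl by (intro lower_central_conj commutator_lower_central db) auto
  finally show ?thesis using cl by (subst lc_proj_eq_iff) simp_all
qed

text \<open>The set \<open>\<kappa>\<close> is general in order to cover three cases: a singleton, a
  coset in the lower central series of \<open>K\<close>, and the zero class, which is compared with
  the identity.\<close>

lemma class_action_lc_proj:
  assumes k: "k \<in> hom G G" "displaces k d" and h: "h \<in> lower_central G i" and i: "i \<ge> 1"
    and \<kappa>: "\<kappa> \<noteq> {}" "\<And>k'. k' \<in> \<kappa> \<Longrightarrow> k' \<in> hom G G"
    and eq: "\<And>k' h. \<lbrakk>k' \<in> \<kappa>; h \<in> lower_central G i\<rbrakk> \<Longrightarrow> k' h \<otimes> inv (k h) \<in> lower_central G (Suc (i + d))"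
  shows "class_action G d i \<kappa> (lc_proj (Suc i) h) = lc_proj (Suc (i + d)) (k h \<otimes> inv h)"
proof -
  interpret k: group_hom G G k using k(1) is_group by (simp add: group_hom_def group_hom_axioms_def)
  note cl = lower_central_closed
  have "lc_proj (Suc (i + d)) (k' h' \<otimes> inv h') = lc_proj (Suc (i + d)) (k h \<otimes> inv h)"
    if k': "k' \<in> \<kappa>" and h': "h' \<in> lc_proj (Suc i) h" for k' h'
  proof -
    obtain c where c: "c \<in> lower_central G (Suc i)" "h' = c \<otimes> h" using lc_proj_mem[OF cl[OF h] h'] .
    have ci: "c \<in> lower_central G i" using c(1) lower_central_Suc_subset by blast
    have h'': "h' \<in> lower_central G i" using ci h c(2) lower_central_mult by simp
    have kc: "k c \<otimes> inv c \<in> lower_central G (Suc (i + d))"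
      using displacesD[OF k(2) _ c(1)] by simp
    have cl': "h' \<in> carrier G" "k' h' \<in> carrier G" using h'' cl \<kappa>(2)[OF k'] by (auto simp: hom_def)
    have "lc_proj (Suc (i + d)) (k' h' \<otimes> inv h') = lc_proj (Suc (i + d)) (k h' \<otimes> inv h')"
      using eq[OF k' h''] cl' by (subst lc_proj_eq_iff) (simp_all add: word_simps)
    also have "\<dots> = lc_proj (Suc (i + d)) ((k c \<otimes> inv c) \<otimes> (k h \<otimes> inv h))"
      unfolding c(2) by (rule displacement_mult[OF k ci h i])
    also have "\<dots> = lc_proj (Suc (i + d)) (k h \<otimes> inv h)"
      using kc cl[OF c(1)] cl[OF h] by (subst lc_proj_eq_iff) (simp_all add: word_simps)
    finally show ?thesis .
  qed
  moreover have "lc_proj (Suc i) h \<noteq> {}" using lc_proj_self cl h by blast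
  ultimately show ?thesis
    using \<kappa>(1) unfolding class_action_def lc_proj_def[of "Suc (i + d)", symmetric] Suc_eq_plus1[symmetric] by auto
qed

lemma class_action_singleton:
  assumes k: "k \<in> hom G G" "displaces k d" and h: "h \<in> lower_central G i" and i: "i \<ge> 1"
  shows "class_action G d i {k} (lc_proj (Suc i) h) = lc_proj (Suc (i + d)) (k h \<otimes> inv h)"
proof (rule class_action_lc_proj[OF k h i])
  fix k' h assume "k' \<in> {k}" "h \<in> lower_central G i"
  then show "k' h \<otimes> inv (k h) \<in> lower_central G (Suc (i + d))"
    using hom_in_carrier[OF k(1) lower_central_closed] by simp
qed (use k in auto)

text \<open>The degree \<open>d\<close> derivation induced by one \<open>k\<close> in
  \<open>\<A>(d)\<close>. Degrees up to \<open>d\<close> receive nothing, because the graded ring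
  starts in degree one.\<close>

definition graded_displacement :: "nat \<Rightarrow> ('a \<Rightarrow> 'a) \<Rightarrow> (nat \<Rightarrow> 'a set) \<Rightarrow> nat \<Rightarrow> 'a set" where
  "graded_displacement d k = (\<lambda>Y\<in>carrier (assoc_graded G). \<lambda>m\<in>{1..}.
     if d < m then class_action G d (m - d) {k} (Y (m - d)) else \<one>\<^bsub>lc_quotient G m\<^esub>)"

lemma graded_displacement_apply:
  assumes k: "k \<in> hom G G" "displaces k d" and Y: "Y \<in> carrier (assoc_graded G)"
    and y: "graded_reps Y y" and m: "m \<ge> 1"
  shows "graded_displacement d k Y m =
    lc_proj (Suc m) (if d < m then k (y (m - d)) \<otimes> inv (y (m - d)) else \<one>)"
  using class_action_singleton[OF k graded_repsD(1)[OF y], of "m - d"] Y graded_repsD(2)[OF y, of "m - d"] m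
  by (auto simp: graded_displacement_def one_lc_quotient)

lemma graded_displacement_closed:
  assumes k: "k \<in> hom G G" "displaces k d" and Y: "Y \<in> carrier (assoc_graded G)"
  shows "graded_displacement d k Y \<in> carrier (assoc_graded G)"
proof -
  interpret k: group_hom G G k using k(1) is_group by (simp add: group_hom_def group_hom_axioms_def)
  obtain y where y: "graded_reps Y y" using graded_repsE[OF Y] .
  note app = graded_displacement_apply[OF k Y y]
  have "graded_displacement d k Y m \<in> carrier (lc_quotient G m)" if m: "m \<ge> 1" for m
    using displacesD[OF k(2) _ graded_repsD(1)[OF y], of "m - d"] m unfolding app[OF m]
    by (intro lc_proj_carrier_lc_quotient) auto
  moreover have "graded_displacement d k Y \<in> extensional {1..}"
    using Y by (simp add: graded_displacement_def)
  moreover have "{m \<in> {1..}. graded_displacement d k Y m \<noteq> \<one>\<^bsub>lc_quotient G m\<^esub>} \<subseteq>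
      (\<lambda>i. i + d) ` {i \<in> {1..}. Y i \<noteq> \<one>\<^bsub>lc_quotient G i\<^esub>}"
  proof
    fix m assume "m \<in> {m \<in> {1..}. graded_displacement d k Y m \<noteq> \<one>\<^bsub>lc_quotient G m\<^esub>}"
    then have m: "m \<ge> 1" "graded_displacement d k Y m \<noteq> \<one>\<^bsub>lc_quotient G m\<^esub>" by auto
    have dm: "d < m" using m app by (auto simp: one_lc_quotient split: if_splits)
    have "Y (m - d) \<noteq> \<one>\<^bsub>lc_quotient G (m - d)\<^esub>"
    proof
      assume "Y (m - d) = \<one>\<^bsub>lc_quotient G (m - d)\<^esub>"
      then have "y (m - d) \<in> lower_central G (Suc (m - d))"
        using graded_repsD[OF y, of "m - d"] dm by (auto simp: lc_proj_eq_one_lc_quotient)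
      then have "k (y (m - d)) \<otimes> inv (y (m - d)) \<in> lower_central G (Suc (m - d) + d)"
        by (intro displacesD[OF k(2)]) auto
      then show False
        using m(2) dm app[OF m(1)] graded_repsD(3)[OF y, of "m - d"]
        by (simp add: lc_proj_eq_one_lc_quotient)
    qed
    then show "m \<in> (\<lambda>i. i + d) ` {i \<in> {1..}. Y i \<noteq> \<one>\<^bsub>lc_quotient G i\<^esub>}"
      using dm by (intro image_eqI[of _ _ "m - d"]) auto
  qed
  then have "finite {m \<in> {1..}. graded_displacement d k Y m \<noteq> \<one>\<^bsub>lc_quotient G m\<^esub>}"
    by (rule finite_subset) (use Y in \<open>simp add: carrier_assoc_graded\<close>)
  ultimately show ?thesis by (intro carrier_assoc_gradedI)
qed

lemma graded_displacement_hom: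
  assumes k: "k \<in> hom G G" "displaces k d" and Y: "Y \<in> carrier (assoc_graded G)" and Z: "Z \<in> carrier (assoc_graded G)"
    and YZ: "Y \<otimes>\<^bsub>assoc_graded G\<^esub> Z \<in> carrier (assoc_graded G)"
  shows "graded_displacement d k (Y \<otimes>\<^bsub>assoc_graded G\<^esub> Z) =
    graded_displacement d k Y \<otimes>\<^bsub>assoc_graded G\<^esub> graded_displacement d k Z"
proof (rule extensionalityI[of _ "{1..}"])
  interpret k: group_hom G G k using k(1) is_group by (simp add: group_hom_def group_hom_axioms_def)
  obtain y where y: "graded_reps Y y" using graded_repsE[OF Y] .
  obtain z where z: "graded_reps Z z" using graded_repsE[OF Z] .
  have yz: "graded_reps (Y \<otimes>\<^bsub>assoc_graded G\<^esub> Z) (\<lambda>i. y i \<otimes> z i)"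
    using graded_repsD[OF y] graded_repsD[OF z]
    by (auto simp: graded_reps_def assoc_graded_mult lc_quotient_mult lower_central_mult)
  fix m :: nat assume "m \<in> {1..}"
  then have m: "m \<ge> 1" by simp
  note apply' = graded_displacement_apply[OF k YZ yz m]
  show "graded_displacement d k (Y \<otimes>\<^bsub>assoc_graded G\<^esub> Z) m =
      (graded_displacement d k Y \<otimes>\<^bsub>assoc_graded G\<^esub> graded_displacement d k Z) m"
  proof (cases "d < m")
    case True
    then have cl: "y (m - d) \<in> carrier G" "z (m - d) \<in> carrier G"
      using graded_repsD(3)[OF y] graded_repsD(3)[OF z] by simp_all
    show ?thesis
      using True m cl displacement_mult[OF k graded_repsD(1)[OF y] graded_repsD(1)[OF z], of "m - d"]
      unfolding apply' unfolding assoc_graded_mult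
      by (simp add: graded_displacement_apply[OF k Y y] graded_displacement_apply[OF k Z z] lc_quotient_mult)
  next
    case False
    then show ?thesis
      using m unfolding apply' unfolding assoc_graded_mult
      by (simp add: graded_displacement_apply[OF k Y y] graded_displacement_apply[OF k Z z] lc_quotient_mult)
  qed
qed (use YZ in \<open>auto simp: graded_displacement_def assoc_graded_mult\<close>)

lemma hom_finprod_lc_quotient:
  assumes f: "f \<in> hom (lc_quotient G i) (lc_quotient G j)" and ij: "i \<ge> 1" "j \<ge> 1"
    and g: "g \<in> A \<rightarrow> carrier (lc_quotient G i)" and A: "finite A"
  shows "f (finprod (lc_quotient G i) g A) = finprod (lc_quotient G j) (\<lambda>a. f (g a)) A"
  using A g
proof (induction A)
  case empty
  interpret i: comm_group "lc_quotient G i" using ij(1) by (rule comm_group_lc_quotient)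
  interpret j: comm_group "lc_quotient G j" using ij(2) by (rule comm_group_lc_quotient)
  show ?case using hom_one[OF f i.is_group j.is_group] by simp
next
  case (insert a A)
  interpret i: comm_group "lc_quotient G i" using ij(1) by (rule comm_group_lc_quotient)
  interpret j: comm_group "lc_quotient G j" using ij(2) by (rule comm_group_lc_quotient)
  have c: "g \<in> A \<rightarrow> carrier (lc_quotient G i)" "g a \<in> carrier (lc_quotient G i)"
    using insert.prems by auto
  then have c': "(\<lambda>a. f (g a)) \<in> A \<rightarrow> carrier (lc_quotient G j)" "f (g a) \<in> carrier (lc_quotient G j)"
    using hom_in_carrier[OF f] by auto
  show ?case
    using insert.hyps c c' insert.IH hom_mult[OF f] by simp
qed

definition bracket_term :: "(nat \<Rightarrow> 'a) \<Rightarrow> (nat \<Rightarrow> 'a) \<Rightarrow> nat \<Rightarrow> nat \<Rightarrow> 'a set" where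
  "bracket_term y z m i = lc_proj (Suc m) (commutator G (y i) (z (m - i)))"

lemma bracket_term_closed:
  assumes "graded_reps Y y" "graded_reps Z z" "i \<in> {1..<m}"
  shows "bracket_term y z m i \<in> carrier (lc_quotient G m)"
  unfolding bracket_term_def
  using lower_central_commutator[OF graded_repsD(1)[OF assms(1), of i] graded_repsD(1)[OF assms(2), of "m - i"]] assms(3)
  by (intro lc_proj_carrier_lc_quotient) auto

lemma bracket_assoc_graded:
  assumes Y: "graded_reps Y y" and Z: "graded_reps Z z" and m: "m \<ge> 1"
  shows "bracket (assoc_graded G) Y Z m = finprod (lc_quotient G m) (bracket_term y z m) {1..<m}"
proof -
  interpret m: comm_group "lc_quotient G m" using m by (rule comm_group_lc_quotient)
  have "bracket (assoc_graded G) Y Z m =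
      finprod (lc_quotient G m) (\<lambda>i. class_bracket G i (m - i) (Y i) (Z (m - i))) {1..<m}"
    using m by (simp add: assoc_graded_def Let_def)
  also have "\<dots> = finprod (lc_quotient G m) (bracket_term y z m) {1..<m}"
  proof (rule m.finprod_cong')
    fix i assume "i \<in> {1..<m}"
    then have i: "1 \<le> i" "1 \<le> m - i" "i + (m - i) = m" by auto
    show "class_bracket G i (m - i) (Y i) (Z (m - i)) = bracket_term y z m i"
      using class_bracket_lc_proj[OF graded_repsD(1)[OF Y i(1)] graded_repsD(1)[OF Z i(2)] i(1,2)]
      by (simp only: graded_repsD(2)[OF Y i(1)] graded_repsD(2)[OF Z i(2)] bracket_term_def i(3))
  qed (use bracket_term_closed[OF Y Z] in auto)
  finally show ?thesis .
qed

lemma bracket_term_eq_one: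
  assumes Y: "graded_reps Y y" and Z: "graded_reps Z z" and i: "i \<in> {1..<m}"
    and "Y i = \<one>\<^bsub>lc_quotient G i\<^esub> \<or> Z (m - i) = \<one>\<^bsub>lc_quotient G (m - i)\<^esub>"
  shows "bracket_term y z m i = \<one>\<^bsub>lc_quotient G m\<^esub>"
proof -
  have i': "1 \<le> i" "1 \<le> m - i" using i by auto
  note yi = graded_repsD[OF Y i'(1)] and zi = graded_repsD[OF Z i'(2)]
  have "y i \<in> lower_central G (Suc i) \<or> z (m - i) \<in> lower_central G (Suc (m - i))"
    using assms(4) unfolding yi(2) zi(2) lc_proj_eq_one_lc_quotient[OF yi(3)] lc_proj_eq_one_lc_quotient[OF zi(3)] .
  then have "commutator G (y i) (z (m - i)) \<in> lower_central G (Suc m)"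
    using lower_central_commutator[of "y i" "Suc i" "z (m - i)" "m - i"]
      lower_central_commutator[of "y i" i "z (m - i)" "Suc (m - i)"] i i' yi(1) zi(1) by auto
  then show ?thesis using yi(3) zi(3) by (simp add: bracket_term_def lc_proj_eq_one_lc_quotient)
qed

lemma bracket_closed:
  assumes "X \<in> carrier (assoc_graded G)" "Y \<in> carrier (assoc_graded G)"
  shows "bracket (assoc_graded G) X Y \<in> carrier (assoc_graded G)"
proof -
  obtain x where x: "graded_reps X x" using graded_repsE[OF assms(1)] .
  obtain y where y: "graded_reps Y y" using graded_repsE[OF assms(2)] .
  have "bracket (assoc_graded G) X Y m \<in> carrier (lc_quotient G m)" if m: "m \<ge> 1" for m
  proof -
    interpret m: comm_group "lc_quotient G m" using m by (rule comm_group_lc_quotient)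
    show ?thesis
      unfolding bracket_assoc_graded[OF x y m] using bracket_term_closed[OF x y] by (intro m.finprod_closed) auto
  qed
  moreover have "bracket (assoc_graded G) X Y \<in> extensional {1..}"
    by (simp add: assoc_graded_def Let_def)
  moreover have "finite {m \<in> {1..}. bracket (assoc_graded G) X Y m \<noteq> \<one>\<^bsub>lc_quotient G m\<^esub>}"
  proof -
    have "finite {i \<in> {1..}. X i \<noteq> \<one>\<^bsub>lc_quotient G i\<^esub>}" "finite {i \<in> {1..}. Y i \<noteq> \<one>\<^bsub>lc_quotient G i\<^esub>}"
      using assms by (simp_all add: carrier_assoc_graded)
    then obtain M N where M: "{i \<in> {1..}. X i \<noteq> \<one>\<^bsub>lc_quotient G i\<^esub>} \<subseteq> {..M}"
      and N: "{i \<in> {1..}. Y i \<noteq> \<one>\<^bsub>lc_quotient G i\<^esub>} \<subseteq> {..N}"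
      by (meson finite_nat_iff_bounded_le)
    have "bracket (assoc_graded G) X Y m = \<one>\<^bsub>lc_quotient G m\<^esub>" if m: "m \<ge> 1" "m > M + N" for m
    proof -
      interpret m: comm_group "lc_quotient G m" using m(1) by (rule comm_group_lc_quotient)
      show ?thesis unfolding bracket_assoc_graded[OF x y m(1)]
      proof (rule m.finprod_one_eqI)
        fix i assume i: "i \<in> {1..<m}"
        have "i \<notin> {..M} \<or> m - i \<notin> {..N}" using m by auto
        then have "X i = \<one>\<^bsub>lc_quotient G i\<^esub> \<or> Y (m - i) = \<one>\<^bsub>lc_quotient G (m - i)\<^esub>"
        proof -
          have "i \<in> {1..}" "m - i \<in> {1..}" using i by auto
          with \<open>i \<notin> {..M} \<or> m - i \<notin> {..N}\<close> M N show ?thesis by blast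
        qed
        then show "bracket_term x y m i = \<one>\<^bsub>lc_quotient G m\<^esub>"
          by (rule bracket_term_eq_one[OF x y i])
      qed
    qed
    then have "{m \<in> {1..}. bracket (assoc_graded G) X Y m \<noteq> \<one>\<^bsub>lc_quotient G m\<^esub>} \<subseteq> {..M + N}"
      by (auto simp: not_less[symmetric])
    then show ?thesis by (rule finite_subset) simp
  qed
  ultimately show ?thesis by (rule carrier_assoc_gradedI)
qed

lemma mult_closed_assoc_graded:
  assumes "X \<in> carrier (assoc_graded G)" "Y \<in> carrier (assoc_graded G)"
  shows "X \<otimes>\<^bsub>assoc_graded G\<^esub> Y \<in> carrier (assoc_graded G)"
proof -
  have "group (sum_group {1..} (lc_quotient G))" by (rule sum_group) (simp add: group_lc_quotient)
  from monoid.m_closed[OF group.is_monoid[OF this]] show ?thesis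
    using assms by (simp add: assoc_graded_def Let_def)
qed

text \<open>In degree \<open>m = n + d\<close> the left side is the image of the sum of all
  \<open>[y i, z (n - i)]\<close>. By \<open>commutator_leibniz\<close> each image splits into one
  term for either derivative; the terms with a derivative of \<open>y\<close> are reindexed by
  \<open>i + d\<close>, and the indices then missing from the sums on the right give trivial
  terms.\<close>

lemma graded_displacement_leibniz:
  assumes k: "k \<in> hom G G" "displaces k d" and d: "d \<ge> 1"
    and Y: "Y \<in> carrier (assoc_graded G)" and Z: "Z \<in> carrier (assoc_graded G)"
  shows "graded_displacement d k (bracket (assoc_graded G) Y Z) =
    bracket (assoc_graded G) (graded_displacement d k Y) Z \<otimes>\<^bsub>assoc_graded G\<^esub>
    bracket (assoc_graded G) Y (graded_displacement d k Z)"
proof (rule extensionalityI[of _ "{1..}"])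
  interpret k: group_hom G G k using k(1) is_group by (simp add: group_hom_def group_hom_axioms_def)
  obtain y where y: "graded_reps Y y" using graded_repsE[OF Y] .
  obtain z where z: "graded_reps Z z" using graded_repsE[OF Z] .
  define D where "D y m = (if d < m then k (y (m - d)) \<otimes> inv (y (m - d)) else \<one>)" for y :: "nat \<Rightarrow> 'a" and m
  have reps: "graded_reps (graded_displacement d k Y) (D y)"
    if "Y \<in> carrier (assoc_graded G)" "graded_reps Y y" for Y y
    unfolding graded_reps_def
  proof (intro allI impI conjI)
    fix m :: nat assume m: "1 \<le> m"
    show "D y m \<in> lower_central G m"
      using displacesD[OF k(2) _ graded_repsD(1)[OF that(2)], of "m - d"] by (simp add: D_def)
    show "graded_displacement d k Y m = lc_proj (Suc m) (D y m)"
      using graded_displacement_apply[OF k that m] by (simp add: D_def)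
  qed
  note Dy = reps[OF Y y] and Dz = reps[OF Z z]
  fix m :: nat assume "m \<in> {1..}"
  then have m: "m \<ge> 1" by simp
  interpret m: comm_group "lc_quotient G m" using m by (rule comm_group_lc_quotient)
  have rhs: "(bracket (assoc_graded G) (graded_displacement d k Y) Z \<otimes>\<^bsub>assoc_graded G\<^esub>
      bracket (assoc_graded G) Y (graded_displacement d k Z)) m =
      finprod (lc_quotient G m) (bracket_term (D y) z m) {1..<m} \<otimes>\<^bsub>lc_quotient G m\<^esub>
      finprod (lc_quotient G m) (bracket_term y (D z) m) {1..<m}"
    using m by (simp add: assoc_graded_mult bracket_assoc_graded[OF Dy z m] bracket_assoc_graded[OF y Dz m])
  \<comment> \<open>A derivative of degree \<open>d\<close> has no component in degrees up to
    \<open>d\<close>.\<close>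
  have one: "bracket_term (D y) z m i = \<one>\<^bsub>lc_quotient G m\<^esub>" if "i \<in> {1..<m}" "i \<le> d" for i
    using that by (intro bracket_term_eq_one[OF Dy z])
      (simp_all add: graded_displacement_apply[OF k Y y] one_lc_quotient)
  have one': "bracket_term y (D z) m i = \<one>\<^bsub>lc_quotient G m\<^esub>" if "i \<in> {1..<m}" "m - i \<le> d" for i
  proof (rule bracket_term_eq_one[OF y Dz that(1)])
    have "1 \<le> m - i" using that(1) by auto
    then show "Y i = \<one>\<^bsub>lc_quotient G i\<^esub> \<or>
        graded_displacement d k Z (m - i) = \<one>\<^bsub>lc_quotient G (m - i)\<^esub>"
      using that(2) by (simp add: graded_displacement_apply[OF k Z z] one_lc_quotient)
  qed
  show "graded_displacement d k (bracket (assoc_graded G) Y Z) m =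
      (bracket (assoc_graded G) (graded_displacement d k Y) Z \<otimes>\<^bsub>assoc_graded G\<^esub>
      bracket (assoc_graded G) Y (graded_displacement d k Z)) m"
  proof (cases "d < m")
    case False
    have "finprod (lc_quotient G m) (bracket_term (D y) z m) {1..<m} = \<one>\<^bsub>lc_quotient G m\<^esub>"
      using False by (intro m.finprod_one_eqI one) auto
    moreover have "finprod (lc_quotient G m) (bracket_term y (D z) m) {1..<m} = \<one>\<^bsub>lc_quotient G m\<^esub>"
      using False by (intro m.finprod_one_eqI one') auto
    ultimately show ?thesis
      using False m unfolding rhs by (simp add: graded_displacement_def bracket_closed[OF Y Z])
  next
    case True
    define n where "n = m - d"
    have n: "n \<ge> 1" "m = n + d" using True by (auto simp: n_def)
    interpret n: comm_group "lc_quotient G n" using n(1) by (rule comm_group_lc_quotient)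
    let ?\<delta> = "class_action G d n {k}"
    have \<delta>: "?\<delta> (lc_proj (Suc n) h) = lc_proj (Suc m) (k h \<otimes> inv h)" if "h \<in> lower_central G n" for h
      using class_action_singleton[OF k that n(1)] n(2) by simp
    have \<delta>_hom: "?\<delta> \<in> hom (lc_quotient G n) (lc_quotient G m)"
    proof (rule homI)
      fix x assume "x \<in> carrier (lc_quotient G n)"
      then obtain a where a: "a \<in> lower_central G n" "x = lc_proj (Suc n) a" by (auto simp: carrier_lc_quotient)
      then show "?\<delta> x \<in> carrier (lc_quotient G m)"
        using displacesD[OF k(2) n(1) a(1)] n(2) by (simp add: \<delta> lc_proj_carrier_lc_quotient)
      fix x' assume "x' \<in> carrier (lc_quotient G n)"
      then obtain b where b: "b \<in> lower_central G n" "x' = lc_proj (Suc n) b" by (auto simp: carrier_lc_quotient)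
      show "?\<delta> (x \<otimes>\<^bsub>lc_quotient G n\<^esub> x') = ?\<delta> x \<otimes>\<^bsub>lc_quotient G m\<^esub> ?\<delta> x'"
        using displacement_mult[OF k a(1) b(1) n(1)] lower_central_closed[OF a(1)] lower_central_closed[OF b(1)]
        by (simp add: a b lc_quotient_mult \<delta> lower_central_mult n(2)[symmetric])
    qed
    have "graded_displacement d k (bracket (assoc_graded G) Y Z) m =
        ?\<delta> (finprod (lc_quotient G n) (bracket_term y z n) {1..<n})"
      using True m by (simp add: graded_displacement_def bracket_closed[OF Y Z] n_def[symmetric]
          bracket_assoc_graded[OF y z n(1)])
    also have "\<dots> = finprod (lc_quotient G m) (\<lambda>i. ?\<delta> (bracket_term y z n i)) {1..<n}"
      using bracket_term_closed[OF y z] by (intro hom_finprod_lc_quotient[OF \<delta>_hom n(1) m]) auto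
    also have "\<dots> = finprod (lc_quotient G m)
        (\<lambda>i. bracket_term (D y) z m (i + d) \<otimes>\<^bsub>lc_quotient G m\<^esub> bracket_term y (D z) m i) {1..<n}"
    proof (rule m.finprod_cong')
      fix i assume i: "i \<in> {1..<n}"
      have yz: "y i \<in> lower_central G i" "z (n - i) \<in> lower_central G (n - i)"
        and c: "y i \<in> carrier G" "z (n - i) \<in> carrier G"
        using i graded_repsD[OF y] graded_repsD[OF z] by auto
      have D: "D y (i + d) = k (y i) \<otimes> inv (y i)" "D z (m - i) = k (z (n - i)) \<otimes> inv (z (n - i))"
        using i n by (auto simp: D_def ac_simps)
      have Dc: "D y (i + d) \<in> lower_central G (i + d)" "D z (m - i) \<in> lower_central G (n - i + d)"
        using graded_repsD(1)[OF Dy, of "i + d"] graded_repsD(1)[OF Dz, of "m - i"] i n by (auto simp: ac_simps)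
      have kc: "k (y i) = D y (i + d) \<otimes> y i" "k (z (n - i)) = D z (m - i) \<otimes> z (n - i)"
        unfolding D using c by (simp_all add: m_assoc)
      have cm: "commutator G (y i) (z (n - i)) \<in> lower_central G n"
        using lower_central_commutator[OF yz] i by (simp add: Suc_le_eq)
      have "?\<delta> (bracket_term y z n i) =
          lc_proj (Suc m) (commutator G (k (y i)) (k (z (n - i))) \<otimes> inv (commutator G (y i) (z (n - i))))"
        unfolding bracket_term_def \<delta>[OF cm] using c by (simp add: hom_commutator[OF is_group is_group k(1)])
      also have "\<dots> = lc_proj (Suc m) (commutator G (D y (i + d)) (z (n - i)) \<otimes> commutator G (y i) (D z (m - i)))"
        using commutator_leibniz[OF Dc(1) yz(1) Dc(2) yz(2)] i d n unfolding kc
        by (simp add: Suc_le_eq)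
      also have "\<dots> = bracket_term (D y) z m (i + d) \<otimes>\<^bsub>lc_quotient G m\<^esub> bracket_term y (D z) m i"
        using c Dc lower_central_closed n by (simp add: bracket_term_def lc_quotient_mult)
      finally show "?\<delta> (bracket_term y z n i) = bracket_term (D y) z m (i + d) \<otimes>\<^bsub>lc_quotient G m\<^esub> bracket_term y (D z) m i" .
    next
      show "(\<lambda>i. bracket_term (D y) z m (i + d) \<otimes>\<^bsub>lc_quotient G m\<^esub> bracket_term y (D z) m i)
          \<in> {1..<n} \<rightarrow> carrier (lc_quotient G m)"
        using n by (intro Pi_I m.m_closed bracket_term_closed[OF Dy z] bracket_term_closed[OF y Dz]) auto
    qed simp
    also have "\<dots> = finprod (lc_quotient G m) (\<lambda>i. bracket_term (D y) z m (i + d)) {1..<n} \<otimes>\<^bsub>lc_quotient G m\<^esub>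
        finprod (lc_quotient G m) (bracket_term y (D z) m) {1..<n}"
      using bracket_term_closed[OF Dy z] bracket_term_closed[OF y Dz] n by (intro m.finprod_multf) auto
    also have "finprod (lc_quotient G m) (\<lambda>i. bracket_term (D y) z m (i + d)) {1..<n} =
        finprod (lc_quotient G m) (bracket_term (D y) z m) ((\<lambda>i. i + d) ` {1..<n})"
      using bracket_term_closed[OF Dy z] n by (intro m.finprod_reindex[symmetric]) auto
    also have "\<dots> = finprod (lc_quotient G m) (bracket_term (D y) z m) {1..<m}"
    proof (rule m.finprod_mono_neutral_cong_left)
      fix i assume i: "i \<in> {1..<m} - (\<lambda>i. i + d) ` {1..<n}"
      have "i \<le> d"
      proof (rule ccontr)
        assume "\<not> i \<le> d"
        then have "i - d \<in> {1..<n}" "i = i - d + d" using i n by auto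
        then show False using i by blast
      qed
      then show "bracket_term (D y) z m i = \<one>\<^bsub>lc_quotient G m\<^esub>" using i by (intro one) auto
    qed (use bracket_term_closed[OF Dy z] n in auto)
    also have "finprod (lc_quotient G m) (bracket_term y (D z) m) {1..<n} =
        finprod (lc_quotient G m) (bracket_term y (D z) m) {1..<m}"
      using bracket_term_closed[OF y Dz] n by (intro m.finprod_mono_neutral_cong_left one') auto
    finally show ?thesis unfolding rhs .
  qed
qed (simp_all add: graded_displacement_def assoc_graded_mult bracket_closed[OF Y Z])

lemma graded_displacement_derivation:
  assumes k: "k \<in> hom G G" "displaces k d" and d: "d \<ge> 1"
  shows "graded_displacement d k \<in> derivations (assoc_graded G)"
  unfolding derivations_def
proof (intro CollectI conjI ballI IntI)
  show "graded_displacement d k \<in> hom (assoc_graded G) (assoc_graded G)"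
    using graded_displacement_closed[OF k] graded_displacement_hom[OF k] mult_closed_assoc_graded
    by (intro homI) auto
  show "graded_displacement d k \<in> extensional (carrier (assoc_graded G))"
    by (simp add: graded_displacement_def)
qed (rule graded_displacement_leibniz[OF k d])

lemma graded_displacement_homogeneous:
  assumes k: "k \<in> hom G G" "displaces k d" and d: "d \<ge> 1"
  shows "homogeneous_derivation G (graded_displacement d k)"
  unfolding homogeneous_derivation_def
proof (intro conjI exI[of _ d] allI impI ballI)
  show "graded_displacement d k \<in> carrier (Der (assoc_graded G))"
    using graded_displacement_derivation[OF assms] by (simp add: Der_def)
  interpret k: group_hom G G k using k(1) is_group by (simp add: group_hom_def group_hom_axioms_def)
  fix i X assume i: "1 \<le> i" and X: "X \<in> graded_part G i"
  then have Xc: "X \<in> carrier (assoc_graded G)" by (simp add: graded_part_def)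
  have "graded_displacement d k X m = \<one>\<^bsub>lc_quotient G m\<^esub>" if m: "m \<ge> 1" "m \<noteq> i + d" for m
  proof (cases "d < m")
    case True
    then have "X (m - d) = lc_proj (Suc (m - d)) \<one>"
      using X m by (simp add: graded_part_def one_lc_quotient)
    then show ?thesis
      using True m Xc class_action_singleton[OF k one_lower_central, of "m - d"]
      by (simp add: graded_displacement_def one_lc_quotient)
  qed (use m Xc in \<open>simp add: graded_displacement_def\<close>)
  then show "graded_displacement d k X \<in> graded_part G (i + d)"
    using graded_displacement_closed[OF k Xc] by (simp add: graded_part_def)
qed

end

section \<open>Inner automorphisms and the Andreadakis equality\<close>

context group begin

lemma homogeneous_reps:
  assumes "x \<in> lower_central G d" "\<And>m. m \<ge> 1 \<Longrightarrow> X m = (if m = d then lc_proj (Suc d) x else \<one>\<^bsub>lc_quotient G m\<^esub>)"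
  shows "graded_reps X (\<lambda>m. if m = d then x else \<one>)"
  using assms by (auto simp: graded_reps_def one_lc_quotient)

lemma homogeneous_closed:
  assumes "x \<in> lower_central G d"
  shows "(\<lambda>m\<in>{1..}. if m = d then lc_proj (Suc d) x else \<one>\<^bsub>lc_quotient G m\<^esub>) \<in> carrier (assoc_graded G)"
    (is "?X \<in> _")
proof (rule carrier_assoc_gradedI)
  show "?X m \<in> carrier (lc_quotient G m)" if "m \<ge> 1" for m
    using that assms by (auto simp: one_lc_quotient)
  show "finite {m \<in> {1..}. ?X m \<noteq> \<one>\<^bsub>lc_quotient G m\<^esub>}"
    by (rule finite_subset[of _ "{d}"]) auto
qed simp

lemma lower_central_aut_subgroup_subset:
  assumes "subgroup K (AutoGroup G)" "K \<subseteq> IA G" "j \<ge> 1"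
  shows "lower_central (aut_subgroup G K) j \<subseteq> lower_central (aut_subgroup G (IA G)) j"
    "lower_central (aut_subgroup G K) j \<subseteq> andreadakis_filtration G j"
    "lower_central (aut_subgroup G K) j \<subseteq> K"
proof -
  interpret A: group "AutoGroup G" by (rule AutoGroup)
  interpret K: group "aut_subgroup G K" using assms(1) by (rule A.subgroup_imp_group)
  show 1: "lower_central (aut_subgroup G K) j \<subseteq> lower_central (aut_subgroup G (IA G)) j"
    using assms by (intro A.subgroup_lower_central_mono subgroup_IA)
  show "lower_central (aut_subgroup G K) j \<subseteq> andreadakis_filtration G j"
    using 1 lower_central_IA_subset[OF assms(3)] by (rule subset_trans)
  show "lower_central (aut_subgroup G K) j \<subseteq> K" using K.lower_central_closed by auto
qed

text \<open>In each degree only the summand at which \<open>X\<close> is the class of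
  \<open>k\<close> survives. Other representatives of this class differ by elements of
  \<open>\<A>(d + 1)\<close>, which do not affect the leading displacement.\<close>

lemma johnson_homogeneous:
  assumes K: "subgroup K (AutoGroup G)" "K \<subseteq> IA G" and d: "d \<ge> 1"
    and k: "k \<in> lower_central (aut_subgroup G K) d"
    and X: "\<And>m. m \<ge> 1 \<Longrightarrow> X m = (if m = d then group.lc_proj (aut_subgroup G K) (Suc d) k
      else \<one>\<^bsub>lc_quotient (aut_subgroup G K) m\<^esub>)"
  shows "johnson G X = graded_displacement d k"
proof (rule extensionalityI[of _ "carrier (assoc_graded G)"])
  fix Y assume Y: "Y \<in> carrier (assoc_graded G)"
  let ?K = "aut_subgroup G K"
  interpret A: group "AutoGroup G" by (rule AutoGroup)
  interpret K: group "?K" using K(1) by (rule A.subgroup_imp_group)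
  obtain y where y: "graded_reps Y y" using graded_repsE[OF Y] .
  have kA: "k \<in> auto G" "displaces k d"
    using k lower_central_aut_subgroup_subset(2)[OF K d] by (auto simp: andreadakis_filtration_iff)
  note kh = auto_hom[OF kA(1)] kA(2)
  let ?f = "\<lambda>m i. class_action G (m - i) i (X (m - i)) (Y i)"
  have eq_d: "?f m i = lc_proj (Suc m) (k (y i) \<otimes> inv (y i))"
    if i: "i \<in> {1..<m}" "m - i = d" for m i
  proof -
    have i1: "1 \<le> i" and m: "i + d = m" using i by auto
    have "class_action G d i (K.lc_proj (Suc d) k) (lc_proj (Suc i) (y i)) = lc_proj (Suc (i + d)) (k (y i) \<otimes> inv (y i))"
    proof (rule class_action_lc_proj[OF kh graded_repsD(1)[OF y i1] i1])
      show "K.lc_proj (Suc d) k \<noteq> {}" using K.lc_proj_self[OF K.lower_central_closed[OF k]] by blast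
      fix k' assume "k' \<in> K.lc_proj (Suc d) k"
      then obtain c where c: "c \<in> lower_central ?K (Suc d)" "k' = c \<otimes>\<^bsub>AutoGroup G\<^esub> k"
        using K.lc_proj_mem[OF K.lower_central_closed[OF k]] by auto
      have cA: "c \<in> auto G" "displaces c (Suc d)"
        using c(1) lower_central_aut_subgroup_subset(2)[OF K, of "Suc d"] by (auto simp: andreadakis_filtration_iff)
      show "k' \<in> hom G G" using auto_mult_closed[OF cA(1) kA(1)] c(2) auto_hom by simp
      fix h assume h: "h \<in> lower_central G i"
      then have "k h \<in> lower_central G i" using auto_lower_central[OF kA(1)] by simp
      then have "c (k h) \<otimes> inv (k h) \<in> lower_central G (i + Suc d)"
        by (rule displacesD[OF cA(2) i1])
      then show "k' h \<otimes> inv (k h) \<in> lower_central G (Suc (i + d))"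
        using lower_central_closed[OF h] by (simp add: c(2) auto_mult_apply[OF cA(1) kA(1)])
    qed
    then show ?thesis
      using X[OF d] graded_repsD(2)[OF y i1] i(2) m by simp
  qed
  have neq_d: "?f m i = \<one>\<^bsub>lc_quotient G m\<^esub>"
    if i: "i \<in> {1..<m}" "m - i \<noteq> d" for m i
  proof -
    have i1: "1 \<le> i" "1 \<le> m - i" and m: "i + (m - i) = m" using i by auto
    \<comment> \<open>The zero class of \<open>K\<close> in degree \<open>m - i\<close> is the next
      lower central term itself; its elements act to this order like \<open>id\<close>, which
      displaces by any amount.\<close>
    have "class_action G (m - i) i (lower_central ?K (Suc (m - i))) (lc_proj (Suc i) (y i)) =
        lc_proj (Suc (i + (m - i))) (id (y i) \<otimes> inv (y i))"
    proof (rule class_action_lc_proj[OF _ _ graded_repsD(1)[OF y i1(1)] i1(1)])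
      show "id \<in> hom G G" by (rule homI) auto
      show "displaces id (m - i)" using lower_central_closed by (auto simp: displaces_def)
      show "lower_central ?K (Suc (m - i)) \<noteq> {}" using K.one_lower_central by blast
      fix c assume "c \<in> lower_central ?K (Suc (m - i))"
      then have cA: "c \<in> auto G" "displaces c (Suc (m - i))"
        using lower_central_aut_subgroup_subset(2)[OF K, of "Suc (m - i)"] by (auto simp: andreadakis_filtration_iff)
      show "c \<in> hom G G" using cA(1) by (rule auto_hom)
      fix h assume h: "h \<in> lower_central G i"
      then show "c h \<otimes> inv (id h) \<in> lower_central G (Suc (i + (m - i)))"
        using displacesD[OF cA(2) i1(1) h] by simp
    qed
    then show ?thesis
      using X[OF i1(2)] graded_repsD(2,3)[OF y i1(1)] i(2)
      by (simp add: m one_lc_quotient) (simp add: lc_quotient_def)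
  qed
  show "johnson G X Y = graded_displacement d k Y"
  proof (rule extensionalityI[of _ "{1..}"])
    fix m :: nat assume "m \<in> {1..}"
    then have m: "m \<ge> 1" by simp
    interpret m: comm_group "lc_quotient G m" using m by (rule comm_group_lc_quotient)
    have J: "johnson G X Y m = finprod (lc_quotient G m) (?f m) {1..<m}"
      using m Y by (simp add: johnson_def)
    show "johnson G X Y m = graded_displacement d k Y m"
    proof (cases "d < m")
      case True
      have mem: "lc_proj (Suc m) (k (y (m - d)) \<otimes> inv (y (m - d))) \<in> carrier (lc_quotient G m)"
        using displacesD[OF kA(2) _ graded_repsD(1)[OF y], of "m - d"] True
        by (intro lc_proj_carrier_lc_quotient) (simp add: Suc_le_eq)
      have "finprod (lc_quotient G m) (?f m) {1..<m} = finprod (lc_quotient G m)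
          (\<lambda>i. if i = m - d then lc_proj (Suc m) (k (y (m - d)) \<otimes> inv (y (m - d))) else \<one>\<^bsub>lc_quotient G m\<^esub>) {1..<m}"
      proof (rule m.finprod_cong')
        fix i assume i: "i \<in> {1..<m}"
        show "?f m i = (if i = m - d then lc_proj (Suc m) (k (y (m - d)) \<otimes> inv (y (m - d))) else \<one>\<^bsub>lc_quotient G m\<^esub>)"
        proof (cases "i = m - d")
          case i': True
          then have "m - i = d" using True by simp
          from eq_d[OF i this] show ?thesis using i' by simp
        next
          case False
          then have "m - i \<noteq> d" using i by auto
          from neq_d[OF i this] show ?thesis using False by simp
        qed
      qed (use mem in auto)
      also have "\<dots> = lc_proj (Suc m) (k (y (m - d)) \<otimes> inv (y (m - d)))"
        using True d mem by (intro m.finprod_singleton_swap[of "m - d" "{1..<m}" "\<lambda>_. lc_proj (Suc m) (k (y (m - d)) \<otimes> inv (y (m - d)))"]) auto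
      finally show ?thesis
        unfolding J graded_displacement_apply[OF kh Y y m] using True by simp
    next
      case False
      have "finprod (lc_quotient G m) (?f m) {1..<m} = \<one>\<^bsub>lc_quotient G m\<^esub>"
        using False by (intro m.finprod_one_eqI neq_d) auto
      then show ?thesis
        unfolding J graded_displacement_apply[OF kh Y y m] using False by (simp add: one_lc_quotient)
    qed
  qed (use Y in \<open>simp_all add: johnson_def graded_displacement_def\<close>)
qed (simp_all add: johnson_def graded_displacement_def)

text \<open>Bracketing with a class of degree \<open>d\<close> leaves one summand in each degree
  above \<open>d\<close>, and \<open>eq\<close> says that conjugation by \<open>g\<close> and
  \<open>k\<close> agree on it to leading order.\<close>

lemma ad_homogeneous:
  assumes g: "g \<in> lower_central G d" and d: "d \<ge> 1" and k: "k \<in> hom G G" "displaces k d"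
    and eq: "\<And>i h. \<lbrakk>i \<ge> 1; h \<in> lower_central G i\<rbrakk> \<Longrightarrow>
      lc_proj (Suc (i + d)) (commutator G g h) = lc_proj (Suc (i + d)) (k h \<otimes> inv h)"
  shows "ad (assoc_graded G) (\<lambda>m\<in>{1..}. if m = d then lc_proj (Suc d) g else \<one>\<^bsub>lc_quotient G m\<^esub>) =
    graded_displacement d k" (is "ad _ ?Z = _")
proof (rule extensionalityI[of _ "carrier (assoc_graded G)"])
  fix Y assume Y: "Y \<in> carrier (assoc_graded G)"
  obtain y where y: "graded_reps Y y" using graded_repsE[OF Y] .
  have Z: "graded_reps ?Z (\<lambda>m. if m = d then g else \<one>)"
    by (rule homogeneous_reps[OF g]) simp
  let ?z = "\<lambda>m. if m = d then g else \<one>"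
  have Zc: "?Z \<in> carrier (assoc_graded G)" by (rule homogeneous_closed[OF g])
  show "ad (assoc_graded G) ?Z Y = graded_displacement d k Y"
  proof (rule extensionalityI[of _ "{1..}"])
    fix m :: nat assume "m \<in> {1..}"
    then have m: "m \<ge> 1" by simp
    interpret m: comm_group "lc_quotient G m" using m by (rule comm_group_lc_quotient)
    have A: "ad (assoc_graded G) ?Z Y m = finprod (lc_quotient G m) (bracket_term ?z y m) {1..<m}"
      using Y bracket_assoc_graded[OF Z y m] by (simp add: ad_def)
    have one: "bracket_term ?z y m i = \<one>\<^bsub>lc_quotient G m\<^esub>" if "i \<in> {1..<m}" "i \<noteq> d" for i
      using that by (intro bracket_term_eq_one[OF Z y]) auto
    show "ad (assoc_graded G) ?Z Y m = graded_displacement d k Y m"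
    proof (cases "d < m")
      case True
      then have dm: "d \<in> {1..<m}" "1 \<le> m - d" using d by auto
      have "finprod (lc_quotient G m) (bracket_term ?z y m) {1..<m} =
          finprod (lc_quotient G m) (\<lambda>i. if i = d then bracket_term ?z y m d else \<one>\<^bsub>lc_quotient G m\<^esub>) {1..<m}"
        using one bracket_term_closed[OF Z y dm(1)] by (intro m.finprod_cong') auto
      also have "\<dots> = bracket_term ?z y m d"
        using dm bracket_term_closed[OF Z y dm(1)]
        by (intro m.finprod_singleton_swap[of d "{1..<m}" "\<lambda>_. bracket_term ?z y m d"]) auto
      also have "\<dots> = lc_proj (Suc m) (k (y (m - d)) \<otimes> inv (y (m - d)))"
        using eq[OF dm(2) graded_repsD(1)[OF y dm(2)]] True by (simp add: bracket_term_def)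
      finally show ?thesis
        unfolding A graded_displacement_apply[OF k Y y m] using True by simp
    next
      case False
      have "finprod (lc_quotient G m) (bracket_term ?z y m) {1..<m} = \<one>\<^bsub>lc_quotient G m\<^esub>"
        using False by (intro m.finprod_one_eqI one) auto
      then show ?thesis
        unfolding A graded_displacement_apply[OF k Y y m] using False by (simp add: one_lc_quotient)
    qed
  next
    show "ad (assoc_graded G) ?Z Y \<in> extensional {1..}"
      using Y bracket_closed[OF Zc Y] by (simp add: ad_def carrier_assoc_graded PiE_def)
  qed (use Y in \<open>simp add: graded_displacement_def\<close>)
qed (simp_all add: ad_def graded_displacement_def)

text \<open>Evaluate both derivations at the class of \<open>h\<close> and read off degree
  \<open>i + d\<close>. If \<open>e\<close> differs from \<open>d\<close>, the second derivation has
  no component there.\<close>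

lemma graded_displacement_eqD:
  assumes k: "k \<in> hom G G" "displaces k d" and l: "l \<in> hom G G" "displaces l e"
    and eq: "graded_displacement d k = graded_displacement e l"
    and i: "i \<ge> 1" and h: "h \<in> lower_central G i" and d: "d \<ge> 1"
  shows "d = e \<Longrightarrow> k h \<otimes> inv (l h) \<in> lower_central G (i + Suc d)"
    and "d \<noteq> e \<Longrightarrow> k h \<otimes> inv h \<in> lower_central G (i + Suc d)"
proof -
  interpret k: group_hom G G k using k(1) is_group by (simp add: group_hom_def group_hom_axioms_def)
  interpret l: group_hom G G l using l(1) is_group by (simp add: group_hom_def group_hom_axioms_def)
  let ?Y = "\<lambda>m\<in>{1..}. if m = i then lc_proj (Suc i) h else \<one>\<^bsub>lc_quotient G m\<^esub>"
  let ?y = "\<lambda>m. if m = i then h else \<one>"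
  have Y: "?Y \<in> carrier (assoc_graded G)" by (rule homogeneous_closed[OF h])
  have y: "graded_reps ?Y ?y" by (rule homogeneous_reps[OF h]) simp
  have hc: "h \<in> carrier G" using h by (rule lower_central_closed)
  have id: "1 \<le> i + d" using i by simp
  have "lc_proj (Suc (i + d)) (k h \<otimes> inv h) = graded_displacement d k ?Y (i + d)"
    unfolding graded_displacement_apply[OF k Y y id] using i by simp
  also have "\<dots> = graded_displacement e l ?Y (i + d)" unfolding eq ..
  finally have *: "lc_proj (Suc (i + d)) (k h \<otimes> inv h) =
      lc_proj (Suc (i + d)) (if e < i + d then l (?y (i + d - e)) \<otimes> inv (?y (i + d - e)) else \<one>)"
    unfolding graded_displacement_apply[OF l Y y id] .
  show "k h \<otimes> inv (l h) \<in> lower_central G (i + Suc d)" if "d = e"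
  proof -
    have "lc_proj (Suc (i + d)) (k h \<otimes> inv h) = lc_proj (Suc (i + d)) (l h \<otimes> inv h)"
      using * that i by simp
    then have "(k h \<otimes> inv h) \<otimes> inv (l h \<otimes> inv h) \<in> lower_central G (Suc (i + d))"
      using hc by (subst (asm) lc_proj_eq_iff) simp_all
    then show ?thesis using hc by (simp add: word_simps)
  qed
  show "k h \<otimes> inv h \<in> lower_central G (i + Suc d)" if "d \<noteq> e"
  proof -
    have "i + d - e \<noteq> i \<or> \<not> e < i + d" using that by auto
    then have "lc_proj (Suc (i + d)) (k h \<otimes> inv h) = lc_proj (Suc (i + d)) \<one>"
      using * by (auto split: if_splits)
    then show ?thesis using hc by (subst (asm) lc_proj_eq_iff) simp_all
  qed
qed

text \<open>Gives \<open>graded_class\<close> the one form that \<open>johnson_homogeneous\<close>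
  accepts; a zero class is represented by the identity automorphism in degree one.\<close>

lemma graded_class_homogeneous:
  assumes "subgroup K (AutoGroup G)" "x \<in> K"
  obtains e y where "e \<ge> 1" "y \<in> lower_central (aut_subgroup G K) e" "y = x \<or> y = \<one>\<^bsub>AutoGroup G\<^esub>"
    "\<And>m. m \<ge> 1 \<Longrightarrow> graded_class (aut_subgroup G K) x m =
      (if m = e then group.lc_proj (aut_subgroup G K) (Suc e) y else \<one>\<^bsub>lc_quotient (aut_subgroup G K) m\<^esub>)"
proof -
  let ?K = "aut_subgroup G K"
  interpret A: group "AutoGroup G" by (rule AutoGroup)
  interpret K: group "?K" using assms(1) by (rule A.subgroup_imp_group)
  show ?thesis
  proof (cases "\<exists>e\<ge>1. x \<in> lower_central ?K e - lower_central ?K (Suc e)")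
    case True
    then obtain e where e: "e \<ge> 1" "x \<in> lower_central ?K e" "x \<notin> lower_central ?K (Suc e)" by auto
    have unique: "m = e" if "x \<in> lower_central ?K m" "x \<notin> lower_central ?K (Suc m)" for m
      using that e K.lower_central_antimono[of "Suc m" e] K.lower_central_antimono[of "Suc e" m]
      by (cases m e rule: linorder_cases) (auto simp: Suc_le_eq)
    show ?thesis
    proof (rule that[OF e(1,2)])
      show "graded_class ?K x m = (if m = e then K.lc_proj (Suc e) x else \<one>\<^bsub>lc_quotient ?K m\<^esub>)" if "m \<ge> 1" for m
      proof (cases "m = e")
        case True
        then show ?thesis using e by (simp add: graded_class_def K.lc_proj_def)
      next
        case False
        then have "x \<notin> lower_central ?K m - lower_central ?K (Suc m)" using unique by blast
        then show ?thesis using that False by (auto simp: graded_class_def)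
      qed
    qed simp
  next
    case False
    show ?thesis
    proof (rule that[of 1 "\<one>\<^bsub>?K\<^esub>"])
      show "graded_class ?K x m = (if m = 1 then K.lc_proj (Suc 1) \<one>\<^bsub>?K\<^esub> else \<one>\<^bsub>lc_quotient ?K m\<^esub>)"
        if "m \<ge> 1" for m
        using that False K.one_lc_quotient[of 1] by (auto simp: graded_class_def)
    qed (use subgroup.one_closed[OF assms(1)] in auto)
  qed
qed

text \<open>Both inclusions in the Andreadakis equality hold for every subgroup of
  \<open>IA G\<close>, so returning from the last set to the first closes the circle.\<close>

lemma andreadakis_equalityI:
  assumes M: "subgroup M (AutoGroup G)" "M \<subseteq> IA G"
    and "\<And>j. j \<ge> 1 \<Longrightarrow> M \<inter> andreadakis_filtration G j \<subseteq> lower_central (aut_subgroup G M) j"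
  shows "andreadakis_equality G M"
proof -
  interpret A: group "AutoGroup G" by (rule AutoGroup)
  have "subgroup M (aut_subgroup G (IA G))" by (rule A.subgroup_incl[OF M(1) subgroup_IA M(2)])
  moreover have "lower_central (aut_subgroup G M) j = M \<inter> lower_central (aut_subgroup G (IA G)) j"
    "M \<inter> lower_central (aut_subgroup G (IA G)) j = M \<inter> andreadakis_filtration G j" if "j \<ge> 1" for j
    using lower_central_aut_subgroup_subset[OF M that] assms(3)[OF that] lower_central_IA_subset[OF that]
    by blast+
  ultimately show ?thesis by (simp add: andreadakis_equality_def)
qed

text \<open>If \<open>c\<^sub>g k\<close> displaces by \<open>d + 1\<close> then the class of \<open>k\<close> acts as \<open>- ad g\<close>, so the hypothesis yields
  an inner automorphism in \<open>K\<close> by which \<open>k\<close> can be corrected.\<close>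

lemma inner_correction:
  assumes K: "subgroup K (AutoGroup G)" "K \<subseteq> IA G"
    and eq: "\<And>j. j \<ge> 1 \<Longrightarrow> K \<inter> andreadakis_filtration G j \<subseteq> lower_central (aut_subgroup G K) j"
    and lift: "\<And>D. D \<in> johnson G ` carrier (assoc_graded (aut_subgroup G K))
               \<inter> ad (assoc_graded G) ` carrier (assoc_graded G) \<Longrightarrow>
             homogeneous_derivation G D \<Longrightarrow>
             \<exists>x\<in>K \<inter> Inn G. D = johnson G (graded_class (aut_subgroup G K) x)"
    and center: "\<And>g j. \<lbrakk>g \<in> carrier G; j \<ge> 1; displaces (conj_auto g) j\<rbrakk> \<Longrightarrow> g \<in> lower_central G j"
    and d: "d \<ge> 1" and g: "g \<in> carrier G" and k: "k \<in> K" "k \<in> andreadakis_filtration G d"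
    and gk: "conj_auto g \<otimes>\<^bsub>AutoGroup G\<^esub> k \<in> andreadakis_filtration G (Suc d)"
  shows "\<exists>g'\<in>carrier G. \<exists>k'\<in>K \<inter> andreadakis_filtration G (Suc d).
    conj_auto g \<otimes>\<^bsub>AutoGroup G\<^esub> k = conj_auto g' \<otimes>\<^bsub>AutoGroup G\<^esub> k'"
proof -
  let ?A = "AutoGroup G" and ?K = "aut_subgroup G K"
  interpret A: group "?A" by (rule AutoGroup)
  interpret K: group "?K" using K(1) by (rule A.subgroup_imp_group)
  interpret c: group_hom G ?A conj_auto by (rule group_hom_conj_auto)
  have ka: "k \<in> auto G" "displaces k d" using k(2) by (simp_all add: andreadakis_filtration_iff)
  note kh = auto_hom[OF ka(1)] ka(2)
  interpret k: group_hom G G k using ka(1) by (rule auto_group_hom)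
  have ca: "conj_auto g \<in> auto G" using g by (rule conj_auto_auto)
  \<comment> \<open>Cancelling \<open>k\<close> shows that \<open>c\<^sub>g\<close> is in
    \<open>\<A>(d)\<close>, so that \<open>center\<close> applies to \<open>g\<close>.\<close>
  have "(conj_auto g \<otimes>\<^bsub>?A\<^esub> k) \<otimes>\<^bsub>?A\<^esub> inv\<^bsub>?A\<^esub> k \<in> andreadakis_filtration G d"
    using subsetD[OF andreadakis_filtration_antimono gk, of d]
    by (intro subgroup.m_closed[OF subgroup_andreadakis_filtration _
        subgroup.m_inv_closed[OF subgroup_andreadakis_filtration k(2)]]) simp
  then have "conj_auto g \<in> andreadakis_filtration G d"
    using ca ka(1) by (simp add: A.m_assoc auto_inv_closed A.r_inv)
  then have "g \<in> lower_central G d" using g d by (intro center) (simp_all add: andreadakis_filtration_iff)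
  then have g': "inv g \<in> lower_central G d" by (rule lower_central_inv)
  have kd: "k \<in> lower_central ?K d" using eq[OF d] k by blast
  let ?X = "\<lambda>m\<in>{1..}. if m = d then K.lc_proj (Suc d) k else \<one>\<^bsub>lc_quotient ?K m\<^esub>"
  let ?Z = "\<lambda>m\<in>{1..}. if m = d then lc_proj (Suc d) (inv g) else \<one>\<^bsub>lc_quotient G m\<^esub>"
  let ?D = "graded_displacement d k"
  have D1: "johnson G ?X = ?D" by (rule johnson_homogeneous[OF K d kd]) simp
  then have D1: "?D \<in> johnson G ` carrier (assoc_graded ?K)"
    by (intro image_eqI[OF _ K.homogeneous_closed[OF kd]]) (rule sym)
  \<comment> \<open>The inverse of \<open>g\<close> appears because \<open>c\<^sub>g k\<close> is
    trivial in degree \<open>d\<close>, so \<open>k\<close> acts there as the inverse of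
    \<open>c\<^sub>g\<close>.\<close>
  have "ad (assoc_graded G) ?Z = ?D"
  proof (rule ad_homogeneous[OF g' d kh])
    fix i h assume i: "i \<ge> 1" and h: "h \<in> lower_central G i"
    have hc: "h \<in> carrier G" using h by (rule lower_central_closed)
    have "conj_auto g (k h) \<otimes> inv h \<in> lower_central G (i + Suc d)"
      using displacesD[of "conj_auto g \<otimes>\<^bsub>?A\<^esub> k" "Suc d" i h] gk i h hc
      by (simp add: andreadakis_filtration_iff auto_mult_apply[OF ca ka(1)])
    \<comment> \<open>This element equals \<open>[inv g, h]\<close> times the inverse of the
      displacement of \<open>h\<close> by \<open>k\<close>.\<close>
    then have "inv g \<otimes> inv (conj_auto g (k h) \<otimes> inv h) \<otimes> inv (inv g) \<in> lower_central G (i + Suc d)"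
      using g by (intro lower_central_conj lower_central_inv) auto
    then show "lc_proj (Suc (i + d)) (commutator G (inv g) h) = lc_proj (Suc (i + d)) (k h \<otimes> inv h)"
      using g hc by (subst lc_proj_eq_iff) (simp_all add: conj_auto_apply commutator_def word_simps)
  qed
  then have D2: "?D \<in> ad (assoc_graded G) ` carrier (assoc_graded G)"
    by (intro image_eqI[OF _ homogeneous_closed[OF g']]) (rule sym)
  obtain x where x: "x \<in> K" "x \<in> Inn G" "?D = johnson G (graded_class ?K x)"
    using lift[OF IntI[OF D1 D2] graded_displacement_homogeneous[OF kh d]] by blast
  obtain e y where e: "e \<ge> 1" and y: "y \<in> lower_central ?K e" "y = x \<or> y = \<one>\<^bsub>?A\<^esub>"
    and cls: "\<And>m. m \<ge> 1 \<Longrightarrow> graded_class ?K x m =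
      (if m = e then K.lc_proj (Suc e) y else \<one>\<^bsub>lc_quotient ?K m\<^esub>)"
    using graded_class_homogeneous[OF K(1) x(1)] by blast
  have ya: "y \<in> auto G" "displaces y e"
    using y(1) lower_central_aut_subgroup_subset(2)[OF K e] by (auto simp: andreadakis_filtration_iff)
  have yK: "y \<in> K" using y(1) lower_central_aut_subgroup_subset(3)[OF K e] by blast
  have Dy: "?D = graded_displacement e y"
    unfolding x(3) by (rule johnson_homogeneous[OF K e y(1) cls])
  note D_eq = graded_displacement_eqD[OF kh auto_hom[OF ya(1)] ya(2) Dy _ _ d]
  show ?thesis
  proof (cases "d = e")
    \<comment> \<open>Derivations of different degrees agree only if both vanish, so
      \<open>k\<close> is already one term deeper and no correction is made.\<close>
    case False
    then have "k \<in> andreadakis_filtration G (Suc d)"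
      using D_eq(2) ka(1) by (simp add: andreadakis_filtration_def)
    then show ?thesis using g k(1) by blast
  next
    case True
    \<comment> \<open>Both possibilities for \<open>y\<close>, the automorphism \<open>x\<close> and
      the identity, are inner.\<close>
    obtain u where u: "u \<in> carrier G" "y = conj_auto u"
    proof (cases "y = x")
      case True
      then show ?thesis using that x(2) by (auto simp: Inn_eq)
    next
      case False
      then show ?thesis using that[of \<one>] y(2) c.hom_one by simp
    qed
    let ?k = "inv\<^bsub>?A\<^esub> y \<otimes>\<^bsub>?A\<^esub> k"
    have yi: "inv\<^bsub>?A\<^esub> y \<in> auto G" using ya(1) by (rule auto_inv_closed)
    interpret yi: group_hom G G "inv\<^bsub>?A\<^esub> y" using yi by (rule auto_group_hom)
    have "?k h \<otimes> inv h \<in> lower_central G (i + Suc d)" if i: "i \<ge> 1" and h: "h \<in> lower_central G i" for i h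
    proof -
      have hc: "h \<in> carrier G" using h by (rule lower_central_closed)
      have "(inv\<^bsub>?A\<^esub> y) (k h \<otimes> inv (y h)) \<in> lower_central G (i + Suc d)"
        using D_eq(1)[OF i h True] by (rule auto_lower_central[OF yi])
      then show ?thesis
        using hc auto_closed[OF ya(1) hc] auto_inv_apply(2)[OF ya(1) hc]
        by (simp add: auto_mult_apply[OF yi ka(1)])
    qed
    then have "?k \<in> andreadakis_filtration G (Suc d)"
      using auto_mult_closed[OF yi ka(1)] by (simp add: andreadakis_filtration_def)
    moreover have "?k \<in> K"
      using yK k(1) K(1) by (intro subgroup.m_closed[OF K(1)] subgroup.m_inv_closed[OF K(1)])
    \<comment> \<open>The factor \<open>y = c\<^sub>u\<close> passes from \<open>k\<close> to the
      inner part.\<close>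
    moreover have "conj_auto g \<otimes>\<^bsub>?A\<^esub> k = conj_auto (g \<otimes> u) \<otimes>\<^bsub>?A\<^esub> ?k"
    proof -
      have "conj_auto (g \<otimes> u) \<otimes>\<^bsub>?A\<^esub> ?k = conj_auto g \<otimes>\<^bsub>?A\<^esub> (y \<otimes>\<^bsub>?A\<^esub> (inv\<^bsub>?A\<^esub> y \<otimes>\<^bsub>?A\<^esub> k))"
        using g u yi ca ya(1) ka(1) by (simp add: conj_auto_mult A.m_assoc auto_mult_closed)
      also have "y \<otimes>\<^bsub>?A\<^esub> (inv\<^bsub>?A\<^esub> y \<otimes>\<^bsub>?A\<^esub> k) = k"
        using ya(1) ka(1) by (intro A.mult_inv_cancel_left) simp_all
      finally show ?thesis ..
    qed
    ultimately show ?thesis using g u(1) by blast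
  qed
qed

text \<open>The argument for any group in which the depth of \<open>g\<close> can be recovered from
  the displacement of \<open>c\<^sub>g\<close>; \<open>center\<close> is where the free group of
  rank at least two will enter.\<close>

theorem Inn_mult_andreadakis_equality:
  assumes K: "subgroup K (AutoGroup G)" "K \<subseteq> IA G"
    and eq: "\<And>j. j \<ge> 1 \<Longrightarrow> K \<inter> andreadakis_filtration G j \<subseteq> lower_central (aut_subgroup G K) j"
    and lift: "\<And>D. D \<in> johnson G ` carrier (assoc_graded (aut_subgroup G K))
               \<inter> ad (assoc_graded G) ` carrier (assoc_graded G) \<Longrightarrow>
             homogeneous_derivation G D \<Longrightarrow>
             \<exists>x\<in>K \<inter> Inn G. D = johnson G (graded_class (aut_subgroup G K) x)"
    and center: "\<And>g j. \<lbrakk>g \<in> carrier G; j \<ge> 1; displaces (conj_auto g) j\<rbrakk> \<Longrightarrow> g \<in> lower_central G j"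
  shows "andreadakis_equality G (Inn G <#>\<^bsub>AutoGroup G\<^esub> K)"
proof (rule andreadakis_equalityI)
  let ?A = "AutoGroup G" and ?M = "Inn G <#>\<^bsub>AutoGroup G\<^esub> K"
  interpret A: group "?A" by (rule AutoGroup)
  interpret c: group_hom G ?A conj_auto by (rule group_hom_conj_auto)
  show M: "subgroup ?M ?A" by (rule A.mult_norm_subgroup[OF normal_Inn K(1)])
  interpret M: group "aut_subgroup G ?M" using M by (rule A.subgroup_imp_group)
  show "?M \<subseteq> IA G"
    using subgroup.m_closed[OF subgroup_IA] Inn_subset_IA K(2) by (auto simp: set_mult_def)
  have KM: "K \<subseteq> ?M"
    using subgroup.subset[OF A.subgroup_of_normal_set_mult[OF normal_Inn K(1)]] by simp
  have IM: "Inn G \<subseteq> ?M"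
    using subgroup.subset[OF normal_imp_subgroup[OF A.normal_in_normal_set_mult[OF normal_Inn K(1)]]] by simp
  fix j :: nat assume j: "j \<ge> 1"
  show "?M \<inter> andreadakis_filtration G j \<subseteq> lower_central (aut_subgroup G ?M) j"
  proof
    fix f assume f: "f \<in> ?M \<inter> andreadakis_filtration G j"
    \<comment> \<open>The automorphism \<open>f\<close> stays fixed while its decomposition changes
      with \<open>d\<close>; \<open>d \<le> j\<close> keeps \<open>f\<close> deep enough for each
      correction.\<close>
    have "\<exists>g\<in>carrier G. \<exists>k\<in>K \<inter> andreadakis_filtration G d. f = conj_auto g \<otimes>\<^bsub>?A\<^esub> k" if "1 \<le> d" "d \<le> j" for d
      using that
    proof (induction d rule: dec_induct)
      case base
      have "\<exists>g\<in>carrier G. \<exists>k\<in>K. f = conj_auto g \<otimes>\<^bsub>?A\<^esub> k"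
        using f by (auto simp: set_mult_def Inn_eq)
      then show ?case using K(2) by (auto simp: IA_eq_andreadakis_filtration)
    next
      case (step d)
      then obtain g k where gk: "g \<in> carrier G" "k \<in> K" "k \<in> andreadakis_filtration G d"
        "f = conj_auto g \<otimes>\<^bsub>?A\<^esub> k" by auto
      have "f \<in> andreadakis_filtration G (Suc d)"
        using f andreadakis_filtration_antimono[OF step.prems] by blast
      then show ?case
        using inner_correction[OF K eq lift center step.hyps(1) gk(1-3)] unfolding gk(4) by blast
    qed
    from this[OF j order_refl] obtain g k where gk: "g \<in> carrier G" "k \<in> K" "k \<in> andreadakis_filtration G j"
      "f = conj_auto g \<otimes>\<^bsub>?A\<^esub> k" by auto
    have ka: "k \<in> auto G" using gk(3) by (simp add: andreadakis_filtration_iff)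
    have "f \<otimes>\<^bsub>?A\<^esub> inv\<^bsub>?A\<^esub> k \<in> andreadakis_filtration G j"
      using f by (intro subgroup.m_closed[OF subgroup_andreadakis_filtration _
          subgroup.m_inv_closed[OF subgroup_andreadakis_filtration gk(3)]]) simp
    then have "conj_auto g \<in> andreadakis_filtration G j"
      using conj_auto_auto[OF gk(1)] ka by (simp add: gk(4) A.m_assoc auto_inv_closed A.r_inv)
    then have gj: "g \<in> lower_central G j"
      using gk(1) j by (intro center) (simp_all add: andreadakis_filtration_iff)
    \<comment> \<open>As a homomorphism into \<open>Inn(G) K\<close>, conjugation carries
      \<open>\<Gamma>(j)\<close> of \<open>G\<close> into the term of index \<open>j\<close> of that
      group.\<close>
    have "conj_auto \<in> hom G (aut_subgroup G ?M)"
      using IM conj_auto_mult by (intro homI) (auto simp: Inn_eq)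
    then have 1: "conj_auto g \<in> lower_central (aut_subgroup G ?M) j"
      using hom_lower_central[OF is_group M.is_group] gj by blast
    have 2: "k \<in> lower_central (aut_subgroup G ?M) j"
      using eq[OF j] gk(2,3) A.subgroup_lower_central_mono[OF K(1) M KM] by blast
    from M.lower_central_mult[OF 1 2] show "f \<in> lower_central (aut_subgroup G ?M) j"
      by (simp add: gk(4))
  qed
qed

end

theorem corollary5p1:
  fixes n :: nat and K :: "((nat \<times> bool) list \<Rightarrow> (nat \<times> bool) list) set"
  assumes "subgroup K (aut_subgroup (F n) (IA (F n)))"
    and "andreadakis_equality (F n) K"
    and "\<And>D. D \<in> johnson (F n) ` carrier (assoc_graded (aut_subgroup (F n) K))
               \<inter> ad (assoc_graded (F n)) ` carrier (assoc_graded (F n)) \<Longrightarrow>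
             homogeneous_derivation (F n) D \<Longrightarrow>
             \<exists>x\<in>K \<inter> Inn (F n). D = johnson (F n) (graded_class (aut_subgroup (F n) K) x)"
  shows "andreadakis_equality (F n) (Inn (F n) <#>\<^bsub>AutoGroup (F n)\<^esub> K)"
proof -
  interpret group "F n" by (rule group_free_group)
  interpret A: group "AutoGroup (F n)" by (rule AutoGroup)
  have K: "subgroup K (AutoGroup (F n))" "K \<subseteq> IA (F n)"
    using A.incl_subgroup[OF subgroup_IA assms(1)] subgroup.subset[OF assms(1)] by simp_all
  show ?thesis
  proof (cases "n \<ge> 2")
    case True
    show ?thesis
    proof (rule Inn_mult_andreadakis_equality[OF K _ assms(3)])
      show "K \<inter> andreadakis_filtration (F n) j \<subseteq> lower_central (aut_subgroup (F n) K) j" if "j \<ge> 1" for j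
        using assms(2) that by (simp add: andreadakis_equality_def)
      show "g \<in> lower_central (F n) j"
        if "g \<in> carrier (F n)" "j \<ge> 1" "displaces (conj_auto g) j" for g j
        using that True by (intro free_group_displaces_conj[of "{..<n}" 0 1]) auto
    qed
  next
    \<comment> \<open>The group is cyclic, hence abelian, so \<open>IA\<close> and with it the whole
      product is trivial.\<close>
    case False
    have IA: "IA (F n) = {\<one>\<^bsub>AutoGroup (F n)\<^esub>}"
      using False by (intro IA_commutative free_group_commute) auto
    let ?M = "Inn (F n) <#>\<^bsub>AutoGroup (F n)\<^esub> K"
    have M: "subgroup ?M (AutoGroup (F n))" by (rule A.mult_norm_subgroup[OF normal_Inn K(1)])
    have "?M \<subseteq> IA (F n)"
      using subgroup.m_closed[OF subgroup_IA] Inn_subset_IA K(2) by (auto simp: set_mult_def)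
    then show ?thesis
    proof (rule andreadakis_equalityI[OF M])
      fix j :: nat assume "j \<ge> 1"
      have "\<one>\<^bsub>AutoGroup (F n)\<^esub> \<in> lower_central (aut_subgroup (F n) ?M) j"
        using group.one_lower_central[OF A.subgroup_imp_group[OF M]] by simp
      then show "?M \<inter> andreadakis_filtration (F n) j \<subseteq> lower_central (aut_subgroup (F n) ?M) j"
        using \<open>?M \<subseteq> IA (F n)\<close> unfolding IA by blast
    qed
  qed
qed

end
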